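(* Let $X$ and $Y$ be Polish spaces with non-atomic infinite $\sigma$-finite Borel measures $\mu$ and $\nu$ respectively. Suppose that each of $X$ and $Y$ has at least one open subset of finite non-zero measure. Let $T:X\to X$ and $S:Y\to Y$ be ergodic measure-preserving homeomorphisms of $(X,\mu)$ and $(Y,\nu)$. Then there are a $T$-invariant $G_\delta$ subset $X'\subset X$ and an $S$-invariant $G_\delta$ subset $Y'\subset Y$, each of full measure, and a homeomorphism $\varphi:X'\to Y'$ (for the subspace topologies) which maps $\mu|_{X'}$ to $\nu|_{Y'}$ and maps $T$-orbits onto $S$-orbits.
   Context: A subset has full measure if its complement is a null set. The $T$-orbit of $x$ is $\{T^n x:n\in\mathbb Z\}$, and similarly for $S$. "$\varphi$ maps $T$-orbits onto $S$-orbits" means $\varphi(\{T^n x:n\in\mathbb Z\})=\{S^n\varphi(x):n\in\mathbb Z\}$ for every $x\in X'$. "$\varphi$ maps $\mu|_{X'}$ to $\nu|_{Y'}$" means that the push-forward of $\mu|_{X'}$ under $\varphi$ is $\nu|_{Y'}$. Invariant means $TX'=X'$, $SY'=Y'$. Ergodic means every invariant Borel set is null or has null complement. *)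

theory Defs
  imports "HOL-Analysis.Analysis"
begin

(* A Borel measure is an M with sets M = sets borel, which entails space M = UNIV. *)

definition measure_atom :: "'a measure \<Rightarrow> 'a set \<Rightarrow> bool" where
  "measure_atom M A \<longleftrightarrow> A \<in> sets M \<and> emeasure M A > 0 \<and>
     (\<forall>B\<in>sets M. B \<subseteq> A \<longrightarrow> emeasure M B = 0 \<or> emeasure M (A - B) = 0)"

definition nonatomic :: "'a measure \<Rightarrow> bool" where
  "nonatomic M \<longleftrightarrow> (\<nexists>A. measure_atom M A)"

definition self_homeomorphism :: "('a::topological_space \<Rightarrow> 'a) \<Rightarrow> bool" where
  "self_homeomorphism T \<longleftrightarrow> (\<exists>T'. homeomorphism UNIV UNIV T T')"

definition measure_preserving_map :: "'a measure \<Rightarrow> 'b measure \<Rightarrow> ('a \<Rightarrow> 'b) \<Rightarrow> bool" where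
  "measure_preserving_map M N f \<longleftrightarrow> f \<in> measurable M N \<and> distr M N f = N"

(* Invariance is strict, T A = A, not merely up to null sets. *)
definition ergodic :: "'a measure \<Rightarrow> ('a \<Rightarrow> 'a) \<Rightarrow> bool" where
  "ergodic M T \<longleftrightarrow>
     (\<forall>A\<in>sets M. T ` A = A \<longrightarrow> A \<in> null_sets M \<or> space M - A \<in> null_sets M)"

definition full_measure :: "'a measure \<Rightarrow> 'a set \<Rightarrow> bool" where
  "full_measure M A \<longleftrightarrow> A \<subseteq> space M \<and> space M - A \<in> null_sets M"

(* Used for bijective T only, where inv T is the two-sided inverse. *)
definition int_iterate :: "('a \<Rightarrow> 'a) \<Rightarrow> int \<Rightarrow> 'a \<Rightarrow> 'a" where
  "int_iterate T n = (if n \<ge> 0 then T ^^ nat n else inv T ^^ nat (- n))"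

(* The two-sided orbit; HOL-Combinatorics.Orbits only has forward orbits. *)
definition int_orbit :: "('a \<Rightarrow> 'a) \<Rightarrow> 'a \<Rightarrow> 'a set" where
  "int_orbit T x = {int_iterate T n x | n. True}"

end

theory Submission
  imports Defs
begin

text \<open>
  The theorem is an almost continuous version of Dye's theorem in infinite measure, and the proof
  goes through a model. Take the half-line \<open>(0, \<infinity>)\<close> with Lebesgue measure and
  call two points equivalent when their difference is a dyadic rational. Every system \<open>(X,
  \<mu>, T)\<close> as in the theorem is, on an invariant conull \<open>G\<^sub>\<delta>\<close>
  set, homeomorphic to a part of this model, with orbits corresponding to equivalence classes
  (\<open>ex_coding\<close>). Two systems with such codings \<open>\<Phi>\<close> and
  \<open>\<Psi>\<close> are then matched by \<open>\<Psi>\<^sup>-\<^sup>1 \<circ> \<Phi>\<close> on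
  the set where the ranges overlap (\<open>coding_orbit_equivalence\<close>). The ranges are
  \<open>G\<^sub>\<delta>\<close> sets because complete metrizability is a topological invariant,
  and both codings push the measure forward to Lebesgue measure, so the overlap is conull on either
  side.

  To stay continuous, every function with discrete values that occurs in the construction, and the
  indicator function of every set, is locally constant on some invariant conull
  \<open>G\<^sub>\<delta>\<close> set; only countably many are used, and the intersection of their
  domains is again such a set. Three facts supply enough of them. Balls whose spheres are null form
  a base of the topology (\<open>ex_acont_base\<close>). Sets can be cut into pieces of any
  prescribed measure (\<open>ex_equal_pieces\<close>), because there is a real coordinate with
  one-point level sets. Two sets of equal finite measure are exchanged by a piecewise power of
  \<open>T\<close> (\<open>ex_orbit_iso\<close>): enumerate the integers and let each power in turn
  carry over as much as it can; what is never carried over is null by ergodicity.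

  The coding itself is built in stages. At stage \<open>n\<close> the space is divided into cells
  numbered by \<open>\<nat>\<close>, all of measure \<open>2\<^sup>-\<^sup>e\<close> with \<open>e =
  e\<^sub>n\<close>, and a piecewise power of \<open>T\<close> carries every cell onto one base set.
  Dividing the base into \<open>2\<^sup>D\<close> equal parts and transporting the division to all
  cells gives the next stage. The division is chosen along a skyscraper over a small subset
  \<open>B\<close> of the base (\<open>ex_refinement\<close>): by recurrence almost every point sits
  at a finite height above \<open>B\<close>, so outside a set of small measure the position in the
  skyscraper determines any given finite amount of information, and a point and its image under a
  bounded power of \<open>T\<close> lie in the same column unless a visit to \<open>B\<close> comes
  in between. Hence, apart from small exceptional sets, cells of stage \<open>n + 1\<close> do not
  cross the first \<open>n\<close> basic open sets, and \<open>x\<close> and \<open>T x\<close> are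
  carried to the same point of the base. By Borel and Cantelli almost every point is exceptional
  only finitely often. The limit of (number of the cell)\<open>/2\<^sup>e\<close> is therefore
  injective with continuous inverse, and it maps orbits to dyadic classes.
\<close>

section \<open>Integer iterates, G-delta sets and null level sets\<close>

lemma int_iterate_1_add:
  assumes "bij T"
  shows "int_iterate T (1 + k) x = T (int_iterate T k x)"
proof (cases "k \<ge> 0")
  case True
  then show ?thesis by (simp add: int_iterate_def nat_add_distrib)
next
  case False
  define n where "n = nat (- k) - 1"
  have k: "k = - int (Suc n)" using False by (simp add: n_def)
  have "T (inv T y) = y" for y using assms by (simp add: bij_is_surj surj_f_inv_f)
  then show ?thesis unfolding k int_iterate_def by (auto simp: nat_add_distrib)
qed

lemma int_iterate_add:
  assumes "bij T"
  shows "int_iterate T (j + k) x = int_iterate T j (int_iterate T k x)"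
proof (induction j rule: int_induct[where k = 0])
  case base
  show ?case by (simp add: int_iterate_def)
next
  case (step1 i)
  then show ?case using int_iterate_1_add[OF assms, of "i + k" x]
      int_iterate_1_add[OF assms, of i "int_iterate T k x"] by (simp add: add.commute add.left_commute)
next
  case (step2 i)
  have "T (int_iterate T (i - 1 + k) x) = T (int_iterate T (i - 1) (int_iterate T k x))"
    using step2 int_iterate_1_add[OF assms, of "i - 1 + k" x]
      int_iterate_1_add[OF assms, of "i - 1" "int_iterate T k x"] by (simp add: algebra_simps)
  then show ?case using assms by (simp add: bij_is_inj inj_eq)
qed

lemma gdelta_countable_INT:
  assumes "countable I" "I \<noteq> {}" "\<And>i. i \<in> I \<Longrightarrow> open (F i)"
  shows "gdelta (\<Inter>i\<in>I. F i)"
proof -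
  have "(\<Inter>i\<in>I. F i) = (\<Inter>(range (\<lambda>n::nat. F (from_nat_into I n))))"
    using range_from_nat_into[OF assms(2,1)] by (metis image_image)
  moreover have "gdelta \<dots>"
    by (rule gdelta.intros) (simp add: assms from_nat_into)
  ultimately show ?thesis by simp
qed

text \<open>The level sets are disjoint, so in a \<open>\<sigma>\<close>-finite measure space only
  countably many of them have positive measure.\<close>
lemma ex_null_level:
  fixes f :: "'a \<Rightarrow> real"
  assumes "sigma_finite_measure M" and f: "f \<in> borel_measurable M" and "p < q"
  shows "\<exists>r\<in>{p<..<q}. {x\<in>space M. f x = r} \<in> null_sets M"
proof -
  interpret sigma_finite_measure M by fact
  obtain A :: "nat \<Rightarrow> 'a set" where A: "range A \<subseteq> sets M" "(\<Union>i. A i) = space M" "\<And>i. emeasure M (A i) \<noteq> \<infinity>"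
    using sigma_finite by metis
  define N where "N i = distr (restrict_space M (A i)) borel f" for i
  have AM: "A i \<in> sets M" for i using A(1) by auto
  have meas: "f \<in> borel_measurable (restrict_space M (A i))" for i
    using f by (rule measurable_restrict_space1)
  have fin: "finite_measure (N i)" for i
    unfolding N_def
  proof (rule finite_measure.finite_measure_distr[OF _ meas])
    show "finite_measure (restrict_space M (A i))"
      using A(3)[of i] AM[of i]
      by (intro finite_measureI) (simp add: emeasure_restrict_space space_restrict_space sets.Int_space_eq2)
  qed
  have "countable (\<Union>i. {r. measure (N i) {r} \<noteq> 0})"
    using finite_measure.countable_support[OF fin] by (intro countable_UN) auto
  moreover have "uncountable {p<..<q}" using \<open>p < q\<close> by (simp add: uncountable_open_interval)
  ultimately obtain r where r: "r \<in> {p<..<q}" "r \<notin> (\<Union>i. {r. measure (N i) {r} \<noteq> 0})"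
    by (meson countable_subset subsetI)
  have z: "{x\<in>A i. f x = r} \<in> null_sets M" for i
  proof -
    have "emeasure (N i) {r} = 0"
      using r(2) finite_measure.emeasure_eq_measure[OF fin] by auto
    moreover have "emeasure (N i) {r} = emeasure M {x\<in>A i. f x = r}"
      unfolding N_def using meas AM[of i] sets.sets_into_space[OF AM[of i]]
      by (subst emeasure_distr) (auto simp: emeasure_restrict_space space_restrict_space intro!: arg_cong[where f="emeasure M"])
    moreover have "{x\<in>A i. f x = r} = A i \<inter> {x\<in>space M. f x = r}"
      using sets.sets_into_space[OF AM[of i]] by auto
    moreover have "A i \<inter> {x\<in>space M. f x = r} \<in> sets M"
      using f AM by measurable
    ultimately show ?thesis by (auto simp: null_sets_def)
  qed
  have "{x\<in>space M. f x = r} = (\<Union>i. {x\<in>A i. f x = r})" using A(2) by auto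
  also have "\<dots> \<in> null_sets M" using z by auto
  finally show ?thesis using r(1) by blast
qed

section \<open>Ergodic homeomorphisms of Polish measure spaces\<close>

locale polish_ergodic =
  fixes \<mu> :: "'a::polish_space measure" and T :: "'a \<Rightarrow> 'a"
  assumes sets_mu: "sets \<mu> = sets borel"
    and sigma_finite_mu: "sigma_finite_measure \<mu>"
    and nonatomic_mu: "nonatomic \<mu>"
    and infinite_mu: "emeasure \<mu> (space \<mu>) = \<infinity>"
    and open_finite: "\<exists>U. open U \<and> 0 < emeasure \<mu> U \<and> emeasure \<mu> U < \<infinity>"
    and homeo_T: "self_homeomorphism T"
    and mp_T: "measure_preserving_map \<mu> \<mu> T"
    and ergodic_T: "ergodic \<mu> T"
begin

abbreviation iter ("\<tau>") where "\<tau> k \<equiv> int_iterate T k"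
text \<open>Sets that are only specified up to an invariant null set need not be Borel, but they are
  measurable for the completed measure.\<close>
abbreviation M where "M \<equiv> completion \<mu>"
abbreviation mass where "mass P \<equiv> emeasure M {x. P x}"

lemma space_mu [simp]: "space \<mu> = UNIV"
  using sets_eq_imp_space_eq[OF sets_mu] by simp

lemma bij_T: "bij T"
proof -
  obtain T' where "homeomorphism UNIV UNIV T T'" using homeo_T self_homeomorphism_def by blast
  then show ?thesis unfolding homeomorphism_def by (metis UNIV_I bijI')
qed

lemma cont_T: "continuous_on UNIV T" and cont_inv_T: "continuous_on UNIV (inv T)"
proof -
  obtain T' where h: "homeomorphism UNIV UNIV T T'" using homeo_T self_homeomorphism_def by blast
  then show "continuous_on UNIV T" by (simp add: homeomorphism_def)
  have "T' = inv T" using h unfolding homeomorphism_def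
    by (metis UNIV_I inj_imp_inv_eq bij_T bij_is_inj)
  then show "continuous_on UNIV (inv T)" using h by (simp add: homeomorphism_def)
qed

lemma tau_0 [simp]: "\<tau> 0 x = x" by (simp add: int_iterate_def)
lemma vimage_tau_0 [simp]: "\<tau> 0 -` A = A" by auto
lemma tau_1 [simp]: "\<tau> 1 x = T x" by (simp add: int_iterate_def)
lemma tau_tau [simp]: "\<tau> j (\<tau> k x) = \<tau> (j + k) x"
  using int_iterate_add[OF bij_T] by simp

lemma cont_tau: "continuous_on UNIV (\<tau> k)"
proof -
  have *: "continuous_on UNIV (f ^^ n)" if "continuous_on UNIV f" for f :: "'a \<Rightarrow> 'a" and n
  proof (induction n)
    case (Suc n)
    show ?case using continuous_on_compose[OF Suc continuous_on_subset[OF that subset_UNIV]]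
      by (simp add: comp_def)
  qed (simp add: id_def)
  have "int_iterate T k = (if k \<ge> 0 then T ^^ nat k else inv T ^^ nat (- k))"
    by (auto simp: int_iterate_def)
  then show ?thesis using *[OF cont_T] *[OF cont_inv_T] by simp
qed

lemma open_vimage_tau: "open U \<Longrightarrow> open (\<tau> k -` U)"
  using cont_tau open_vimage by blast

lemma tau_measurable [measurable]: "\<tau> k \<in> measurable \<mu> \<mu>"
  using borel_measurable_continuous_onI[OF cont_tau, of k] sets_mu measurable_cong_sets by blast

lemma vimage_tau_sets: "A \<in> sets \<mu> \<Longrightarrow> \<tau> k -` A \<in> sets \<mu>"
  using measurable_sets[OF tau_measurable, of A k] by simp

text \<open>Invariance under \<open>T\<close> passes to \<open>T\<^sup>-\<^sup>1\<close> because
  \<open>T\<close> pulls the preimage under \<open>T\<^sup>-\<^sup>1\<close> back to the set itself;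
  this is what both directions of the induction use.\<close>
lemma emeasure_vimage_tau:
  assumes "A \<in> sets \<mu>"
  shows "emeasure \<mu> (\<tau> k -` A) = emeasure \<mu> A"
proof -
  have T: "T \<in> measurable \<mu> \<mu>" "distr \<mu> \<mu> T = \<mu>"
    using mp_T by (auto simp: measure_preserving_map_def)
  have T1: "emeasure \<mu> (T -` A) = emeasure \<mu> A" if "A \<in> sets \<mu>" for A
    using emeasure_distr[OF T(1) that] T(2) by simp
  show ?thesis using assms
  proof (induction k rule: int_induct[where k = 0])
    case (step1 i)
    have "\<tau> (i + 1) -` A = T -` (\<tau> i -` A)" using tau_tau[of i 1] by (auto simp del: tau_tau)
    then show ?case using T1[OF vimage_tau_sets[OF step1(3), of i]] step1 by simp
  next
    case (step2 i)
    have "T -` (\<tau> (i - 1) -` A) = \<tau> i -` A" using tau_tau[of "i - 1" 1] by (auto simp del: tau_tau)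
    then show ?case using T1[OF vimage_tau_sets[OF step2(3), of "i - 1"]] step2 by simp
  qed simp
qed

lemma null_vimage_tau: "A \<in> null_sets \<mu> \<Longrightarrow> \<tau> k -` A \<in> null_sets \<mu>"
  using emeasure_vimage_tau vimage_tau_sets by (auto simp: null_sets_def)

lemma mass_shift:
  assumes "{x. P x} \<in> sets M"
  shows "mass (\<lambda>x. P (\<tau> k x)) = mass P"
proof -
  obtain S N N' where SN: "{x. P x} = S \<union> N" "N \<subseteq> N'" "N' \<in> null_sets \<mu>" "S \<in> sets \<mu>"
    using sets_completionE[OF assms] by metis
  have eq: "{x. P (\<tau> k x)} = \<tau> k -` S \<union> \<tau> k -` N" using SN(1) by auto
  have N: "N \<in> null_sets M" "\<tau> k -` N \<in> null_sets M"
    using SN null_sets_completion_subset[of N N' \<mu>] null_sets_completion_subset[of "\<tau> k -` N" "\<tau> k -` N'" \<mu>]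
      null_vimage_tau[of N' k] by (auto simp: null_sets_completionI)
  show "mass (\<lambda>x. P (\<tau> k x)) = mass P" unfolding eq SN(1)
    using N SN(4) vimage_tau_sets[OF SN(4), of k] emeasure_vimage_tau[OF SN(4), of k]
    by (simp add: emeasure_Un_null_set)
qed

lemma AE_shift:
  assumes "AE x in M. P x" shows "AE x in M. P (\<tau> k x)"
proof -
  obtain N where N: "N \<in> null_sets \<mu>" "{x. \<not> P x} \<subseteq> N"
    using assms unfolding AE_completion_iff by (elim AE_E) (auto simp: null_sets_def)
  have "AE x in \<mu>. P (\<tau> k x)"
    using null_vimage_tau[OF N(1), of k] N(2) by (intro AE_I'[of "\<tau> k -` N"]) auto
  then show ?thesis by (simp add: AE_completion_iff)
qed

lemma AE_shift_all:
  assumes "AE x in M. P x" shows "AE x in M. \<forall>k. P (\<tau> k x)"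
  using AE_shift[OF assms] by (simp add: AE_all_countable)

lemma mass_cong_AE:
  assumes "AE x in M. P x = Q x" "{x. P x} \<in> sets M"
  shows "{x. Q x} \<in> sets M" "mass P = mass Q"
proof -
  have "{x. P x} \<in> sets M \<longleftrightarrow> {x. Q x} \<in> sets M"
    using completion.in_sets_AE[of "{x. P x}" "{x. Q x}" \<mu>]
      completion.in_sets_AE[of "{x. Q x}" "{x. P x}" \<mu>] assms by (auto simp: eq_commute)
  then show "{x. Q x} \<in> sets M" using assms(2) by simp
  then show "mass P = mass Q" using assms by (intro emeasure_eq_AE) auto
qed

section \<open>Generic sets and almost continuous functions\<close>

text \<open>The domains on which the construction is allowed to live. They are closed under
  countable intersections (\<open>generic_Inter\<close>), and the condition on \<open>\<tau>
  k\<close> is written with preimages so that membership can be rewritten along orbits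
  (\<open>generic_tau\<close>).\<close>
definition generic :: "'a set \<Rightarrow> bool" where
  "generic G \<longleftrightarrow> gdelta G \<and> (\<forall>k. \<tau> k -` G = G) \<and> - G \<in> null_sets \<mu>"

definition generically :: "('a \<Rightarrow> bool) \<Rightarrow> bool" where
  "generically P \<longleftrightarrow> (\<exists>G. generic G \<and> (\<forall>x\<in>G. P x))"

definition loc_const :: "'a set \<Rightarrow> ('a \<Rightarrow> 'c) \<Rightarrow> bool" where
  "loc_const G f \<longleftrightarrow> (\<forall>x\<in>G. \<exists>U. open U \<and> x \<in> U \<and> (\<forall>y\<in>U \<inter> G. f y = f x))"

text \<open>Almost continuity for maps into a discrete space. For a Boolean \<open>f\<close> it says
  that the set \<open>{x. f x}\<close> is almost clopen: clopen relative to a generic set.\<close>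
definition acont :: "('a \<Rightarrow> 'c) \<Rightarrow> bool" where
  "acont f \<longleftrightarrow> (\<exists>G. generic G \<and> loc_const G f)"

lemma genE:
  assumes "generically P" obtains G where "generic G" "\<And>x. x \<in> G \<Longrightarrow> P x"
  using assms unfolding generically_def by blast

lemma acontE:
  assumes "acont f" obtains G where "generic G" "loc_const G f"
  using assms unfolding acont_def by blast

lemma generic_tau: "generic G \<Longrightarrow> \<tau> k x \<in> G \<longleftrightarrow> x \<in> G"
  unfolding generic_def by blast

text \<open>An open set with null complement contains an invariant set with the same properties,
  namely the intersection of its translates, because the powers of \<open>T\<close> preserve null
  sets.\<close>
lemma generic_of_open:
  assumes "\<And>n::nat. open (Op n)" "\<And>n. - Op n \<in> null_sets \<mu>"
  shows "generic (\<Inter>n. \<Inter>k. \<tau> k -` Op n)"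
proof -
  have eq: "(\<Inter>n. \<Inter>k. \<tau> k -` Op n) = (\<Inter>p\<in>UNIV. \<tau> (snd p) -` Op (fst p))" by auto
  have 1: "gdelta (\<Inter>n. \<Inter>k. \<tau> k -` Op n)" unfolding eq
    by (rule gdelta_countable_INT) (auto simp: open_vimage_tau assms)
  have 2: "\<tau> k -` (\<Inter>n. \<Inter>k. \<tau> k -` Op n) = (\<Inter>n. \<Inter>k. \<tau> k -` Op n)" for k
  proof -
    have "(\<forall>j. \<tau> (j + k) x \<in> Op n) \<longleftrightarrow> (\<forall>j. \<tau> j x \<in> Op n)" for x n
      by (metis diff_add_cancel)
    then show ?thesis by auto
  qed
  have "- (\<Inter>n. \<Inter>k. \<tau> k -` Op n) = (\<Union>p\<in>UNIV. \<tau> (snd p) -` (- Op (fst p)))" by auto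
  also have "\<dots> \<in> null_sets \<mu>"
    by (rule null_sets_UN') (auto intro!: null_vimage_tau assms)
  finally show ?thesis using 1 2 by (simp add: generic_def)
qed

lemma generic_Inter:
  assumes "\<And>n::nat. generic (G n)" shows "generic (\<Inter>n. G n)"
proof -
  have "\<exists>F. (\<forall>m::nat. open (F m)) \<and> G n = (\<Inter>m. F m)" for n
    using assms[of n] unfolding generic_def gdelta.simps by metis
  then obtain F where F: "\<And>n m::nat. open (F n m)" "\<And>n. G n = (\<Inter>m. F n m)" by metis
  have eq: "(\<Inter>n. G n) = (\<Inter>p\<in>UNIV. F (fst p) (snd p))" using F(2) by auto
  have 1: "gdelta (\<Inter>n. G n)" unfolding eq
    by (rule gdelta_countable_INT) (auto simp: F)
  have "- (\<Inter>n. G n) = (\<Union>n. - G n)" by auto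
  also have "\<dots> \<in> null_sets \<mu>" using assms by (intro null_sets_UN') (auto simp: generic_def)
  finally have 2: "- (\<Inter>n. G n) \<in> null_sets \<mu>" .
  have "\<tau> k -` (\<Inter>n. G n) = (\<Inter>n. G n)" for k
    using generic_tau[OF assms] by auto
  then show ?thesis using 1 2 by (simp add: generic_def)
qed

lemma generic_Int:
  assumes "generic G" "generic H" shows "generic (G \<inter> H)"
proof -
  have "(\<Inter>n::nat. if n = 0 then G else H) = G \<inter> H"
    by (auto split: if_splits)
  then show ?thesis using generic_Inter[of "\<lambda>n. if n = 0 then G else H"] assms by simp
qed

lemma generic_UNIV: "generic UNIV"
  using generic_of_open[of "\<lambda>_. UNIV"] by simp

lemma loc_const_mono: "loc_const G f \<Longrightarrow> H \<subseteq> G \<Longrightarrow> loc_const H f"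
  unfolding loc_const_def by (meson IntD1 IntD2 IntI subsetD)

lemma gen_countable:
  assumes "\<And>n::nat. generically (P n)" shows "generically (\<lambda>x. \<forall>n. P n x)"
proof -
  obtain G where "\<And>n. generic (G n) \<and> (\<forall>x\<in>G n. P n x)" using assms unfolding generically_def by metis
  then show ?thesis unfolding generically_def using generic_Inter[of G] by blast
qed

lemma gen_all_countable:
  fixes P :: "'c::countable \<Rightarrow> _"
  assumes "\<And>n. generically (P n)" shows "generically (\<lambda>x. \<forall>n. P n x)"
proof -
  have "generically (\<lambda>x. \<forall>n::nat. P (from_nat n) x)" using assms by (intro gen_countable)
  then obtain G where "generic G" "\<And>x n. x \<in> G \<Longrightarrow> P (from_nat n) x" unfolding generically_def by blast
  then show ?thesis unfolding generically_def by (metis from_nat_to_nat)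
qed

lemma gen_True: "generically (\<lambda>x. True)" using generic_UNIV generically_def by blast

lemma gen_mono: "generically P \<Longrightarrow> (\<And>x. P x \<Longrightarrow> Q x) \<Longrightarrow> generically Q" unfolding generically_def by blast

lemma gen_conj: "generically P \<Longrightarrow> generically Q \<Longrightarrow> generically (\<lambda>x. P x \<and> Q x)"
  unfolding generically_def by (metis IntD1 IntD2 generic_Int)

lemma gen_all: "(\<And>x. P x) \<Longrightarrow> generically P"
  using gen_True gen_mono by blast

text \<open>This is why generic sets are required to be invariant: a property that holds generically
  holds along the whole orbit of a generic point.\<close>
lemma gen_shift: "generically P \<Longrightarrow> generically (\<lambda>x. \<forall>k. P (\<tau> k x))"
  unfolding generically_def using generic_tau by metis

lemma gen_AE: assumes "generically P" shows "AE x in M. P x"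
proof -
  obtain G where "- G \<in> null_sets \<mu>" "\<forall>x\<in>G. P x" using assms unfolding generically_def generic_def by blast
  then have "AE x in \<mu>. P x" by (intro AE_I'[of "- G"]) auto
  then show ?thesis by (simp add: AE_completion_iff)
qed

lemma acont_common:
  assumes "\<And>n::nat. acont (f n)" shows "\<exists>G. generic G \<and> (\<forall>n. loc_const G (f n))"
proof -
  obtain G where "\<And>n. generic (G n) \<and> loc_const (G n) (f n)" using assms unfolding acont_def by metis
  then show ?thesis using generic_Inter[of G] loc_const_mono
    by (intro exI[of _ "\<Inter>n. G n"]) blast
qed

lemma acont_common_countable:
  fixes f :: "'c::countable \<Rightarrow> _"
  assumes "\<And>n. acont (f n)" shows "\<exists>G. generic G \<and> (\<forall>n. loc_const G (f n))"
proof -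
  obtain G where "generic G" "\<forall>n::nat. loc_const G (f (from_nat n))"
    using acont_common[of "\<lambda>n. f (from_nat n)"] assms by blast
  then show ?thesis by (metis from_nat_to_nat)
qed

lemma loc_const_pair:
  assumes "loc_const G f" "loc_const G g" shows "loc_const G (\<lambda>x. h (f x) (g x))"
  unfolding loc_const_def
proof
  fix x assume x: "x \<in> G"
  obtain U where U: "open U" "x \<in> U" "\<forall>y\<in>U \<inter> G. f y = f x" using assms(1) x unfolding loc_const_def by blast
  obtain V where V: "open V" "x \<in> V" "\<forall>y\<in>V \<inter> G. g y = g x" using assms(2) x unfolding loc_const_def by blast
  show "\<exists>U. open U \<and> x \<in> U \<and> (\<forall>y\<in>U \<inter> G. h (f y) (g y) = h (f x) (g x))"
    using U V by (intro exI[of _ "U \<inter> V"]) auto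
qed

lemma loc_const_fam:
  assumes "loc_const G n" "\<And>k. loc_const G (f k)" shows "loc_const G (\<lambda>x. f (n x) x)"
  unfolding loc_const_def
proof
  fix x assume x: "x \<in> G"
  obtain U where U: "open U" "x \<in> U" "\<forall>y\<in>U \<inter> G. n y = n x" using assms(1) x unfolding loc_const_def by blast
  obtain V where V: "open V" "x \<in> V" "\<forall>y\<in>V \<inter> G. f (n x) y = f (n x) x" using assms(2) x unfolding loc_const_def by blast
  show "\<exists>U. open U \<and> x \<in> U \<and> (\<forall>y\<in>U \<inter> G. f (n y) y = f (n x) x)"
    using U V by (intro exI[of _ "U \<inter> V"]) auto
qed

lemma loc_const_shift:
  assumes "generic G" "loc_const G f" shows "loc_const G (\<lambda>x. f (\<tau> k x))"
  unfolding loc_const_def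
proof
  fix x assume x: "x \<in> G"
  then obtain U where U: "open U" "\<tau> k x \<in> U" "\<forall>y\<in>U \<inter> G. f y = f (\<tau> k x)"
    using assms unfolding loc_const_def by (metis generic_tau)
  show "\<exists>U. open U \<and> x \<in> U \<and> (\<forall>y\<in>U \<inter> G. f (\<tau> k y) = f (\<tau> k x))"
    using U open_vimage_tau[OF U(1), of k] generic_tau[OF assms(1)]
    by (intro exI[of _ "\<tau> k -` U"]) auto
qed

named_theorems acont_intros

lemma acont_const [acont_intros]: "acont (\<lambda>x. a)"
  unfolding acont_def loc_const_def using generic_UNIV by blast

lemma acont_pair:
  assumes "acont f" "acont g" shows "acont (\<lambda>x. h (f x) (g x))"
proof -
  obtain G where G: "generic G" "loc_const G f" using assms(1) by (rule acontE)
  obtain H where H: "generic H" "loc_const H g" using assms(2) by (rule acontE)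
  have "loc_const (G \<inter> H) (\<lambda>x. h (f x) (g x))"
    using loc_const_pair[of "G \<inter> H" f g h] loc_const_mono[OF G(2), of "G \<inter> H"]
      loc_const_mono[OF H(2), of "G \<inter> H"] by simp
  then show ?thesis using generic_Int[OF G(1) H(1)] acont_def by blast
qed

lemma acont_comp: "acont f \<Longrightarrow> acont (\<lambda>x. h (f x))"
  using acont_pair[of f f "\<lambda>a b. h a"] by simp

text \<open>Only countably many functions \<open>f k\<close> are selected, so they have a common
  generic domain. With powers of \<open>T\<close> as the family, this makes compositions with
  piecewise powers of \<open>T\<close> almost continuous.\<close>
lemma acont_fam:
  fixes n :: "'a \<Rightarrow> 'c::countable"
  assumes "acont n" "\<And>k. acont (f k)" shows "acont (\<lambda>x. f (n x) x)"
proof -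
  obtain G where G: "generic G" "loc_const G n" using assms(1) by (rule acontE)
  obtain H where H: "generic H" "\<And>k. loc_const H (f k)" using acont_common_countable[of f] assms(2) by blast
  have "loc_const (G \<inter> H) (\<lambda>x. f (n x) x)"
  proof (rule loc_const_fam[of _ n f])
    show "loc_const (G \<inter> H) n" using G(2) loc_const_mono by blast
    show "loc_const (G \<inter> H) (f k)" for k using H(2) loc_const_mono[of H "f k"] by blast
  qed
  then show ?thesis using generic_Int[OF G(1) H(1)] acont_def by blast
qed

lemma acont_shift: "acont f \<Longrightarrow> acont (\<lambda>x. f (\<tau> k x))"
  unfolding acont_def using loc_const_shift by blast

lemma acont_subst:
  assumes "acont c" "acont f" shows "acont (\<lambda>x. f (\<tau> (c x) x))"
  using acont_fam[of c "\<lambda>k x. f (\<tau> k x)"] assms acont_shift by blast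

lemma acont_conj [acont_intros]: "acont P \<Longrightarrow> acont Q \<Longrightarrow> acont (\<lambda>x. P x \<and> Q x)" by (rule acont_pair)
lemma acont_disj [acont_intros]: "acont P \<Longrightarrow> acont Q \<Longrightarrow> acont (\<lambda>x. P x \<or> Q x)" by (rule acont_pair)
lemma acont_not [acont_intros]: "acont P \<Longrightarrow> acont (\<lambda>x. \<not> P x)" by (rule acont_comp)
lemma acont_eq [acont_intros]: "acont f \<Longrightarrow> acont g \<Longrightarrow> acont (\<lambda>x. f x = g x)" by (rule acont_pair)
lemma acont_less [acont_intros]: "acont f \<Longrightarrow> acont g \<Longrightarrow> acont (\<lambda>x. f x < g x)" by (rule acont_pair)
lemma acont_le [acont_intros]: "acont f \<Longrightarrow> acont g \<Longrightarrow> acont (\<lambda>x. f x \<le> g x)" by (rule acont_pair)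
lemma acont_plus [acont_intros]: "acont f \<Longrightarrow> acont g \<Longrightarrow> acont (\<lambda>x. f x + g x)" by (rule acont_pair)
lemma acont_uminus [acont_intros]: "acont f \<Longrightarrow> acont (\<lambda>x. - f x)" by (rule acont_comp)
lemma acont_Pair [acont_intros]: "acont f \<Longrightarrow> acont g \<Longrightarrow> acont (\<lambda>x. (f x, g x))" by (rule acont_pair)
lemma acont_mem [acont_intros]: "acont f \<Longrightarrow> acont (\<lambda>x. f x \<in> S)" by (rule acont_comp)
lemma acont_if [acont_intros]:
  assumes "acont P" "acont f" "acont g" shows "acont (\<lambda>x. if P x then f x else g x)"
proof -
  have "acont (\<lambda>x. (\<lambda>(a, b) c. if a then b else c) (P x, f x) (g x))"
    by (rule acont_pair[OF acont_pair[OF assms(1,2), of Pair] assms(3)])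
  then show ?thesis by simp
qed

lemma acont_map [acont_intros]:
  "(\<And>i. i \<in> set xs \<Longrightarrow> acont (f i)) \<Longrightarrow> acont (\<lambda>x. map (\<lambda>i. f i x) xs)"
proof (induction xs)
  case (Cons a xs)
  then show ?case using acont_pair[of "f a" "\<lambda>x. map (\<lambda>i. f i x) xs" Cons] by simp
qed (simp add: acont_const)

lemma acont_finite_bex [acont_intros]:
  assumes "finite S" "\<And>n. n \<in> S \<Longrightarrow> acont (P n)" shows "acont (\<lambda>x. \<exists>n\<in>S. P n x)"
  using assms by (induction S) (auto intro!: acont_intros)

lemma acont_cong_gen:
  assumes "acont f" "generically (\<lambda>x. f x = g x)" shows "acont g"
proof -
  obtain G where G: "generic G" "loc_const G f" using assms(1) by (rule acontE)
  obtain H where H: "generic H" "\<And>x. x \<in> H \<Longrightarrow> f x = g x" using assms(2) by (rule genE) (rule that)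
  have "loc_const (G \<inter> H) g"
    using loc_const_mono[OF G(2), of "G \<inter> H"] H(2) unfolding loc_const_def by force
  then show ?thesis using generic_Int[OF G(1) H(1)] acont_def by blast
qed

lemma loc_const_open:
  assumes "loc_const G P"
  shows "\<exists>V. open V \<and> V \<inter> G = {x\<in>G. P x}"
proof -
  obtain U where U: "\<And>x. x \<in> G \<Longrightarrow> open (U x) \<and> x \<in> U x \<and> (\<forall>y\<in>U x \<inter> G. P y = P x)"
    using assms unfolding loc_const_def by metis
  show ?thesis
    by (rule exI[of _ "\<Union>x\<in>{x\<in>G. P x}. U x"]) (use U in \<open>auto; blast\<close>)
qed

lemma acont_sets: assumes "acont P" shows "{x. P x} \<in> sets M"
proof -
  obtain G where G: "generic G" "loc_const G P" using assms by (rule acontE)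
  obtain V where V: "open V" "V \<inter> G = {x\<in>G. P x}" using loc_const_open[OF G(2)] by blast
  have "-G \<in> sets \<mu>" "- G \<in> null_sets \<mu>" using G(1) by (auto simp: generic_def)
  then have "- (- G) \<in> sets \<mu>" by (simp add: sets.compl_sets sets.Diff Compl_eq_Diff_UNIV space_mu[symmetric] del: space_mu)
  moreover have "V \<in> sets \<mu>" using V sets_mu by auto
  ultimately have "V \<inter> G \<in> sets \<mu>" by auto
  then show ?thesis
    by (intro sets_completionI[of _ "V \<inter> G" "{x. P x} - G" "- G"]) (use V \<open>- G \<in> null_sets \<mu>\<close> in auto)
qed

text \<open>The passage from almost everywhere to generically. A countable union of almost clopen
  sets is relatively open, so if it is conull it contains a generic set; an arbitrary conull set may
  be meagre and then contains no conull \<open>G\<^sub>\<delta>\<close> set if \<open>\<mu>\<close>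
  has full support.\<close>
lemma acont_ex_gen:
  assumes "\<And>n::'c::countable. acont (P n)" "AE x in M. \<exists>n. P n x"
  shows "generically (\<lambda>x. \<exists>n. P n x)"
proof -
  obtain G where G: "generic G" "\<And>n. loc_const G (P n)" using acont_common_countable[of P] assms(1) by blast
  obtain V where V: "\<And>n. open (V n)" "\<And>n. V n \<inter> G = {x\<in>G. P n x}" using loc_const_open[OF G(2)] by metis
  define W where "W = (\<Union>n. V n)"
  have W: "open W" using V by (auto simp: W_def)
  have "AE x in M. x \<in> G" by (rule gen_AE) (use G in \<open>auto simp: generically_def\<close>)
  with assms(2) have "AE x in M. x \<in> W"
    by eventually_elim (use V W_def in blast)
  moreover have "W \<in> sets \<mu>" using W sets_mu by auto
  ultimately have "- W \<in> null_sets \<mu>"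
    using AE_iff_null_sets[of "- W" \<mu>] sets.compl_sets[of W \<mu>]
    by (simp add: AE_completion_iff Compl_eq_Diff_UNIV)
  then have "generic (\<Inter>n::nat. \<Inter>k. \<tau> k -` W)" using W by (intro generic_of_open) auto
  then have *: "generic (G \<inter> (\<Inter>n::nat. \<Inter>k. \<tau> k -` W))" using G(1) generic_Int by blast
  have "\<exists>n. P n x" if "x \<in> G \<inter> (\<Inter>n::nat. \<Inter>k. \<tau> k -` W)" for x
  proof -
    have "\<tau> 0 x \<in> W" using that by blast
    then show ?thesis using that V(2) unfolding W_def by auto
  qed
  then show ?thesis using * unfolding generically_def by (intro exI[of _ "G \<inter> (\<Inter>n::nat. \<Inter>k. \<tau> k -` W)"]) simp
qed

lemma acont_AE_gen: "acont P \<Longrightarrow> AE x in M. P x \<Longrightarrow> generically P"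
  using acont_ex_gen[of "\<lambda>_::unit. P"] by simp

lemma acont_Least:
  assumes "\<And>n::nat. acont (P n)" "generically (\<lambda>x. \<exists>n. P n x)" shows "acont (\<lambda>x. LEAST n. P n x)"
proof -
  obtain G where G: "generic G" "\<And>n. loc_const G (P n)" using acont_common_countable[of P] assms(1) by blast
  obtain H where H: "generic H" "\<And>x. x \<in> H \<Longrightarrow> \<exists>n. P n x" using assms(2) by (rule genE) (rule that)
  have gh: "loc_const (G \<inter> H) (P n)" for n using loc_const_mono[OF G(2), of "G \<inter> H"] by blast
  have "loc_const (G \<inter> H) (\<lambda>x. LEAST n. P n x)" unfolding loc_const_def
  proof
    fix x assume x: "x \<in> G \<inter> H"
    define n where "n = (LEAST n. P n x)"
    have n: "P n x" using H(2) x unfolding n_def by (metis IntD2 LeastI_ex)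
    have "\<exists>U. open U \<and> x \<in> U \<and> (\<forall>y\<in>U \<inter> (G \<inter> H). P k y = P k x)" for k
      using gh[of k] x unfolding loc_const_def by blast
    then obtain U where U: "\<And>k. open (U k)" "\<And>k. x \<in> U k" "\<And>k y. y\<in>U k \<inter> (G \<inter> H) \<Longrightarrow> P k y = P k x"
      by metis
    have "(LEAST n. P n y) = n" if "y \<in> (\<Inter>k\<le>n. U k) \<inter> (G \<inter> H)" for y
    proof (rule Least_equality)
      show "P n y" using that U(3) n by auto
      show "n \<le> k" if "P k y" for k
      proof (cases "k \<le> n")
        case True
        then have "P k x" using \<open>y \<in> _\<close> that U(3)[of y k] by auto
        then show ?thesis unfolding n_def by (rule Least_le)
      qed simp
    qed
    then have "\<forall>y\<in>(\<Inter>k\<le>n. U k) \<inter> (G \<inter> H). (LEAST n. P n y) = (LEAST n. P n x)"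
      unfolding n_def by blast
    moreover have "open (\<Inter>k\<le>n. U k)" by (intro open_INT) (simp_all add: U(1))
    moreover have "x \<in> (\<Inter>k\<le>n. U k)" using U(2) by simp
    ultimately show "\<exists>U. open U \<and> x \<in> U \<and> (\<forall>y\<in>U \<inter> (G \<inter> H). (LEAST n. P n y) = (LEAST n. P n x))"
      by blast
  qed
  then show ?thesis using generic_Int[OF G(1) H(1)] acont_def by blast
qed

lemma acont_of_levels:
  fixes v :: "'a \<Rightarrow> 'c::countable"
  assumes "\<And>r. acont (\<lambda>x. v x = r)" shows "acont v"
proof -
  obtain G where G: "generic G" "\<And>n. loc_const G (\<lambda>x. v x = n)"
    using acont_common_countable[of "\<lambda>n x. v x = n"] assms by blast
  have "loc_const G v" unfolding loc_const_def
  proof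
    fix x assume x: "x \<in> G"
    obtain U where "open U" "x \<in> U" "\<forall>y\<in>U \<inter> G. (v y = v x) = (v x = v x)"
      using G(2)[of "v x"] x unfolding loc_const_def by blast
    then show "\<exists>U. open U \<and> x \<in> U \<and> (\<forall>y\<in>U \<inter> G. v y = v x)" by auto
  qed
  then show ?thesis using G acont_def by blast
qed

section \<open>A countable base of almost clopen sets\<close>

text \<open>Complementary relatively open sets are relatively clopen.\<close>
lemma acont_decide:
  assumes "\<And>n::nat. acont (P n)" "\<And>n. acont (Q n)" "generically (\<lambda>x. \<exists>n. P n x \<or> Q n x)"
    and "generically (\<lambda>x. \<forall>n m. \<not> (P n x \<and> Q m x))"
  shows "acont (\<lambda>x. \<exists>n. P n x)"
proof (rule acont_cong_gen)
  have "acont (\<lambda>x. LEAST n. P n x \<or> Q n x)" by (intro acont_Least acont_disj assms)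
  then show "acont (\<lambda>x. P (LEAST n. P n x \<or> Q n x) x)" by (rule acont_fam) (rule assms)
  show "generically (\<lambda>x. P (LEAST n. P n x \<or> Q n x) x = (\<exists>n. P n x))"
    using gen_conj[OF assms(3,4)]
  proof (rule gen_mono)
    fix x assume x: "(\<exists>n. P n x \<or> Q n x) \<and> (\<forall>n m. \<not> (P n x \<and> Q m x))"
    then have "P (LEAST n. P n x \<or> Q n x) x \<or> Q (LEAST n. P n x \<or> Q n x) x"
      using LeastI_ex[of "\<lambda>n. P n x \<or> Q n x"] by blast
    then show "P (LEAST n. P n x \<or> Q n x) x = (\<exists>n. P n x)" using x by blast
  qed
qed

text \<open>For a limit of almost continuous functions with an explicit error, both \<open>f x <
  t\<close> and \<open>f x > t\<close> are decided at some finite stage, as soon as the level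
  \<open>t\<close> itself is avoided.\<close>
lemma
  fixes f :: "'a \<Rightarrow> real"
  assumes g: "\<And>n::nat. acont (g n)"
    and bd: "generically (\<lambda>x. \<forall>n. g n x \<le> f x \<and> f x \<le> g n x + \<delta> n)"
    and \<delta>: "\<delta> \<longlonglongrightarrow> 0" and ne: "AE x in M. f x \<noteq> t"
  shows gen_limit_neq: "generically (\<lambda>x. f x \<noteq> t)" and acont_limit_less: "acont (\<lambda>x. f x < t)"
proof -
  define P where "P n x \<longleftrightarrow> g n x + \<delta> n < t" for n x
  define Q where "Q n x \<longleftrightarrow> g n x > t" for n x
  have acont: "acont (P n)" "acont (Q n)" for n unfolding P_def Q_def by (intro acont_intros g)+
  have 1: "(f x < t) = (\<exists>n. P n x)" "(f x > t) = (\<exists>n. Q n x)"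
    if x: "\<forall>n. g n x \<le> f x \<and> f x \<le> g n x + \<delta> n" for x
  proof -
    have small: "\<exists>n. \<delta> n < e" if "e > 0" for e
      using order_tendstoD(2)[OF \<delta> that] by (auto dest: eventually_happens)
    show "(f x < t) = (\<exists>n. P n x)"
    proof
      assume "f x < t"
      then obtain n where "\<delta> n < t - f x" using small[of "t - f x"] by auto
      then show "\<exists>n. P n x" using x unfolding P_def by (intro exI[of _ n]) (smt (verit))
    qed (use x in \<open>auto simp: P_def intro: le_less_trans\<close>)
    show "(f x > t) = (\<exists>n. Q n x)"
    proof
      assume "f x > t"
      then obtain n where "\<delta> n < f x - t" using small[of "f x - t"] by auto
      then show "\<exists>n. Q n x" using x unfolding Q_def by (intro exI[of _ n]) (smt (verit))
    qed (use x in \<open>auto simp: Q_def intro: less_le_trans\<close>)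
  qed
  have "AE x in M. \<exists>n. P n x \<or> Q n x" using gen_AE[OF bd] ne
  proof eventually_elim
    case (elim x)
    then show ?case using 1[OF elim(1)] by (metis linorder_less_linear)
  qed
  then have ex: "generically (\<lambda>x. \<exists>n. P n x \<or> Q n x)" by (intro acont_ex_gen acont_disj acont)
  show "generically (\<lambda>x. f x \<noteq> t)" using gen_conj[OF ex bd]
    by (rule gen_mono) (metis 1 less_irrefl)
  have "generically (\<lambda>x. \<forall>n m. \<not> (P n x \<and> Q m x))" using bd by (rule gen_mono) (metis 1 less_asym)
  then have "acont (\<lambda>x. \<exists>n. P n x)" using ex acont by (intro acont_decide[of P Q]) auto
  then show "acont (\<lambda>x. f x < t)"
    by (rule acont_cong_gen) (use bd in \<open>rule gen_mono, metis 1\<close>)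
qed

text \<open>The boundary of the ball is contained in the sphere, and the complement of a closed null
  set contains a generic set.\<close>
lemma acont_ball:
  assumes "{x. dist d x = r} \<in> null_sets \<mu>" shows "acont (\<lambda>x. x \<in> ball d r)"
proof -
  define Op where "Op = - {x. dist d x = r}"
  have "closed {x. dist d x = r}" by (intro closed_Collect_eq continuous_intros)
  then have "open Op" by (auto simp: Op_def)
  then have G: "generic (\<Inter>n::nat. \<Inter>k. \<tau> k -` Op)" (is "generic ?G")
    using assms by (intro generic_of_open) (auto simp: Op_def)
  have "loc_const ?G (\<lambda>x. x \<in> ball d r)"
    unfolding loc_const_def
  proof
    fix x assume "x \<in> ?G"
    then have "\<tau> 0 x \<in> Op" by blast
    then have "dist d x \<noteq> r" by (simp add: Op_def)
    then consider "dist d x < r" | "dist d x > r" by (metis linorder_neqE)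
    then show "\<exists>U. open U \<and> x \<in> U \<and> (\<forall>y\<in>U \<inter> ?G. (y \<in> ball d r) = (x \<in> ball d r))"
    proof cases
      case 1 then show ?thesis by (intro exI[of _ "ball d r"]) auto
    next
      case 2
      have "open {y. r < dist d y}" by (intro open_Collect_less continuous_intros)
      then show ?thesis using 2 by (intro exI[of _ "{y. r < dist d y}"]) auto
    qed
  qed
  then show ?thesis using G acont_def by blast
qed

lemma ex_acont_base:
  obtains U :: "nat \<Rightarrow> 'a set" where "\<And>l. open (U l)" "\<And>l. acont (\<lambda>x. x \<in> U l)"
    "\<And>x V. open V \<Longrightarrow> x \<in> V \<Longrightarrow> \<exists>l. x \<in> U l \<and> U l \<subseteq> V"
proof -
  obtain D :: "'a set" where D: "countable D" "\<And>X. open X \<Longrightarrow> X \<noteq> {} \<Longrightarrow> \<exists>d\<in>D. d \<in> X"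
    using countable_dense_exists by blast
  have "\<exists>r. 1 / real (k + 2) < r \<and> r < 1 / real (k + 1) \<and> {x. dist d x = r} \<in> null_sets \<mu>" for d k
  proof -
    have "(\<lambda>x. dist d x) \<in> borel_measurable borel" by measurable
    then have "(\<lambda>x. dist d x) \<in> borel_measurable \<mu>"
      using sets_mu measurable_cong_sets by blast
    then show ?thesis
      using ex_null_level[OF sigma_finite_mu, of "\<lambda>x. dist d x" "1 / real (k + 2)" "1 / real (k + 1)"]
      by (auto simp: divide_simps)
  qed
  then have "\<forall>d k. \<exists>r. 1 / real (k + 2) < r \<and> r < 1 / real (k + 1) \<and> {x. dist d x = r} \<in> null_sets \<mu>"
    by blast
  then have "\<exists>r. \<forall>d k. 1 / real (k + 2) < r d k \<and> r d k < 1 / real (k + 1) \<and> {x. dist d x = r d k} \<in> null_sets \<mu>"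
    by (simp only: choice_iff)
  then obtain r where "\<forall>d k. 1 / real (k + 2) < r d k \<and> r d k < 1 / real (k + 1) \<and> {x. dist d x = r d k} \<in> null_sets \<mu>"
    by blast
  then have r: "\<And>d k. 1 / real (k + 2) < r d k" "\<And>d k. r d k < 1 / real (k + 1)"
    "\<And>d k. {x. dist d x = r d k} \<in> null_sets \<mu>" by blast+
  obtain d0 where "d0 \<in> D" using D(2)[OF open_UNIV UNIV_not_empty] by blast
  then have I: "countable (D \<times> (UNIV::nat set))" "D \<times> (UNIV::nat set) \<noteq> {}" using D(1) by auto
  define U where "U l = (let p = from_nat_into (D \<times> UNIV) l in ball (fst p) (r (fst p) (snd p)))" for l
  show thesis
  proof
    show "open (U l)" for l by (simp add: U_def Let_def)
    show "acont (\<lambda>x. x \<in> U l)" for l unfolding U_def Let_def by (rule acont_ball) (rule r)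
    fix x :: 'a and V assume "open V" "x \<in> V"
    then obtain e where e: "e > 0" "ball x e \<subseteq> V" using open_contains_ball by metis
    obtain k :: nat where k: "2 / e < real k" using reals_Archimedean2 by blast
    obtain d where d: "d \<in> D" "d \<in> ball x (1 / real (k + 2))"
      using D(2)[of "ball x (1 / real (k + 2))"] by (metis centre_in_ball empty_iff open_ball
        of_nat_0_less_iff zero_less_divide_1_iff add_gr_0 zero_less_numeral)
    obtain l where l: "from_nat_into (D \<times> UNIV) l = (d, k)"
      using from_nat_into_surj[OF I(1)] d by (metis SigmaI UNIV_I)
    have small: "2 / real (k + 1) < e" using k e by (simp add: field_simps)
    have small2: "1 / real (k + 2) \<le> 1 / real (k + 1)" by (simp add: frac_le)
    have Ul: "U l = ball d (r d k)" by (simp add: U_def l)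
    note small small2
    moreover have "dist x d < 1 / real (k + 2)" using d by (simp add: dist_commute)
    moreover have "dist x y \<le> dist x d + dist d y" for y by (rule dist_triangle)
    moreover have "2 / real (k + 1) = 1 / real (k + 1) + 1 / real (k + 1)" by simp
    ultimately have "dist x y < e" if "dist d y < r d k" for y using r(2)[of d k] that
      by (smt (verit))
    then have "U l \<subseteq> ball x e" unfolding Ul by auto
    moreover have "x \<in> U l" unfolding Ul using d r(1)[of k d] by (simp add: dist_commute)
    ultimately show "\<exists>l. x \<in> U l \<and> U l \<subseteq> V" using e by blast
  qed
qed

section \<open>Ergodicity and recurrence\<close>

lemma singleton_null: "{x} \<in> null_sets \<mu>"
proof -
  have "{x} \<in> sets \<mu>" using sets_mu by simp
  moreover have "emeasure \<mu> B = 0 \<or> emeasure \<mu> ({x} - B) = 0" if "B \<subseteq> {x}" for B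
    using that by (cases "B = {}") (auto simp: subset_singleton_iff)
  ultimately show ?thesis using nonatomic_mu
    unfolding nonatomic_def measure_atom_def null_sets_def by (auto simp: zero_less_iff_neq_zero)
qed

lemma AE_visits:
  assumes "B \<in> sets \<mu>" "emeasure \<mu> B > 0" shows "AE x in \<mu>. \<exists>k. \<tau> k x \<in> B"
proof -
  define V where "V = (\<Union>k. \<tau> k -` B)"
  have V: "V \<in> sets \<mu>" unfolding V_def using vimage_tau_sets[OF assms(1)] by auto
  have Vi: "T x \<in> V \<longleftrightarrow> x \<in> V" for x
  proof -
    have "(\<exists>k. \<tau> k (\<tau> 1 x) \<in> B) \<longleftrightarrow> (\<exists>k. \<tau> k x \<in> B)"
      by (metis tau_tau diff_add_cancel)
    then show ?thesis by (simp add: V_def)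
  qed
  have "T ` V = V"
  proof
    show "V \<subseteq> T ` V" using Vi bij_T by (metis bij_pointE image_eqI subsetI)
  qed (use Vi in auto)
  then have "V \<in> null_sets \<mu> \<or> - V \<in> null_sets \<mu>"
    using ergodic_T V unfolding ergodic_def by (auto simp: Compl_eq_Diff_UNIV)
  moreover have "B \<subseteq> V" unfolding V_def using vimage_tau_0 by blast
  then have "V \<notin> null_sets \<mu>" using assms null_sets_subset[of V \<mu> B] by (auto simp: null_sets_def)
  ultimately have "- V \<in> null_sets \<mu>" by blast
  then show ?thesis by (rule AE_I') (auto simp: V_def)
qed

text \<open>Ergodicity is assumed for Borel sets only; this transfers its consequences to sets that
  are measurable for the completion.\<close>
lemma ex_borel_core:
  assumes "{x. B x} \<in> sets M" "mass B > 0"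
  obtains S where "S \<in> sets \<mu>" "emeasure \<mu> S > 0" "\<And>x. x \<in> S \<Longrightarrow> B x"
proof -
  obtain S N N' where SN: "{x. B x} = S \<union> N" "N \<subseteq> N'" "N' \<in> null_sets \<mu>" "S \<in> sets \<mu>"
    using sets_completionE[OF assms(1)] by metis
  have "N \<in> null_sets M" using SN null_sets_completion_subset[of N N' \<mu>] by (auto simp: null_sets_completionI)
  then have "emeasure \<mu> S > 0" using assms(2) SN by (simp add: emeasure_Un_null_set)
  then show thesis using that[of S] SN by blast
qed

lemma AE_visits_M:
  assumes "{x. B x} \<in> sets M" "mass B > 0" shows "AE x in M. \<exists>k. B (\<tau> k x)"
proof -
  obtain S where S: "S \<in> sets \<mu>" "emeasure \<mu> S > 0" "\<And>x. x \<in> S \<Longrightarrow> B x"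
    using ex_borel_core[OF assms] by blast
  from AE_visits[OF S(1,2)] have "AE x in \<mu>. \<exists>k. B (\<tau> k x)"
    by eventually_elim (use S(3) in blast)
  then show ?thesis by (simp add: AE_completion_iff)
qed

lemma gen_visits: "acont B \<Longrightarrow> mass B > 0 \<Longrightarrow> generically (\<lambda>x. \<exists>k. B (\<tau> k x))"
  by (rule acont_ex_gen) (auto intro: acont_shift AE_visits_M acont_sets)

text \<open>Conservativity. Let \<open>V\<close> be the forward saturation of \<open>B\<close>. The
  set \<open>W\<close> of points that have just entered \<open>V\<close> meets every orbit at most
  once. If it had positive measure, it could be split into two parts of positive measure, and the
  saturation of one part would be an invariant set that misses the other. So \<open>W\<close> is
  null, \<open>V\<close> is invariant up to null sets, and almost every point whose orbit meets
  \<open>B\<close> has already been in \<open>B\<close>.\<close>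
lemma AE_recurrent:
  assumes B: "B \<in> sets \<mu>" "emeasure \<mu> B > 0"
  shows "AE x in \<mu>. \<exists>l::nat. \<tau> (- int l) x \<in> B"
proof -
  define V where "V = (\<Union>l::nat. \<tau> (- int l) -` B)"
  define W where "W = V - \<tau> (-1) -` V"
  have V: "V \<in> sets \<mu>" unfolding V_def using vimage_tau_sets[OF B(1)] by auto
  have W: "W \<in> sets \<mu>" unfolding W_def using V vimage_tau_sets[OF V, of "-1"] by auto
  have fwd: "\<tau> (int n) x \<in> V" if x: "x \<in> V" for x and n :: nat
  proof -
    obtain l :: nat where "\<tau> (- int l) x \<in> B" using x by (auto simp: V_def)
    then have "\<tau> (- int (l + n)) (\<tau> (int n) x) \<in> B" by simp
    then show ?thesis unfolding V_def by blast
  qed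
  have wander: "k = 0" if "x \<in> W" "\<tau> k x \<in> W" for x k
  proof (rule ccontr)
    have pos: False if x: "x \<in> W" "\<tau> (int n) x \<in> W" "n > 0" for x n
    proof -
      have "\<tau> (int (n - 1)) x \<in> V" using fwd[of x "n - 1"] x(1) unfolding W_def by blast
      moreover have "\<tau> (int (n - 1)) x = \<tau> (-1) (\<tau> (int n) x)" using x(3) by (simp add: of_nat_diff)
      ultimately show False using x(2) by (auto simp: W_def)
    qed
    assume k: "k \<noteq> 0"
    show False
    proof (cases "k > 0")
      case True then show False using pos[of x "nat k"] that by simp
    next
      case False then show False using pos[of "\<tau> k x" "nat (- k)"] that k by simp
    qed
  qed
  have W0: "emeasure \<mu> W = 0"
  proof (rule ccontr)
    assume "emeasure \<mu> W \<noteq> 0"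
    then have "\<not> measure_atom \<mu> W" "emeasure \<mu> W > 0" using nonatomic_mu
      by (auto simp: nonatomic_def zero_less_iff_neq_zero)
    then obtain C where C: "C \<in> sets \<mu>" "C \<subseteq> W" "emeasure \<mu> C \<noteq> 0" "emeasure \<mu> (W - C) \<noteq> 0"
      using W unfolding measure_atom_def by blast
    from AE_visits[OF C(1)] C(3) have "AE x in \<mu>. \<exists>k. \<tau> k x \<in> C" by (simp add: zero_less_iff_neq_zero)
    then have "AE x in \<mu>. x \<notin> W - C"
    proof eventually_elim
      case (elim x)
      then obtain k where k: "\<tau> k x \<in> C" by blast
      show ?case
      proof
        assume "x \<in> W - C"
        then have "k = 0" using wander[of x k] k C(2) by blast
        then show False using k \<open>x \<in> W - C\<close> by simp
      qed
    qed
    then have "W - C \<in> null_sets \<mu>" using AE_iff_null_sets[of "W - C" \<mu>] W C(1) by auto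
    then show False using C(4) by auto
  qed
  then have "AE x in M. x \<notin> W" using W AE_not_in[of W \<mu>] by (auto simp: AE_completion_iff)
  then have 1: "AE x in M. \<forall>k. \<tau> k x \<notin> W" by (rule AE_shift_all)
  have "AE x in M. \<exists>k. \<tau> k x \<in> B" using AE_visits[OF B] by (simp add: AE_completion_iff)
  with 1 have "AE x in M. \<exists>l::nat. \<tau> (- int l) x \<in> B"
  proof eventually_elim
    case (elim x)
    then obtain k where "\<tau> k x \<in> B" by blast
    then have k: "\<tau> k x \<in> V" unfolding V_def by (metis UN_I UNIV_I of_nat_0 neg_0_equal_iff_equal vimage_tau_0)
    have "\<tau> (k - int n) x \<in> V" for n :: nat
    proof (induction n)
      case (Suc n)
      have "\<tau> (k - int n) x \<notin> W" using elim(1) by blast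
      then show ?case using Suc by (simp add: W_def algebra_simps)
    qed (use k in simp)
    from this[of "nat k"] have "\<tau> (k - int (nat k)) x \<in> V" .
    then have "\<tau> (int (nat (- k))) (\<tau> (k - int (nat k)) x) \<in> V" by (rule fwd)
    then have "x \<in> V" by (cases "k \<ge> 0") simp_all
    then show ?case by (simp add: V_def)
  qed
  then show ?thesis by (simp add: AE_completion_iff)
qed

lemma gen_recurrent:
  assumes "acont B" "mass B > 0" shows "generically (\<lambda>x. \<exists>l::nat. B (\<tau> (- int l) x))"
proof (rule acont_ex_gen)
  show "acont (\<lambda>x. B (\<tau> (- int l) x))" for l by (intro acont_shift assms)
  obtain S where S: "S \<in> sets \<mu>" "emeasure \<mu> S > 0" "\<And>x. x \<in> S \<Longrightarrow> B x"
    using ex_borel_core[OF acont_sets[OF assms(1)] assms(2)] by blast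
  from AE_recurrent[OF S(1,2)] have "AE x in \<mu>. \<exists>l::nat. B (\<tau> (- int l) x)"
    by eventually_elim (use S(3) in blast)
  then show "AE x in M. \<exists>l::nat. B (\<tau> (- int l) x)" by (simp add: AE_completion_iff)
qed

section \<open>Pieces of prescribed measure\<close>

lemma ex_acont_finite: obtains A where "acont A" "mass A > 0" "mass A < \<infinity>"
proof -
  obtain V where V: "open V" "0 < emeasure \<mu> V" "emeasure \<mu> V < \<infinity>" using open_finite by blast
  obtain U :: "nat \<Rightarrow> 'a set" where U: "\<And>l. open (U l)" "\<And>l. acont (\<lambda>x. x \<in> U l)"
    "\<And>x V. open V \<Longrightarrow> x \<in> V \<Longrightarrow> \<exists>l. x \<in> U l \<and> U l \<subseteq> V"
    using ex_acont_base by blast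
  have sets: "U l \<in> sets \<mu>" "V \<in> sets \<mu>" for l using U(1) V(1) sets_mu by auto
  have "\<exists>l. U l \<subseteq> V \<and> emeasure \<mu> (U l) > 0"
  proof (rule ccontr)
    assume "\<not> ?thesis"
    then have "(\<Union>l\<in>{l. U l \<subseteq> V}. U l) \<in> null_sets \<mu>"
      using sets by (intro null_sets_UN') (auto simp: null_sets_def)
    moreover have "(\<Union>l\<in>{l. U l \<subseteq> V}. U l) = V" using U(3)[OF V(1)] by blast
    ultimately show False using V(2) by (simp add: null_sets_def)
  qed
  then obtain l where l: "U l \<subseteq> V" "emeasure \<mu> (U l) > 0" by blast
  then have "emeasure \<mu> (U l) < \<infinity>" using emeasure_mono[OF l(1) sets(2)] V(3) by (metis le_less_trans)
  then show thesis using that[of "\<lambda>x. x \<in> U l"] U(2) l(2) sets by simp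
qed

text \<open>Base 3 makes the expansion with digits 0 and 1 injective, since the first differing
  digit outweighs all later ones. The finite partial sums depend on finitely many digits.\<close>
lemma ternary_digits:
  fixes b :: "nat \<Rightarrow> 'c \<Rightarrow> bool"
  defines "f \<equiv> \<lambda>x. (\<Sum>l. (if b l x then 1 else 0) * (1/3::real) ^ Suc l)"
    and "g \<equiv> \<lambda>n x. (\<Sum>l<n. (if b l x then 1 else 0) * (1/3::real) ^ Suc l)"
  shows "g n x \<le> f x" "f x \<le> g n x + (1/3)^n / 2"
    and "f x = f y \<Longrightarrow> b l x = b l y"
proof -
  have geo: "(\<lambda>l. (1/3::real) ^ Suc (l + n)) sums ((1/3)^n / 2)" for n
    using sums_mult[OF geometric_sums[of "1/3::real"], of "(1/3) ^ Suc n"]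
    by (simp add: power_add field_simps)
  have geo_s: "summable (\<lambda>l. (1/3::real) ^ Suc l)" using geo[of 0] by (auto simp: sums_iff)
  have s: "summable (\<lambda>l. (if b l x then 1 else 0) * (1/3::real) ^ Suc l)" for x
    by (rule summable_comparison_test'[OF geo_s, of 0]) auto
  have split: "f x = g n x + (\<Sum>l. (if b (l + n) x then 1 else 0) * (1/3::real) ^ Suc (l + n))" for n x
    unfolding f_def g_def using suminf_split_initial_segment[OF s[of x], of n] by simp
  have s': "summable (\<lambda>l. (if b (l + n) x then 1 else 0) * (1/3::real) ^ Suc (l + n))" for n x
    using summable_ignore_initial_segment[OF s[of x], of n] .
  have lo: "g n x \<le> f x" for n x
  proof -
    have "0 \<le> (\<Sum>l. (if b (l + n) x then 1 else 0) * (1/3::real) ^ Suc (l + n))"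
      by (rule suminf_nonneg[OF s']) auto
    then show ?thesis unfolding split[of x n] by simp
  qed
  have hi: "f x \<le> g n x + (1/3)^n / 2" for n x
  proof -
    have "(\<Sum>l. (if b (l + n) x then 1 else 0) * (1/3::real) ^ Suc (l + n)) \<le> (\<Sum>l. (1/3::real) ^ Suc (l + n))"
      using geo[of n] by (intro suminf_le s') (auto simp: sums_iff)
    also have "\<dots> = (1/3)^n / 2" using geo[of n] by (simp add: sums_iff)
    finally show ?thesis unfolding split[of x n] by simp
  qed
  show "g n x \<le> f x" "f x \<le> g n x + (1/3)^n / 2" by (fact lo hi)+
  have aux: "f u < f v" if eq: "\<And>k. k < l \<Longrightarrow> b k u = b k v" and d: "\<not> b l u" "b l v" for l u v
  proof -
    have "g l u = g l v" unfolding g_def using eq by (intro sum.cong) auto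
    then have "g (Suc l) u + (1/3) ^ Suc l = g (Suc l) v" using d by (simp add: g_def)
    moreover have "(1/3::real)^Suc l / 2 < (1/3) ^ Suc l" by simp
    ultimately show ?thesis using hi[of u "Suc l"] lo[of "Suc l" v] by linarith
  qed
  show "b l x = b l y" if "f x = f y"
  proof (rule ccontr)
    assume "b l x \<noteq> b l y"
    define m where "m = (LEAST l. b l x \<noteq> b l y)"
    have m: "b m x \<noteq> b m y" unfolding m_def by (rule LeastI) fact
    have eq: "b k x = b k y" if "k < m" for k using not_less_Least[of k] that unfolding m_def by blast
    show False
    proof (cases "b m x")
      case True
      then have "f y < f x" using m eq by (intro aux[of m]) auto
      then show False using \<open>f x = f y\<close> by simp
    next
      case False
      then have "f x < f y" using m eq by (intro aux[of m]) auto
      then show False using \<open>f x = f y\<close> by simp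
    qed
  qed
qed

text \<open>With such a function a set can be cut at any prescribed measure: sublevel sets are
  almost clopen, and their measure grows without jumps.\<close>
definition coordinate :: "('a \<Rightarrow> real) \<Rightarrow> bool" where
  "coordinate L \<longleftrightarrow> (\<forall>t. acont (\<lambda>x. L x < t)) \<and> (\<forall>t. generically (\<lambda>x. L x \<noteq> t)) \<and>
     (\<forall>t. mass (\<lambda>x. L x < t) < \<infinity>) \<and> (\<forall>x. 0 \<le> L x)"

text \<open>The integer part of the coordinate exhausts the space by sets of finite measure, the
  translates of one such set; the fractional part encodes membership in the sets of a base. Points
  are separated by the base, so level sets have at most one element and are null.\<close>
lemma ex_coordinate: "\<exists>L. coordinate L"
proof -
  obtain U :: "nat \<Rightarrow> 'a set" where U: "\<And>l. open (U l)" "\<And>l. acont (\<lambda>x. x \<in> U l)"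
    "\<And>x V. open V \<Longrightarrow> x \<in> V \<Longrightarrow> \<exists>l. x \<in> U l \<and> U l \<subseteq> V"
    using ex_acont_base by blast
  obtain A where A: "acont A" "mass A > 0" "mass A < \<infinity>" by (rule ex_acont_finite)
  define N where "N x = (LEAST n. A (\<tau> (int_decode n) x))" for x
  have ex: "generically (\<lambda>x. \<exists>n. A (\<tau> (int_decode n) x))"
    using gen_visits[OF A(1,2)] by (rule gen_mono) (metis int_encode_inverse)
  have N: "acont N" unfolding N_def by (intro acont_Least ex acont_shift[OF A(1)])
  have NA: "generically (\<lambda>x. A (\<tau> (int_decode (N x)) x))"
    using ex unfolding N_def by (rule gen_mono) (rule LeastI_ex)
  define f where "f x = (\<Sum>l. (if x \<in> U l then 1 else 0) * (1/3::real) ^ Suc l)" for x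
  define g where "g n x = (\<Sum>l<n. (if x \<in> U l then 1 else 0) * (1/3::real) ^ Suc l)" for n x
  define L where "L x = real (N x) + f x" for x
  have fg: "g n x \<le> f x" "f x \<le> g n x + (1/3)^n / 2" for n x
    unfolding f_def g_def
    by (rule ternary_digits(1)[where b = "\<lambda>l x. x \<in> U l"], rule ternary_digits(2)[where b = "\<lambda>l x. x \<in> U l"])
  have fg3: "x \<in> U l \<longleftrightarrow> y \<in> U l" if "f x = f y" for x y l
    using that unfolding f_def by (rule ternary_digits(3)[where b = "\<lambda>l x. x \<in> U l"])
  have inj: "x = y" if "L x = L y" for x y
  proof -
    have "0 \<le> f z" "f z \<le> 1 / 2" for z using fg(1)[of 0 z] fg(2)[of z 0] by (simp_all add: g_def)
    note this[of x] this[of y]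
    then have "N x = N y" using that unfolding L_def by linarith
    then have "f x = f y" using that unfolding L_def by simp
    then have "\<forall>l. x \<in> U l \<longleftrightarrow> y \<in> U l" using fg3 by blast
    then show "x = y" using U(3) by (metis hausdorff disjoint_iff subsetD)
  qed
  have gac: "acont (\<lambda>x. real (N x) + g n x)" for n
  proof -
    have "acont (g n)"
    proof (induction n)
      case (Suc n)
      have "acont (\<lambda>x. g n x + (if x \<in> U n then 1 else 0) * (1/3::real) ^ Suc n)"
        by (intro acont_plus Suc acont_comp[of _ "\<lambda>a. (if a then 1 else 0) * (1/3::real) ^ Suc n"] U)
      then show ?case by (simp add: g_def[abs_def])
    qed (simp add: g_def[abs_def] acont_const)
    then show ?thesis by (intro acont_plus acont_comp[OF N])
  qed
  have bd: "generically (\<lambda>x. \<forall>n. real (N x) + g n x \<le> L x \<and> L x \<le> real (N x) + g n x + (1/3)^n / 2)"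
    using fg by (intro gen_all) (auto simp: L_def)
  have lim: "(\<lambda>n. (1/3::real)^n / 2) \<longlonglongrightarrow> 0"
    using tendsto_divide[OF LIMSEQ_realpow_zero[of "1/3::real"] tendsto_const[of 2]] by simp
  have ne: "AE x in M. L x \<noteq> t" for t
  proof -
    have "\<exists>z. {x. L x = t} \<subseteq> {z}" using inj by blast
    then obtain z where "{x. L x = t} \<subseteq> {z}" by blast
    then have "AE x in \<mu>. L x \<noteq> t" using singleton_null[of z] by (intro AE_I'[of "{z}"]) auto
    then show ?thesis by (simp add: AE_completion_iff)
  qed
  show ?thesis unfolding coordinate_def
  proof (intro exI[of _ L] conjI allI)
    show "acont (\<lambda>x. L x < t)" for t by (rule acont_limit_less[OF gac bd lim ne])
    show "generically (\<lambda>x. L x \<noteq> t)" for t by (rule gen_limit_neq[OF gac bd lim ne])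
    show "0 \<le> L x" for x using fg(1)[of 0 x] by (simp add: L_def g_def)
    show "mass (\<lambda>x. L x < t) < \<infinity>" for t
    proof -
      define m where "m = nat \<lceil>t\<rceil>"
      have "mass (\<lambda>x. L x < t) \<le> mass (\<lambda>x. \<exists>n\<in>{..<m}. A (\<tau> (int_decode n) x))"
      proof (rule emeasure_mono_AE)
        show "AE x in M. x \<in> {x. L x < t} \<longrightarrow> x \<in> {x. \<exists>n\<in>{..<m}. A (\<tau> (int_decode n) x)}"
          using gen_AE[OF NA]
        proof eventually_elim
          case (elim x)
          have "real (N x) \<le> L x" using fg(1)[of 0 x] by (simp add: L_def g_def)
          then have "L x < t \<longrightarrow> N x < m" unfolding m_def by linarith
          then show ?case using elim by auto
        qed
        show "{x. \<exists>n\<in>{..<m}. A (\<tau> (int_decode n) x)} \<in> sets M" by (intro acont_sets acont_finite_bex acont_shift[OF A(1)]) simp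
      qed
      also have "{x. \<exists>n\<in>{..<m}. A (\<tau> (int_decode n) x)} = (\<Union>n\<in>{..<m}. {x. A (\<tau> (int_decode n) x)})" by auto
      also have "emeasure M \<dots> \<le> (\<Sum>n\<in>{..<m}. mass (\<lambda>x. A (\<tau> (int_decode n) x)))"
        by (intro emeasure_subadditive_finite) (auto intro!: acont_sets acont_finite_bex acont_shift[OF A(1)])
      also have "\<dots> = (\<Sum>n\<in>{..<m}. mass A)" using mass_shift[OF acont_sets[OF A(1)]] by simp
      also have "\<dots> < \<infinity>" using A(3) by (simp add: ennreal_mult_less_top of_nat_less_top)
      finally show ?thesis .
    qed
  qed
qed

lemma AE_imp_mass_le:
  assumes "AE x in M. P x \<longrightarrow> Q x" "acont Q" shows "mass P \<le> mass Q"
  using assms by (intro emeasure_mono_AE acont_sets) auto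

lemma acont_mass_cong: "generically (\<lambda>x. P x = Q x) \<Longrightarrow> acont P \<Longrightarrow> mass P = mass Q"
  using mass_cong_AE(2)[OF gen_AE acont_sets] .

text \<open>Such an \<open>H\<close> pushes the measure on \<open>A\<close> forward to Lebesgue
  measure on an initial segment of the half-line.\<close>
definition uniform_height :: "('a \<Rightarrow> bool) \<Rightarrow> ('a \<Rightarrow> real) \<Rightarrow> bool" where
  "uniform_height A H \<longleftrightarrow> (\<forall>t. acont (\<lambda>x. A x \<and> H x < t)) \<and> (\<forall>x. 0 \<le> H x) \<and>
    (\<forall>t. 0 \<le> t \<longrightarrow> ennreal t \<le> mass A \<longrightarrow> mass (\<lambda>x. A x \<and> H x < t) = ennreal t)"

text \<open>The distribution function \<open>F\<close> of the coordinate on \<open>A\<close> is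
  continuous because level sets are null, hence \<open>H = F \<circ> L\<close> is uniformly
  distributed. The set \<open>H < t\<close> is a sublevel set of the coordinate \<open>L\<close>, up
  to the level at the endpoint.\<close>
lemma ex_uniform_height:
  assumes A: "acont A" shows "\<exists>H. uniform_height A H"
proof -
  obtain L where "coordinate L" using ex_coordinate by blast
  then have L: "\<And>t. acont (\<lambda>x. L x < t)" "\<And>t. generically (\<lambda>x. L x \<noteq> t)"
    "\<And>t. mass (\<lambda>x. L x < t) < \<infinity>" "\<And>x. L x \<ge> 0" unfolding coordinate_def by simp_all
  define F where "F t = measure M {x. A x \<and> L x < t}" for t
  have acF: "acont (\<lambda>x. A x \<and> L x < t)" for t by (intro acont_intros A L)
  have fin: "mass (\<lambda>x. A x \<and> L x < t) < \<infinity>" for t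
  proof -
    have "mass (\<lambda>x. A x \<and> L x < t) \<le> mass (\<lambda>x. L x < t)" by (intro AE_imp_mass_le L) auto
    then show ?thesis using L(3)[of t] by (metis le_less_trans)
  qed
  have massF: "mass (\<lambda>x. A x \<and> L x < t) = ennreal (F t)" for t
    unfolding F_def using fin[of t] by (intro emeasure_eq_ennreal_measure) auto
  have F0: "F t \<ge> 0" for t by (simp add: F_def)
  have Fneg: "F t = 0" if "t \<le> 0" for t
  proof -
    have "{x. A x \<and> L x < t} = {}" using L(4) that by (auto simp: not_less intro: order_trans)
    then show ?thesis unfolding F_def by (metis measure_empty)
  qed
  have Fmono: "F s \<le> F t" if "s \<le> t" for s t
  proof -
    have "ennreal (F s) \<le> ennreal (F t)" unfolding massF[symmetric]
      by (intro AE_imp_mass_le acF) (use that in auto)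
    then show ?thesis using F0 by simp
  qed
  \<comment> \<open>Left continuity is continuity from below; right continuity holds because level sets are null.\<close>
  have left: "(\<lambda>n. F (t - 1 / real (Suc n))) \<longlonglongrightarrow> F t" for t
  proof -
    have "(\<lambda>n. measure M {x. A x \<and> L x < t - 1 / real (Suc n)}) \<longlonglongrightarrow> measure M (\<Union>n. {x. A x \<and> L x < t - 1 / real (Suc n)})"
    proof (rule Lim_measure_incseq)
      show "range (\<lambda>n. {x. A x \<and> L x < t - 1 / real (Suc n)}) \<subseteq> sets M" using acont_sets[OF acF] by auto
      show "incseq (\<lambda>n. {x. A x \<and> L x < t - 1 / real (Suc n)})"
        by (rule incseq_SucI) (auto elim!: less_le_trans simp: frac_le)
      have "emeasure M (\<Union>n. {x. A x \<and> L x < t - 1 / real (Suc n)}) \<le> mass (\<lambda>x. A x \<and> L x < t)"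
        by (rule emeasure_mono) (use acont_sets[OF acF] in \<open>auto elim!: less_le_trans\<close>)
      then show "emeasure M (\<Union>n. {x. A x \<and> L x < t - 1 / real (Suc n)}) \<noteq> \<infinity>"
        using fin[of t] by (auto simp: top_unique)
    qed
    also have "(\<Union>n. {x. A x \<and> L x < t - 1 / real (Suc n)}) = {x. A x \<and> L x < t}"
    proof (intro equalityI subsetI)
      fix x assume x: "x \<in> {x. A x \<and> L x < t}"
      then obtain n where "1 / real (Suc n) < t - L x" using reals_Archimedean[of "t - L x"]
        by (auto simp: inverse_eq_divide)
      then show "x \<in> (\<Union>n. {x. A x \<and> L x < t - 1 / real (Suc n)})" using x by (auto simp: algebra_simps intro!: exI[of _ n])
    qed (auto elim!: less_le_trans)
    finally show ?thesis by (simp add: F_def)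
  qed
  have right: "(\<lambda>n. F (t + 1 / real (Suc n))) \<longlonglongrightarrow> F t" for t
  proof -
    have "(\<lambda>n. measure M {x. A x \<and> L x < t + 1 / real (Suc n)}) \<longlonglongrightarrow> measure M (\<Inter>n. {x. A x \<and> L x < t + 1 / real (Suc n)})"
    proof (rule Lim_measure_decseq)
      show "range (\<lambda>n. {x. A x \<and> L x < t + 1 / real (Suc n)}) \<subseteq> sets M" using acont_sets[OF acF] by auto
      show "decseq (\<lambda>n. {x. A x \<and> L x < t + 1 / real (Suc n)})"
        by (rule decseq_SucI) (auto elim!: less_le_trans simp: frac_le)
      show "emeasure M {x. A x \<and> L x < t + 1 / real (Suc n)} \<noteq> \<infinity>" for n using fin[of "t + 1 / real (Suc n)"] by auto
    qed
    also have "measure M (\<Inter>n. {x. A x \<and> L x < t + 1 / real (Suc n)}) = F t" unfolding F_def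
    proof (rule measure_eq_AE)
      show "AE x in M. x \<in> (\<Inter>n. {x. A x \<and> L x < t + 1 / real (Suc n)}) \<longleftrightarrow> x \<in> {x. A x \<and> L x < t}"
        using gen_AE[OF L(2)[of t]]
      proof eventually_elim
        case (elim x)
        have "(\<forall>n. L x < t + 1 / real (Suc n)) \<longleftrightarrow> L x < t"
        proof
          assume a: "\<forall>n. L x < t + 1 / real (Suc n)"
          have "L x \<le> t"
          proof (rule ccontr)
            assume "\<not> L x \<le> t"
            then obtain n where "1 / real (Suc n) < L x - t" using reals_Archimedean[of "L x - t"]
              by (auto simp: inverse_eq_divide)
            then show False using a[rule_format, of n] by linarith
          qed
          then show "L x < t" using elim by simp
        qed (auto elim: less_trans)
        then show ?case by auto
      qed
    qed (use acont_sets[OF acF] in auto)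
    finally show ?thesis by (simp add: F_def)
  qed
  define S where "S t = {s. t \<le> F s}" for t
  define H where "H x = F (L x)" for x
  have SE: "generically (\<lambda>x. (A x \<and> L x < Inf (S t)) = (A x \<and> H x < t))" if t: "t > 0" "S t \<noteq> {}" for t
    using L(2)[of "Inf (S t)"]
  proof (rule gen_mono)
    have bdd: "bdd_below (S t)" unfolding S_def using t(1) Fneg
      by (intro bdd_belowI[of _ 0]) (metis leD linear mem_Collect_eq)
    fix x assume x: "L x \<noteq> Inf (S t)"
    show "(A x \<and> L x < Inf (S t)) = (A x \<and> H x < t)"
    proof (cases "L x < Inf (S t)")
      case True
      then have "L x \<notin> S t" using cInf_lower[OF _ bdd] by force
      then show ?thesis using True by (auto simp: S_def H_def)
    next
      case False
      then obtain s where "s \<in> S t" "s < L x" using x cInf_less_iff[OF t(2) bdd, of "L x"] by auto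
      then have "t \<le> F (L x)" using Fmono[of s "L x"] by (simp add: S_def)
      then show ?thesis using False by (simp add: H_def)
    qed
  qed
  have Sempty: "(\<lambda>x. A x \<and> H x < t) = A" if "S t = {}" for t
    using that by (auto simp: S_def H_def not_le)
  have Hneg: "(\<lambda>x. A x \<and> H x < t) = (\<lambda>x. False)" if "t \<le> 0" for t
  proof -
    have "\<not> H x < t" for x using F0[of "L x"] that by (simp add: H_def)
    then show ?thesis by simp
  qed
  show ?thesis unfolding uniform_height_def
  proof (intro exI[of _ H] conjI allI impI)
    show "acont (\<lambda>x. A x \<and> H x < t)" for t
    proof (cases "t > 0")
      case True
      show ?thesis
      proof (cases "S t = {}")
        case False
        show ?thesis by (rule acont_cong_gen[OF acF SE[OF True False]])
      qed (simp add: Sempty A)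
    qed (simp add: Hneg acont_const)
    show "0 \<le> H x" for x by (simp add: H_def F0)
    fix t assume t: "0 \<le> t" "ennreal t \<le> mass A"
    consider "t = 0" | "t > 0" "S t = {}" | "t > 0" "S t \<noteq> {}" using t(1) by force
    then show "mass (\<lambda>x. A x \<and> H x < t) = ennreal t"
    proof cases
      case 1
      then show ?thesis using Hneg[of 0] by simp
    next
      case 2
      have "mass A \<le> ennreal t"
      proof -
        have "incseq (\<lambda>n::nat. {x. A x \<and> L x < real n})"
          by (rule incseq_SucI) auto
        then have "(SUP n. mass (\<lambda>x. A x \<and> L x < real n)) = emeasure M (\<Union>n::nat. {x. A x \<and> L x < real n})"
          using acont_sets[OF acF] by (intro SUP_emeasure_incseq) auto
        also have "(\<Union>n::nat. {x. A x \<and> L x < real n}) = {x. A x}" using reals_Archimedean2 by auto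
        finally have "mass A = (SUP n. mass (\<lambda>x. A x \<and> L x < real n))" by simp
        also have "\<dots> \<le> ennreal t"
        proof (rule SUP_least)
          fix n :: nat
          have "F (real n) \<le> t" using 2(2) by (auto simp: S_def not_le intro: less_imp_le)
          then show "mass (\<lambda>x. A x \<and> L x < real n) \<le> ennreal t" using massF by (simp add: ennreal_leI)
        qed
        finally show ?thesis .
      qed
      then show ?thesis using t(2) Sempty[OF 2(2)] by (metis antisym)
    next
      case 3
      define s where "s = Inf (S t)"
      have bdd: "bdd_below (S t)" unfolding S_def using 3(1) Fneg
        by (intro bdd_belowI[of _ 0]) (metis leD linear mem_Collect_eq)
      have "F s \<le> t"
      proof (rule LIMSEQ_le_const2[OF left[of s]])
        have "F (s - 1 / real (Suc n)) \<le> t" for n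
        proof -
          have "s - 1 / real (Suc n) \<notin> S t" using cInf_lower[OF _ bdd, of "s - 1 / real (Suc n)"] by (auto simp: s_def)
          then show ?thesis by (simp add: S_def)
        qed
        then show "\<exists>N. \<forall>n\<ge>N. F (s - 1 / real (Suc n)) \<le> t" by blast
      qed
      moreover have "t \<le> F s"
      proof (rule LIMSEQ_le_const[OF right[of s]])
        have "t \<le> F (s + 1 / real (Suc n))" for n
        proof -
          obtain u where "u \<in> S t" "u < s + 1 / real (Suc n)"
            using cInf_less_iff[OF 3(2) bdd, of "s + 1 / real (Suc n)"] by (auto simp: s_def)
          then show ?thesis using Fmono[of u "s + 1 / real (Suc n)"] by (simp add: S_def)
        qed
        then show "\<exists>N. \<forall>n\<ge>N. t \<le> F (s + 1 / real (Suc n))" by blast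
      qed
      ultimately have "F s = t" by simp
      then show ?thesis using massF[of s] acont_mass_cong[OF SE[OF 3] acF] by (simp add: s_def)
    qed
  qed
qed

lemma ex_equal_pieces:
  assumes A: "acont A" and s: "s > (0::real)"
  obtains v :: "'a \<Rightarrow> nat" where "acont v"
    "\<And>r. ennreal (real (r + 1) * s) \<le> mass A \<Longrightarrow> mass (\<lambda>x. A x \<and> v x = r) = ennreal s"
proof -
  obtain H where "uniform_height A H" using ex_uniform_height[OF A] by blast
  then have H: "\<And>t. acont (\<lambda>x. A x \<and> H x < t)" "\<And>x. H x \<ge> 0"
    "\<And>t. 0 \<le> t \<Longrightarrow> ennreal t \<le> mass A \<Longrightarrow> mass (\<lambda>x. A x \<and> H x < t) = ennreal t"
    unfolding uniform_height_def by simp_all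
  define v where "v x = (if A x then nat \<lfloor>H x / s\<rfloor> else 0)" for x
  have v: "A x \<and> v x = r \<longleftrightarrow> (A x \<and> H x < real (r + 1) * s) \<and> \<not> (A x \<and> H x < real r * s)" for x r
  proof -
    have "nat \<lfloor>H x / s\<rfloor> = r \<longleftrightarrow> \<lfloor>H x / s\<rfloor> = int r" using H(2)[of x] s by auto
    also have "\<dots> \<longleftrightarrow> real r * s \<le> H x \<and> H x < real (r + 1) * s"
      using s by (auto simp: floor_eq_iff field_simps)
    finally show ?thesis unfolding v_def by auto
  qed
  have acv: "acont (\<lambda>x. A x \<and> v x = r)" for r unfolding v by (intro acont_intros H)
  show thesis
  proof
    show "acont v"
    proof (rule acont_of_levels)
      fix r
      have eq: "(\<lambda>x. v x = r) = (\<lambda>x. (A x \<and> v x = r) \<or> (\<not> A x \<and> r = 0))" by (auto simp: v_def)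
      show "acont (\<lambda>x. v x = r)" unfolding eq by (intro acont_disj acv acont_conj acont_not A acont_const)
    qed
    fix r assume r: "ennreal (real (r + 1) * s) \<le> mass A"
    have r': "ennreal (real r * s) \<le> mass A"
      by (rule order_trans[OF _ r], rule ennreal_leI) (use s in \<open>simp add: field_simps\<close>)
    have "mass (\<lambda>x. A x \<and> v x = r) = emeasure M ({x. A x \<and> H x < real (r + 1) * s} - {x. A x \<and> H x < real r * s})"
      unfolding v by (rule arg_cong[where f="emeasure M"]) auto
    also have "\<dots> = mass (\<lambda>x. A x \<and> H x < real (r + 1) * s) - mass (\<lambda>x. A x \<and> H x < real r * s)"
    proof (rule emeasure_Diff)
      show "{x. A x \<and> H x < real r * s} \<subseteq> {x. A x \<and> H x < real (r + 1) * s}"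
        using s by (auto simp: algebra_simps elim!: less_trans intro: less_le_trans)
    qed (use H(3)[OF _ r'] s acont_sets[OF H(1)] in auto)
    also have "\<dots> = ennreal (real (r + 1) * s) - ennreal (real r * s)"
      using H(3)[OF _ r] H(3)[OF _ r'] s by simp
    also have "\<dots> = ennreal s" using s by (simp add: ennreal_minus algebra_simps)
    finally show "mass (\<lambda>x. A x \<and> v x = r) = ennreal s" .
  qed
qed

section \<open>Orbit isomorphisms\<close>

text \<open>Isomorphisms in the full groupoid of \<open>T\<close>. They are represented by their
  cocycles, the exponents of the powers of \<open>T\<close> that are applied, so that almost
  continuity can be stated for functions with values in \<open>\<int>\<close>. The conditions say
  that \<open>x \<mapsto> \<tau> (c x) x\<close> and \<open>x \<mapsto> \<tau> (c' x) x\<close> are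
  mutually inverse, on the level of cocycles.\<close>
definition orbit_iso :: "('a \<Rightarrow> int) \<Rightarrow> ('a \<Rightarrow> int) \<Rightarrow> ('a \<Rightarrow> bool) \<Rightarrow> ('a \<Rightarrow> bool) \<Rightarrow> bool" where
  "orbit_iso c c' C D \<longleftrightarrow> acont c \<and> acont c' \<and>
     generically (\<lambda>x. C x \<longrightarrow> D (\<tau> (c x) x) \<and> c' (\<tau> (c x) x) = - c x) \<and>
     generically (\<lambda>x. D x \<longrightarrow> C (\<tau> (c' x) x) \<and> c (\<tau> (c' x) x) = - c' x)"

lemma orbit_isoD:
  assumes "orbit_iso c c' C D"
  shows "acont c" "acont c'" "generically (\<lambda>x. C x \<longrightarrow> D (\<tau> (c x) x) \<and> c' (\<tau> (c x) x) = - c x)"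
    "generically (\<lambda>x. D x \<longrightarrow> C (\<tau> (c' x) x) \<and> c (\<tau> (c' x) x) = - c' x)"
  using assms unfolding orbit_iso_def by auto

lemma orbit_iso_sym: "orbit_iso c c' C D \<Longrightarrow> orbit_iso c' c D C"
  unfolding orbit_iso_def by blast

lemma orbit_iso_trans:
  assumes 1: "orbit_iso c c' C D" and 2: "orbit_iso d d' D E"
  shows "orbit_iso (\<lambda>x. c x + d (\<tau> (c x) x)) (\<lambda>x. d' x + c' (\<tau> (d' x) x)) C E"
proof -
  note c = orbit_isoD[OF 1] and d = orbit_isoD[OF 2]
  have *: "generically (\<lambda>x. C x \<longrightarrow> E (\<tau> (c x + d (\<tau> (c x) x)) x) \<and>
      d' (\<tau> (c x + d (\<tau> (c x) x)) x) + c' (\<tau> (d' (\<tau> (c x + d (\<tau> (c x) x)) x)) (\<tau> (c x + d (\<tau> (c x) x)) x))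
       = - (c x + d (\<tau> (c x) x)))"
    if c: "generically (\<lambda>x. C x \<longrightarrow> D (\<tau> (c x) x) \<and> c' (\<tau> (c x) x) = - c x)"
      and d: "generically (\<lambda>x. D x \<longrightarrow> E (\<tau> (d x) x) \<and> d' (\<tau> (d x) x) = - d x)" for c c' d d' C D E
    using gen_conj[OF c gen_shift[OF d]]
  proof (rule gen_mono, intro impI)
    fix x assume h: "(C x \<longrightarrow> D (\<tau> (c x) x) \<and> c' (\<tau> (c x) x) = - c x) \<and>
         (\<forall>k. D (\<tau> k x) \<longrightarrow> E (\<tau> (d (\<tau> k x)) (\<tau> k x)) \<and> d' (\<tau> (d (\<tau> k x)) (\<tau> k x)) = - d (\<tau> k x))"
      and "C x"
    define y where "y = \<tau> (c x) x"
    have y: "D y" "c' y = - c x" using h \<open>C x\<close> by (auto simp: y_def)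
    have z: "E (\<tau> (d y) y)" "d' (\<tau> (d y) y) = - d y" using h y(1) unfolding y_def by blast+
    have e: "\<tau> (c x + d y) x = \<tau> (d y) y" by (simp add: y_def add.commute)
    have "\<tau> (- d y) (\<tau> (d y) y) = y" by simp
    then show "E (\<tau> (c x + d (\<tau> (c x) x)) x) \<and>
      d' (\<tau> (c x + d (\<tau> (c x) x)) x) + c' (\<tau> (d' (\<tau> (c x + d (\<tau> (c x) x)) x)) (\<tau> (c x + d (\<tau> (c x) x)) x))
       = - (c x + d (\<tau> (c x) x))"
      unfolding y_def[symmetric] e z(2) using z(1) y(2) by simp
  qed
  show ?thesis unfolding orbit_iso_def
    using *[OF c(3) d(3)] *[OF d(4) c(4)] by (intro conjI acont_plus acont_subst[of c d] acont_subst[of d' c'] c(1,2) d(1,2))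
qed

lemma orbit_iso_shift: "orbit_iso (\<lambda>_. k) (\<lambda>_. - k) C (\<lambda>x. C (\<tau> (- k) x))"
  unfolding orbit_iso_def by (intro conjI acont_const gen_all) auto

lemma orbit_iso_cong:
  assumes "orbit_iso c c' C D" "acont d" "generically (\<lambda>x. C x = C1 x)" "generically (\<lambda>x. D x = D1 x)"
    and "generically (\<lambda>x. C x \<longrightarrow> d x = c x)"
  shows "orbit_iso d c' C1 D1"
proof -
  note c = orbit_isoD[OF assms(1)]
  have g: "generically (\<lambda>x. (C x \<longrightarrow> D (\<tau> (c x) x) \<and> c' (\<tau> (c x) x) = - c x) \<and>
     (D x \<longrightarrow> C (\<tau> (c' x) x) \<and> c (\<tau> (c' x) x) = - c' x) \<and>
     (\<forall>k. (C (\<tau> k x) = C1 (\<tau> k x)) \<and> (D (\<tau> k x) = D1 (\<tau> k x)) \<and> (C (\<tau> k x) \<longrightarrow> d (\<tau> k x) = c (\<tau> k x))))"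
    using gen_conj[OF c(3) gen_conj[OF c(4) gen_shift[OF gen_conj[OF assms(3) gen_conj[OF assms(4,5)]]]]] .
  have "generically (\<lambda>x. C1 x \<longrightarrow> D1 (\<tau> (d x) x) \<and> c' (\<tau> (d x) x) = - d x)"
    using g by (rule gen_mono) (metis tau_0)
  moreover have "generically (\<lambda>x. D1 x \<longrightarrow> C1 (\<tau> (c' x) x) \<and> d (\<tau> (c' x) x) = - c' x)"
    using g by (rule gen_mono) (metis tau_0)
  ultimately show ?thesis using assms(2) c(2) by (simp add: orbit_iso_def)
qed

lemma mass_split:
  fixes n :: "'a \<Rightarrow> nat"
  assumes "acont P" "acont n" shows "mass P = (\<Sum>k. mass (\<lambda>x. P x \<and> n x = k))"
proof -
  have "(\<Sum>k. emeasure M ((\<lambda>k. {x. P x \<and> n x = k}) k)) = emeasure M (\<Union>k. (\<lambda>k. {x. P x \<and> n x = k}) k)"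
    by (rule suminf_emeasure) (auto simp: disjoint_family_on_def intro!: acont_sets acont_conj assms acont_eq acont_const)
  also have "(\<Union>k. (\<lambda>k. {x. P x \<and> n x = k}) k) = {x. P x}" by auto
  finally show ?thesis by simp
qed

text \<open>On each set where the cocycle is constant an orbit isomorphism is a power of
  \<open>T\<close>, and the images of these sets are the level sets of the inverse cocycle.\<close>
lemma orbit_iso_mass:
  assumes iso: "orbit_iso c c' C D" and C: "acont C" and D: "acont D" and P: "acont P"
  shows "mass (\<lambda>x. C x \<and> P (\<tau> (c x) x)) = mass (\<lambda>x. D x \<and> P x)"
proof -
  note c = orbit_isoD[OF iso]
  have n: "acont (\<lambda>x. int_encode (c x))" "acont (\<lambda>x. int_encode (- c' x))"
    by (rule acont_comp[OF c(1)], rule acont_comp[OF c(2)])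
  have Pc: "acont (\<lambda>x. P (\<tau> (c x) x))" by (rule acont_subst[OF c(1) P])
  have "mass (\<lambda>x. C x \<and> P (\<tau> (c x) x)) = (\<Sum>k. mass (\<lambda>x. (C x \<and> P (\<tau> (c x) x)) \<and> int_encode (c x) = k))"
    by (intro mass_split n acont_conj C Pc)
  also have "\<dots> = (\<Sum>k. mass (\<lambda>x. (D x \<and> P x) \<and> int_encode (- c' x) = k))"
  proof (rule suminf_cong)
    fix k
    define j where "j = int_decode k"
    have k: "int_encode i = k \<longleftrightarrow> i = j" for i unfolding j_def by (metis int_decode_inverse int_encode_inverse)
    have acQ: "acont (\<lambda>x. (D x \<and> P x) \<and> - c' x = j)"
      by (intro acont_conj D P acont_eq acont_const acont_uminus c)
    have "mass (\<lambda>x. (C x \<and> P (\<tau> (c x) x)) \<and> c x = j) = mass (\<lambda>x. (D (\<tau> j x) \<and> P (\<tau> j x)) \<and> - c' (\<tau> j x) = j)"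
    proof (rule acont_mass_cong)
      show "generically (\<lambda>x. ((C x \<and> P (\<tau> (c x) x)) \<and> c x = j) = ((D (\<tau> j x) \<and> P (\<tau> j x)) \<and> - c' (\<tau> j x) = j))"
        using gen_conj[OF c(3) gen_shift[OF c(4)]]
      proof (rule gen_mono, elim conjE)
        fix x assume h: "C x \<longrightarrow> D (\<tau> (c x) x) \<and> c' (\<tau> (c x) x) = - c x"
          "\<forall>k. D (\<tau> k x) \<longrightarrow> C (\<tau> (c' (\<tau> k x)) (\<tau> k x)) \<and> c (\<tau> (c' (\<tau> k x)) (\<tau> k x)) = - c' (\<tau> k x)"
        have "\<tau> (- j) (\<tau> j x) = x" by simp
        then show "((C x \<and> P (\<tau> (c x) x)) \<and> c x = j) = ((D (\<tau> j x) \<and> P (\<tau> j x)) \<and> - c' (\<tau> j x) = j)"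
          using h(1) h(2)[rule_format, of j] by (metis minus_equation_iff)
      qed
      show "acont (\<lambda>x. (C x \<and> P (\<tau> (c x) x)) \<and> c x = j)" by (intro acont_conj C Pc acont_eq c acont_const)
    qed
    also have "\<dots> = mass (\<lambda>x. (D x \<and> P x) \<and> - c' x = j)" using mass_shift[OF acont_sets[OF acQ], of j] .
    finally show "mass (\<lambda>x. (C x \<and> P (\<tau> (c x) x)) \<and> int_encode (c x) = k) =
       mass (\<lambda>x. (D x \<and> P x) \<and> int_encode (- c' x) = k)" unfolding k .
  qed
  also have "\<dots> = mass (\<lambda>x. D x \<and> P x)"
    by (rule mass_split[symmetric]) (intro n acont_conj D P)+
  finally show ?thesis .
qed

lemma mass_Diff:
  assumes "acont P" "acont Q" "mass P < \<infinity>"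
  shows "mass (\<lambda>x. P x \<and> \<not> Q x) = mass P - mass (\<lambda>x. P x \<and> Q x)"
proof -
  have "mass (\<lambda>x. P x \<and> \<not> Q x) = emeasure M ({x. P x} - {x. P x \<and> Q x})"
    by (rule arg_cong[where f = "emeasure M"]) auto
  also have "\<dots> = mass P - mass (\<lambda>x. P x \<and> Q x)"
  proof (rule emeasure_Diff)
    have "mass (\<lambda>x. P x \<and> Q x) \<le> mass P" by (rule AE_imp_mass_le) (auto simp: assms)
    then show "mass (\<lambda>x. P x \<and> Q x) \<noteq> \<infinity>" using assms(3) by (auto simp: top_unique)
  qed (auto intro!: acont_sets acont_conj assms)
  finally show ?thesis .
qed

text \<open>A matching that uses up \<open>R 0\<close> and \<open>S 0\<close>: step \<open>n\<close>
  matches \<open>x\<close> with \<open>\<tau> (k n) x\<close> when both are still unmatched. The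
  leftovers have equal measure at every step, hence so do the sets of points that are never matched.
  No power of \<open>T\<close> carries one of these sets into the other, which by ergodicity forces
  them to be null. The least \<open>n\<close> is the step at which \<open>x\<close> is
  matched.\<close>
lemma matching:
  assumes acont: "\<And>n::nat. acont (R n)" "\<And>n. acont (S n)" and eq: "\<And>n. mass (R n) = mass (S n)"
    and fin: "\<And>n. mass (R n) < \<infinity>"
    and RS: "\<And>n. R (Suc n) = (\<lambda>x. R n x \<and> \<not> S n (\<tau> (k n) x))"
    and SS: "\<And>n. S (Suc n) = (\<lambda>y. S n y \<and> \<not> R n (\<tau> (- k n) y))"
    and enum: "\<And>j. \<exists>n. k n = j"
  shows "acont (\<lambda>x. LEAST n. \<not> R 0 x \<or> R n x \<and> S n (\<tau> (k n) x))"
    and "generically (\<lambda>x. \<exists>n. \<not> R 0 x \<or> R n x \<and> S n (\<tau> (k n) x))"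
    and "R n x \<Longrightarrow> S n (\<tau> (k n) x) \<Longrightarrow> (LEAST n. \<not> R 0 x \<or> R n x \<and> S n (\<tau> (k n) x)) = n"
proof -
  have Rdec: "R n x" if "R m x" "n \<le> m" for m n x
    using that by (induction m) (auto simp: RS le_Suc_eq)
  have Sdec: "S n x" if "S m x" "n \<le> m" for m n x
    using that by (induction m) (auto simp: SS le_Suc_eq)
  have sets: "{x. \<forall>n. R n x} \<in> sets M" "{x. \<forall>n. S n x} \<in> sets M"
    and lim: "(INF n. mass (R n)) = mass (\<lambda>x. \<forall>n. R n x)" "(INF n. mass (S n)) = mass (\<lambda>x. \<forall>n. S n x)"
  proof -
    have e: "{x. \<forall>n. R n x} = (\<Inter>n. {x. R n x})" "{x. \<forall>n. S n x} = (\<Inter>n. {x. S n x})" by auto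
    have d: "decseq (\<lambda>n. {x. R n x})" "decseq (\<lambda>n. {x. S n x})"
      unfolding decseq_def using Rdec Sdec by blast+
    show "{x. \<forall>n. R n x} \<in> sets M" "{x. \<forall>n. S n x} \<in> sets M"
      unfolding e using acont_sets[OF acont(1)] acont_sets[OF acont(2)] by auto
    show "(INF n. mass (R n)) = mass (\<lambda>x. \<forall>n. R n x)" unfolding e
      by (rule INF_emeasure_decseq) (use acont_sets[OF acont(1)] fin d in \<open>auto simp: less_top\<close>)
    show "(INF n. mass (S n)) = mass (\<lambda>x. \<forall>n. S n x)" unfolding e
      by (rule INF_emeasure_decseq) (use acont_sets[OF acont(2)] fin[unfolded eq] d in \<open>auto simp: less_top\<close>)
  qed
  have R_null: "mass (\<lambda>x. \<forall>n. R n x) = 0"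
  proof (rule ccontr)
    assume "mass (\<lambda>x. \<forall>n. R n x) \<noteq> 0"
    then have pos: "mass (\<lambda>x. \<forall>n. R n x) > 0" by (simp add: zero_less_iff_neq_zero)
    have "AE x in M. \<not> (\<forall>n. S n x)"
      using AE_visits_M[OF sets(1) pos]
    proof eventually_elim
      case (elim x)
      then obtain i where i: "\<forall>n. R n (\<tau> i x)" by blast
      show ?case
      proof
        assume s: "\<forall>n. S n x"
        obtain n where "k n = - i" using enum by blast
        then have "\<tau> (k n) (\<tau> i x) = x" by simp
        then have "\<not> R (Suc n) (\<tau> i x)" using s i unfolding RS by metis
        then show False using i by blast
      qed
    qed
    then have "mass (\<lambda>x. \<forall>n. S n x) = 0" using AE_iff_measurable[OF sets(2)] by auto
    then show False using pos lim eq by simp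
  qed
  let ?P = "\<lambda>n x. \<not> R 0 x \<or> R n x \<and> S n (\<tau> (k n) x)"
  have acP: "acont (?P n)" for n
    by (intro acont_disj acont_not acont acont_conj acont_shift[OF acont(2)])
  show ex: "generically (\<lambda>x. \<exists>n. ?P n x)"
  proof (rule acont_ex_gen[OF acP])
    have "AE x in M. \<not> (\<forall>n. R n x)" using R_null AE_iff_measurable[OF sets(1)] by auto
    then show "AE x in M. \<exists>n. ?P n x"
    proof eventually_elim
      case (elim x)
      show ?case
      proof (rule ccontr)
        assume no: "\<not> ?case"
        have "R n x" for n by (induction n) (use no in \<open>auto simp: RS\<close>)
        then show False using elim by blast
      qed
    qed
  qed
  show "acont (\<lambda>x. LEAST n. ?P n x)" by (rule acont_Least[OF acP ex])
  show "(LEAST n. ?P n x) = n" if n: "R n x" "S n (\<tau> (k n) x)"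
  proof (rule Least_equality)
    show "?P n x" using n by blast
    fix m assume "?P m x"
    then have m: "R m x" "S m (\<tau> (k m) x)" using Rdec[OF n(1), of 0] by auto
    show "n \<le> m"
    proof (rule ccontr)
      assume "\<not> n \<le> m"
      then have "R (Suc m) x" using Rdec[OF n(1), of "Suc m"] by simp
      then show False using m by (simp add: RS)
    qed
  qed
qed

text \<open>What is left over of \<open>A\<close> and of \<open>B\<close> after the first
  \<open>n\<close> integers, in the order of \<open>int_decode\<close>, have been used as
  exponents.\<close>
fun greedy :: "('a \<Rightarrow> bool) \<Rightarrow> ('a \<Rightarrow> bool) \<Rightarrow> nat \<Rightarrow> ('a \<Rightarrow> bool) \<times> ('a \<Rightarrow> bool)" where
  "greedy A B 0 = (A, B)"
| "greedy A B (Suc n) = (let (A', B') = greedy A B n; k = int_decode n in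
     (\<lambda>x. A' x \<and> \<not> B' (\<tau> k x), \<lambda>y. B' y \<and> \<not> A' (\<tau> (- k) y)))"

text \<open>By symmetry the matching result applies to both sides, with the exponents
  negated.\<close>
theorem ex_orbit_iso:
  assumes A: "acont A" and B: "acont B" and eq: "mass A = mass B" and fin: "mass A < \<infinity>"
  shows "\<exists>c c'. orbit_iso c c' A B"
proof -
  define R where "R n = fst (greedy A B n)" for n
  define S where "S n = snd (greedy A B n)" for n
  have R0: "R 0 = A" and S0: "S 0 = B" by (simp_all add: R_def S_def)
  have RS: "R (Suc n) = (\<lambda>x. R n x \<and> \<not> S n (\<tau> (int_decode n) x))"
    and SS: "S (Suc n) = (\<lambda>y. S n y \<and> \<not> R n (\<tau> (- int_decode n) y))" for n
    by (simp_all add: R_def S_def Let_def split_beta)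
  have acont: "acont (R n)" "acont (S n)" for n
  proof (induction n)
    case (Suc n)
    { case 1 show ?case unfolding RS by (intro acont_conj acont_not acont_shift[of "S n"] Suc) }
    { case 2 show ?case unfolding SS by (intro acont_conj acont_not acont_shift[of "R n"] Suc) }
  qed (simp_all add: R0 S0 A B)
  have RA: "R n x \<Longrightarrow> A x" and SB: "S n x \<Longrightarrow> B x" for n x
    by (induction n) (auto simp: R0 S0 RS SS)
  have RSeq: "mass (R n) = mass (S n)" and Rfin: "mass (R n) < \<infinity>" and Sfin: "mass (S n) < \<infinity>" for n
  proof -
    have R: "mass (R n) < \<infinity>" for n
      by (rule le_less_trans[OF AE_imp_mass_le[OF AE_I2 A] fin]) (use RA in blast)
    have S: "mass (S n) < \<infinity>" for n
      by (rule le_less_trans[OF AE_imp_mass_le[OF AE_I2 B] fin[unfolded eq]]) (use SB in blast)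
    show "mass (R n) < \<infinity>" "mass (S n) < \<infinity>" by (fact R S)+
    show "mass (R n) = mass (S n)"
    proof (induction n)
      case (Suc n)
      have "mass (\<lambda>x. R n x \<and> S n (\<tau> (int_decode n) x)) = mass (\<lambda>x. S n x \<and> R n (\<tau> (- int_decode n) x))"
        using mass_shift[where k = "int_decode n" and P = "\<lambda>x. S n x \<and> R n (\<tau> (- int_decode n) x)"]
          acont_sets[OF acont_conj[OF acont(2) acont_shift[OF acont(1)]], of n n "- int_decode n"]
        by (simp add: conj_commute)
      moreover have "mass (R (Suc n)) = mass (R n) - mass (\<lambda>x. R n x \<and> S n (\<tau> (int_decode n) x))"
        unfolding RS by (rule mass_Diff[OF acont(1) acont_shift[OF acont(2)] R])
      moreover have "mass (S (Suc n)) = mass (S n) - mass (\<lambda>x. S n x \<and> R n (\<tau> (- int_decode n) x))"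
        unfolding SS by (rule mass_Diff[OF acont(2) acont_shift[OF acont(1)] S])
      ultimately show ?case using Suc by simp
    qed (simp add: R0 S0 eq)
  qed
  have enum: "\<exists>n. int_decode n = k" for k by (metis int_encode_inverse)
  have enum': "\<exists>n. - int_decode n = k" for k by (metis int_encode_inverse minus_minus)
  have SS': "S (Suc n) = (\<lambda>y. S n y \<and> \<not> R n (\<tau> (- int_decode n) y))"
    and RS': "R (Suc n) = (\<lambda>x. R n x \<and> \<not> S n (\<tau> (- (- int_decode n)) x))" for n
    by (simp_all add: RS SS)
  define P where "P n x \<longleftrightarrow> \<not> A x \<or> R n x \<and> S n (\<tau> (int_decode n) x)" for n x
  define Q where "Q n y \<longleftrightarrow> \<not> B y \<or> S n y \<and> R n (\<tau> (- int_decode n) y)" for n y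
  have P: "acont (\<lambda>x. LEAST n. P n x)" "generically (\<lambda>x. \<exists>n. P n x)"
    "\<And>n x. R n x \<Longrightarrow> S n (\<tau> (int_decode n) x) \<Longrightarrow> (LEAST n. P n x) = n"
    using matching[of R S int_decode, OF acont RSeq Rfin RS SS enum] unfolding P_def R0 by auto
  have Q: "acont (\<lambda>x. LEAST n. Q n x)" "generically (\<lambda>x. \<exists>n. Q n x)"
    "\<And>n x. S n x \<Longrightarrow> R n (\<tau> (- int_decode n) x) \<Longrightarrow> (LEAST n. Q n x) = n"
    using matching[of S R "\<lambda>n. - int_decode n", OF acont(2,1) RSeq[symmetric] Sfin SS' RS' enum']
    unfolding Q_def S0 by auto
  define c where "c x = int_decode (LEAST n. P n x)" for x
  define c' where "c' x = - int_decode (LEAST n. Q n x)" for x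
  have "orbit_iso c c' A B" unfolding orbit_iso_def
  proof (intro conjI)
    show "acont c" unfolding c_def by (rule acont_comp[OF P(1)])
    show "acont c'" unfolding c'_def by (rule acont_comp[OF Q(1)])
    show "generically (\<lambda>x. A x \<longrightarrow> B (\<tau> (c x) x) \<and> c' (\<tau> (c x) x) = - c x)" using P(2)
    proof (rule gen_mono, intro impI)
      fix x assume "\<exists>n. P n x" "A x"
      then obtain n where n: "R n x" "S n (\<tau> (int_decode n) x)" unfolding P_def by blast
      then have c: "c x = int_decode n" unfolding c_def by (simp add: P(3))
      have "c' (\<tau> (int_decode n) x) = - int_decode n" using n unfolding c'_def by (simp add: Q(3))
      then show "B (\<tau> (c x) x) \<and> c' (\<tau> (c x) x) = - c x" using n SB unfolding c by auto
    qed
    show "generically (\<lambda>x. B x \<longrightarrow> A (\<tau> (c' x) x) \<and> c (\<tau> (c' x) x) = - c' x)" using Q(2)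
    proof (rule gen_mono, intro impI)
      fix x assume "\<exists>n. Q n x" "B x"
      then obtain n where n: "S n x" "R n (\<tau> (- int_decode n) x)" unfolding Q_def by blast
      then have c: "c' x = - int_decode n" unfolding c'_def by (simp add: Q(3))
      have "c (\<tau> (- int_decode n) x) = int_decode n" using n unfolding c_def by (simp add: P(3))
      then show "A (\<tau> (c' x) x) \<and> c (\<tau> (c' x) x) = - c' x" using n RA unfolding c by auto
    qed
  qed
  then show ?thesis by blast
qed

section \<open>Skyscrapers\<close>

text \<open>The time since the last visit to \<open>B\<close>, that is the height in the skyscraper
  over \<open>B\<close>. The point of that visit is \<open>base_pt\<close>.\<close>
definition age :: "('a \<Rightarrow> bool) \<Rightarrow> 'a \<Rightarrow> nat" where
  "age B x = (LEAST l. B (\<tau> (- int l) x))"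

definition base_pt :: "('a \<Rightarrow> bool) \<Rightarrow> 'a \<Rightarrow> 'a" where
  "base_pt B x = \<tau> (- int (age B x)) x"

lemma acont_age:
  assumes "acont B" "mass B > 0" shows "acont (age B)"
  unfolding age_def[abs_def] by (intro acont_Least gen_recurrent assms acont_shift)

lemma acont_base_pt:
  assumes "acont B" "mass B > 0" "acont f" shows "acont (\<lambda>x. f (base_pt B x))"
  unfolding base_pt_def
  by (rule acont_subst[OF acont_comp[OF acont_age[OF assms(1,2)], of "\<lambda>n. - int n"] assms(3)])

lemma age_eqI:
  assumes "B (\<tau> (- int l) x)" "\<And>k. k < l \<Longrightarrow> \<not> B (\<tau> (- int k) x)" shows "age B x = l"
  unfolding age_def using assms by (intro Least_equality) (auto intro: leI)

text \<open>Moving up the skyscraper without meeting \<open>B\<close> stays in the same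
  column.\<close>
lemma age_add:
  assumes ex: "\<exists>l::nat. B (\<tau> (- int l) y)" and no: "\<And>j. 0 < j \<Longrightarrow> j \<le> int k \<Longrightarrow> \<not> B (\<tau> j y)"
  shows "age B (\<tau> (int k) y) = age B y + k" "base_pt B (\<tau> (int k) y) = base_pt B y"
proof -
  have l: "B (\<tau> (- int (age B y)) y)" unfolding age_def using ex by (rule LeastI_ex)
  show 1: "age B (\<tau> (int k) y) = age B y + k"
  proof (rule age_eqI)
    fix m assume m: "m < age B y + k"
    show "\<not> B (\<tau> (- int m) (\<tau> (int k) y))"
    proof (cases "m < k")
      case True
      then show ?thesis using no[of "int k - int m"] by (simp add: algebra_simps)
    next
      case False
      then have "m - k < age B y" using m by simp
      then have "\<not> B (\<tau> (- int (m - k)) y)" unfolding age_def by (rule not_less_Least)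
      then show ?thesis using False by (simp add: of_nat_diff algebra_simps)
    qed
  qed (use l in \<open>simp add: algebra_simps\<close>)
  show "base_pt B (\<tau> (int k) y) = base_pt B y" unfolding base_pt_def 1 by (simp add: algebra_simps)
qed

lemma mass_le_add:
  assumes "AE x in M. P x \<longrightarrow> Q x \<or> R x" "acont Q" "acont R" shows "mass P \<le> mass Q + mass R"
proof -
  have "mass P \<le> mass (\<lambda>x. Q x \<or> R x)" by (intro AE_imp_mass_le acont_disj assms)
  also have "{x. Q x \<or> R x} = {x. Q x} \<union> {x. R x}" by auto
  also have "emeasure M \<dots> \<le> mass Q + mass R" by (intro emeasure_subadditive acont_sets assms)
  finally show ?thesis .
qed

lemma mass_bex_le:
  assumes "finite I" "\<And>i. i \<in> I \<Longrightarrow> acont (Q i)" "\<And>i. i \<in> I \<Longrightarrow> mass (Q i) \<le> e"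
  shows "mass (\<lambda>x. \<exists>i\<in>I. Q i x) \<le> of_nat (card I) * e"
proof -
  have "{x. \<exists>i\<in>I. Q i x} = (\<Union>i\<in>I. {x. Q i x})" by auto
  also have "emeasure M \<dots> \<le> (\<Sum>i\<in>I. mass (Q i))"
    using assms by (intro emeasure_subadditive_finite) (auto intro: acont_sets)
  also have "\<dots> \<le> (\<Sum>i\<in>I. e)" by (intro sum_mono assms)
  finally show ?thesis by simp
qed

lemma mass_finite_sum:
  assumes "finite I" "\<And>i. i \<in> I \<Longrightarrow> acont (\<lambda>x. P x \<and> n x = i)"
  shows "mass (\<lambda>x. P x \<and> n x \<in> I) = (\<Sum>i\<in>I. mass (\<lambda>x. P x \<and> n x = i))"
proof -
  have "{x. P x \<and> n x \<in> I} = (\<Union>i\<in>I. {x. P x \<and> n x = i})" by auto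
  also have "emeasure M \<dots> = (\<Sum>i\<in>I. mass (\<lambda>x. P x \<and> n x = i))"
    using assms by (intro sum_emeasure[symmetric]) (auto simp: disjoint_family_on_def intro!: acont_sets)
  finally show ?thesis .
qed

lemma ex_small_of_decreasing:
  assumes P: "\<And>h::nat. acont (P h)" and dec: "\<And>h x. P (Suc h) x \<Longrightarrow> P h x" and fin: "mass (P 0) < \<infinity>"
    and empty: "\<And>x. \<exists>h. \<not> P h x" and "\<eta> > (0::real)"
  shows "\<exists>h. mass (P h) \<le> ennreal \<eta>"
proof -
  have mono: "P h x \<Longrightarrow> P 0 x" for h x by (induction h) (auto dest: dec)
  have "(\<lambda>h. mass (P h)) \<longlonglongrightarrow> emeasure M (\<Inter>h. {x. P h x})"
  proof (rule Lim_emeasure_decseq)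
    show "range (\<lambda>h. {x. P h x}) \<subseteq> sets M" using acont_sets[OF P] by auto
    show "decseq (\<lambda>h. {x. P h x})" by (rule decseq_SucI) (use dec in blast)
    fix h
    have "mass (P h) \<le> mass (P 0)" by (intro AE_imp_mass_le P) (use mono in auto)
    then show "mass (P h) \<noteq> \<infinity>" using fin by (auto simp: top_unique)
  qed
  moreover have "(\<Inter>h. {x. P h x}) = {}" using empty by blast
  ultimately have "(\<lambda>h. mass (P h)) \<longlonglongrightarrow> 0" by simp
  from order_tendstoD(2)[OF this, of "ennreal \<eta>"] \<open>\<eta> > 0\<close>
  have "eventually (\<lambda>h. mass (P h) < ennreal \<eta>) sequentially" by simp
  then show ?thesis by (auto dest!: eventually_happens intro: less_imp_le)
qed

text \<open>A point of \<open>A\<close> is labelled by the value of \<open>e\<close> at the foot of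
  its column and by its height. For the labels in \<open>Lab\<close> the points of \<open>A\<close>
  with that label form a full translate of a part of \<open>B\<close>, all these parts have the same
  dyadic measure relative to \<open>A\<close>, and the label determines \<open>f\<close>. The
  remaining points are few.\<close>
definition tower_labels ::
  "('a \<Rightarrow> bool) \<Rightarrow> real \<Rightarrow> ('a \<Rightarrow> bool) \<Rightarrow> ('a \<Rightarrow> 'c) \<Rightarrow> real \<Rightarrow> nat \<Rightarrow> ('a \<Rightarrow> nat) \<Rightarrow> (nat \<times> nat) set \<Rightarrow>
    (nat \<Rightarrow> nat \<Rightarrow> 'c) \<Rightarrow> bool" where
  "tower_labels A a B f \<eta> D e Lab g \<longleftrightarrow> 1 \<le> D \<and> acont e \<and> finite Lab \<and>
    (\<forall>w l. (w, l) \<in> Lab \<longrightarrow> mass (\<lambda>x. B x \<and> e x = w) = ennreal (a / 2 ^ D) \<and>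
       generically (\<lambda>x. (A x \<and> e (base_pt B x) = w \<and> age B x = l) = (B (\<tau> (- int l) x) \<and> e (\<tau> (- int l) x) = w)) \<and>
       generically (\<lambda>x. A x \<and> e (base_pt B x) = w \<and> age B x = l \<longrightarrow> f x = g w l)) \<and>
    mass (\<lambda>x. A x \<and> (e (base_pt B x), age B x) \<notin> Lab) \<le> ennreal \<eta>"

text \<open>Cut the skyscraper at a height \<open>H\<close> above which there is little of
  \<open>A\<close>. The name \<open>\<sigma>\<close> of a foot point lists, for each of the
  \<open>H\<close> levels, whether the column still exists there and lies in \<open>A\<close>, and
  the value of \<open>f\<close>. There are finitely many names, so if \<open>D\<close> is large,
  cutting the set of foot points of each name into pieces of measure \<open>a / 2 ^ D\<close> wastes
  little.\<close>
lemma ex_tower_labels: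
  fixes f :: "'a \<Rightarrow> 'c::countable"
  assumes A: "acont A" and mA: "mass A = ennreal a" "a > 0" and B: "acont B" "\<And>x. B x \<Longrightarrow> A x" "mass B > 0"
    and f: "acont f" "finite (range f)" and \<eta>: "\<eta> > (0::real)"
  shows "\<exists>D e Lab g. tower_labels A a B f \<eta> D e Lab g"
proof -
  let ?b = "base_pt B" and ?d = "age B"
  have rec: "generically (\<lambda>x. \<exists>l::nat. B (\<tau> (- int l) x))" by (rule gen_recurrent[OF B(1,3)])
  have d: "acont ?d" by (rule acont_age[OF B(1,3)])
  \<comment> \<open>Ages are finite, so little of \<open>A\<close> lies above a large height.\<close>
  have acH: "acont (\<lambda>x. A x \<and> h \<le> ?d x)" for h by (intro acont_conj A acont_le d acont_const)
  obtain H where H: "mass (\<lambda>x. A x \<and> H \<le> ?d x) \<le> ennreal (\<eta> / 2)"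
  proof -
    have "\<exists>h. mass (\<lambda>x. A x \<and> h \<le> ?d x) \<le> ennreal (\<eta> / 2)"
    proof (rule ex_small_of_decreasing[OF acH])
      show "\<exists>h. \<not> (A x \<and> h \<le> ?d x)" for x by (rule exI[of _ "Suc (?d x)"]) simp
    qed (use mA \<eta> in auto)
    then show thesis using that by blast
  qed
  define \<sigma> where "\<sigma> y = map (\<lambda>l. (?d (\<tau> (int l) y) = l \<and> A (\<tau> (int l) y), f (\<tau> (int l) y))) [0..<H]" for y
  have acont\<sigma>: "acont \<sigma>" unfolding \<sigma>_def[abs_def]
    by (intro acont_map acont_Pair acont_conj acont_eq acont_const acont_shift[OF d] acont_shift[OF A] acont_shift[OF f(1)])
  define W where "W = range \<sigma>"
  have "W \<subseteq> {xs. set xs \<subseteq> UNIV \<times> range f \<and> length xs = H}" unfolding W_def \<sigma>_def by auto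
  then have finW: "finite W"
    by (rule finite_subset[OF _ finite_lists_length_eq]) (simp add: f(2))
  \<comment> \<open>Each name loses at most \<open>s\<close> on each of at most \<open>H\<close> levels, hence the choice of \<open>D0\<close>; \<open>Suc\<close> keeps \<open>D\<close> positive.\<close>
  obtain D0 :: nat where D0: "real (card W * H) * a / (\<eta> / 2) < 2 ^ D0"
    using real_arch_pow[of 2] by auto
  define D where "D = Suc D0"
  define s where "s = a / 2 ^ D"
  have s: "s > 0" using mA by (simp add: s_def)
  have sD: "real (card W * H) * s \<le> \<eta> / 2"
  proof -
    have "real (card W * H) * a < (\<eta> / 2) * 2 ^ D0" using D0 \<eta> by (simp add: field_simps)
    also have "\<dots> \<le> (\<eta> / 2) * 2 ^ D" using \<eta> by (simp add: D_def)
    finally show ?thesis by (simp add: s_def field_simps)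
  qed
  have acBw: "acont (\<lambda>x. B x \<and> \<sigma> x = w)" for w by (intro acont_conj B acont_eq acont\<sigma> acont_const)
  have "\<exists>v :: 'a \<Rightarrow> nat. acont v \<and> (\<forall>r. ennreal (real (r + 1) * s) \<le> mass (\<lambda>x. B x \<and> \<sigma> x = w) \<longrightarrow>
      mass (\<lambda>x. (B x \<and> \<sigma> x = w) \<and> v x = r) = ennreal s)" for w
    using ex_equal_pieces[OF acBw s, of w] by blast
  from choice[OF allI, OF this]
  obtain v :: "(bool \<times> 'c) list \<Rightarrow> 'a \<Rightarrow> nat" where
    "\<forall>w. acont (v w) \<and> (\<forall>r. ennreal (real (r + 1) * s) \<le> mass (\<lambda>x. B x \<and> \<sigma> x = w) \<longrightarrow>
      mass (\<lambda>x. (B x \<and> \<sigma> x = w) \<and> v w x = r) = ennreal s)" by (rule exE)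
  then have v: "\<And>w. acont (v w)"
    "\<And>w r. ennreal (real (r + 1) * s) \<le> mass (\<lambda>x. B x \<and> \<sigma> x = w) \<Longrightarrow>
       mass (\<lambda>x. (B x \<and> \<sigma> x = w) \<and> v w x = r) = ennreal s"
    by simp_all
  define \<beta> where "\<beta> w = measure M {x. B x \<and> \<sigma> x = w}" for w
  have \<beta>: "mass (\<lambda>x. B x \<and> \<sigma> x = w) = ennreal (\<beta> w)" for w
  proof -
    have "mass (\<lambda>x. B x \<and> \<sigma> x = w) \<le> mass A" by (intro AE_imp_mass_le A) (use B(2) in auto)
    then have "mass (\<lambda>x. B x \<and> \<sigma> x = w) \<noteq> \<infinity>" using mA by (auto simp: top_unique)
    then show ?thesis unfolding \<beta>_def by (simp add: emeasure_eq_ennreal_measure)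
  qed
  have \<beta>0: "\<beta> w \<ge> 0" for w by (simp add: \<beta>_def)
  define n where "n w = nat \<lfloor>\<beta> w / s\<rfloor>" for w
  have n: "real (n w) * s \<le> \<beta> w" "\<beta> w < (real (n w) + 1) * s" for w
  proof -
    have "real (n w) = of_int \<lfloor>\<beta> w / s\<rfloor>" unfolding n_def using \<beta>0[of w] s by simp
    then have "real (n w) \<le> \<beta> w / s" "\<beta> w / s < real (n w) + 1" by linarith+
    then show "real (n w) * s \<le> \<beta> w" "\<beta> w < (real (n w) + 1) * s" using s by (simp_all add: field_simps)
  qed
  have piece: "mass (\<lambda>x. (B x \<and> \<sigma> x = w) \<and> v w x = r) = ennreal s" if "r < n w" for w r
  proof (rule v(2))
    have "real (r + 1) * s \<le> real (n w) * s" using that s by (intro mult_right_mono) auto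
    also have "\<dots> \<le> \<beta> w" by (rule n)
    finally show "ennreal (real (r + 1) * s) \<le> mass (\<lambda>x. B x \<and> \<sigma> x = w)" unfolding \<beta> by (rule ennreal_leI)
  qed
  have acv: "acont (\<lambda>x. (B x \<and> \<sigma> x = w) \<and> v w x = r)" for w r by (intro acont_conj[OF acBw] acont_eq v acont_const)
  have left: "mass (\<lambda>x. (B x \<and> \<sigma> x = w) \<and> \<not> v w x < n w) \<le> ennreal s" for w
  proof -
    have "mass (\<lambda>x. (B x \<and> \<sigma> x = w) \<and> v w x < n w) = mass (\<lambda>x. (B x \<and> \<sigma> x = w) \<and> v w x \<in> {..<n w})" by simp
    also have "\<dots> = (\<Sum>r<n w. mass (\<lambda>x. (B x \<and> \<sigma> x = w) \<and> v w x = r))"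
      by (intro mass_finite_sum acv) auto
    also have "\<dots> = (\<Sum>r<n w. ennreal s)" by (intro sum.cong refl piece) auto
    also have "\<dots> = ennreal (real (n w) * s)" using s by (simp add: ennreal_mult ennreal_of_nat_eq_real_of_nat)
    finally have 1: "mass (\<lambda>x. (B x \<and> \<sigma> x = w) \<and> v w x < n w) = ennreal (real (n w) * s)" .
    have "mass (\<lambda>x. (B x \<and> \<sigma> x = w) \<and> \<not> v w x < n w) = mass (\<lambda>x. B x \<and> \<sigma> x = w) - mass (\<lambda>x. (B x \<and> \<sigma> x = w) \<and> v w x < n w)"
      by (rule mass_Diff[OF acBw]) (auto simp: \<beta> intro!: acont_less v acont_const)
    also have "\<dots> = ennreal (\<beta> w - real (n w) * s)" unfolding 1 \<beta> using s by (simp add: ennreal_minus)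
    also have "\<dots> \<le> ennreal s" using n(2)[of w] by (intro ennreal_leI) (simp add: algebra_simps)
    finally show ?thesis .
  qed
  define e where "e y = to_nat (\<sigma> y, v (\<sigma> y) y)" for y
  have "acont e" unfolding e_def[abs_def]
    by (rule acont_comp, rule acont_Pair[OF acont\<sigma>], rule acont_fam[OF acont\<sigma>]) (rule v)
  have e_iff: "e y = to_nat (w, r) \<longleftrightarrow> \<sigma> y = w \<and> v w y = r" for y w r
    unfolding e_def by auto
  define Lab where "Lab = (\<lambda>(w, l, r). (to_nat (w, r), l)) ` (SIGMA w:W. {l. l < H \<and> fst (w ! l)} \<times> {..<n w})"
  have LabI: "(to_nat (w, r), l) \<in> Lab" if "w \<in> W" "l < H" "fst (w ! l)" "r < n w" for w l r
    unfolding Lab_def by (rule image_eqI[of _ _ "(w, l, r)"]) (use that in auto)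
  define g where "g u l = snd (fst (from_nat u :: (bool \<times> 'c) list \<times> nat) ! l)" for u l
  have nth\<sigma>: "\<sigma> y ! l = (?d (\<tau> (int l) y) = l \<and> A (\<tau> (int l) y), f (\<tau> (int l) y))" if "l < H" for y l
    using that by (simp add: \<sigma>_def)
  have bd: "\<tau> (int (?d x)) (?b x) = x" for x by (simp add: base_pt_def)
  have "mass (\<lambda>x. B x \<and> e x = u) = ennreal (a / 2 ^ D) \<and>
       generically (\<lambda>x. (A x \<and> e (?b x) = u \<and> ?d x = l) = (B (\<tau> (- int l) x) \<and> e (\<tau> (- int l) x) = u)) \<and>
       generically (\<lambda>x. A x \<and> e (?b x) = u \<and> ?d x = l \<longrightarrow> f x = g u l)" if ul: "(u, l) \<in> Lab" for u l
  proof (intro conjI)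
    obtain w r where w: "u = to_nat (w, r)" "w \<in> W" "l < H" "fst (w ! l)" "r < n w"
      using ul unfolding Lab_def by auto
    show "mass (\<lambda>x. B x \<and> e x = u) = ennreal (a / 2 ^ D)"
      using piece[OF w(5)] unfolding w(1) e_iff s_def by (simp add: conj_assoc)
    show "generically (\<lambda>x. (A x \<and> e (?b x) = u \<and> ?d x = l) = (B (\<tau> (- int l) x) \<and> e (\<tau> (- int l) x) = u))"
      using rec
    proof (rule gen_mono)
      fix x assume "\<exists>l::nat. B (\<tau> (- int l) x)"
      then have Bb: "B (?b x)" unfolding base_pt_def age_def by (rule LeastI_ex)
      show "(A x \<and> e (?b x) = u \<and> ?d x = l) = (B (\<tau> (- int l) x) \<and> e (\<tau> (- int l) x) = u)"
      proof
        assume "A x \<and> e (?b x) = u \<and> ?d x = l"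
        then show "B (\<tau> (- int l) x) \<and> e (\<tau> (- int l) x) = u" using Bb by (auto simp: base_pt_def)
      next
        assume h: "B (\<tau> (- int l) x) \<and> e (\<tau> (- int l) x) = u"
        define y where "y = \<tau> (- int l) x"
        have "\<sigma> y = w" using h unfolding w(1) e_iff y_def by simp
        then have "?d (\<tau> (int l) y) = l \<and> A (\<tau> (int l) y)" using w(4) nth\<sigma>[OF w(3), of y] by simp
        moreover have "\<tau> (int l) y = x" by (simp add: y_def)
        ultimately have "?d x = l" "A x" by auto
        then show "A x \<and> e (?b x) = u \<and> ?d x = l" using h by (simp add: base_pt_def)
      qed
    qed
    show "generically (\<lambda>x. A x \<and> e (?b x) = u \<and> ?d x = l \<longrightarrow> f x = g u l)"
    proof (rule gen_all, intro impI)
      fix x assume h: "A x \<and> e (?b x) = u \<and> ?d x = l"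
      then have "\<sigma> (?b x) = w" unfolding w(1) e_iff by simp
      then have "w ! l = (True \<and> A x, f x)" using nth\<sigma>[OF w(3), of "?b x"] bd[of x] h by simp
      then show "f x = g u l" unfolding g_def w(1) by simp
    qed
  qed
  moreover have "mass (\<lambda>x. A x \<and> (e (?b x), ?d x) \<notin> Lab) \<le> ennreal \<eta>"
  proof -
    define Q where "Q p x \<longleftrightarrow> (B (\<tau> (- int (snd p)) x) \<and> \<sigma> (\<tau> (- int (snd p)) x) = fst p)
        \<and> \<not> v (fst p) (\<tau> (- int (snd p)) x) < n (fst p)" for p :: "(bool \<times> 'c) list \<times> nat" and x
    have acw: "acont (\<lambda>x. (B x \<and> \<sigma> x = w) \<and> \<not> v w x < n w)" for w
      by (intro acont_conj[OF acBw] acont_not acont_less v acont_const)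
    have acQ: "acont (Q p)" for p unfolding Q_def[abs_def] by (rule acont_shift[OF acw])
    have mQ: "mass (Q p) \<le> ennreal s" for p
      unfolding Q_def using left[of "fst p"] mass_shift[OF acont_sets[OF acw[of "fst p"]], of "- int (snd p)"] by simp
    have "mass (\<lambda>x. A x \<and> (e (?b x), ?d x) \<notin> Lab) \<le> mass (\<lambda>x. A x \<and> H \<le> ?d x) + mass (\<lambda>x. \<exists>p\<in>W \<times> {..<H}. Q p x)"
    proof (rule mass_le_add)
      show "AE x in M. A x \<and> (e (?b x), ?d x) \<notin> Lab \<longrightarrow> (A x \<and> H \<le> ?d x) \<or> (\<exists>p\<in>W \<times> {..<H}. Q p x)"
        using gen_AE[OF rec]
      proof eventually_elim
        case (elim x)
        then have Bb: "B (?b x)" unfolding base_pt_def age_def by (rule LeastI_ex)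
        show ?case
        proof (intro impI, rule ccontr)
          assume h: "A x \<and> (e (?b x), ?d x) \<notin> Lab" and no: "\<not> (A x \<and> H \<le> ?d x \<or> (\<exists>p\<in>W \<times> {..<H}. Q p x))"
          then have l: "?d x < H" by auto
          have w: "\<sigma> (?b x) \<in> W" by (simp add: W_def)
          have "fst (\<sigma> (?b x) ! ?d x)" using nth\<sigma>[OF l, of "?b x"] bd[of x] h by simp
          moreover have "v (\<sigma> (?b x)) (?b x) < n (\<sigma> (?b x))"
          proof (rule ccontr)
            assume "\<not> ?thesis"
            then have "Q (\<sigma> (?b x), ?d x) x" unfolding Q_def using Bb by (simp add: base_pt_def)
            then show False using no w l by blast
          qed
          ultimately have "(e (?b x), ?d x) \<in> Lab" unfolding e_def by (intro LabI w l)
          then show False using h by blast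
        qed
      qed
      show "acont (\<lambda>x. \<exists>p\<in>W \<times> {..<H}. Q p x)" using finW by (intro acont_finite_bex acQ) auto
    qed (rule acH)
    also have "\<dots> \<le> ennreal (\<eta> / 2) + of_nat (card (W \<times> {..<H})) * ennreal s"
      using finW by (intro add_mono H mass_bex_le acQ mQ) auto
    also have "\<dots> = ennreal (\<eta> / 2 + real (card W * H) * s)"
      using s \<eta> by (simp add: card_cartesian_product ennreal_of_nat_eq_real_of_nat ennreal_mult'[symmetric] ennreal_plus[symmetric] del: ennreal_plus)
    also have "\<dots> \<le> ennreal \<eta>" using sD by (intro ennreal_leI) simp
    finally show ?thesis .
  qed
  moreover have "finite Lab" unfolding Lab_def using finW by (intro finite_imageI finite_SigmaI) auto
  moreover have "1 \<le> D" by (simp add: D_def)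
  ultimately have "tower_labels A a B f \<eta> D e Lab g"
    using \<open>acont e\<close> unfolding tower_labels_def by (intro conjI allI impI) simp_all
  then show ?thesis by blast
qed

section \<open>Refining a set along a skyscraper\<close>

text \<open>A division of \<open>A\<close> into \<open>2 ^ D\<close> equal parts, numbered by
  \<open>j\<close> and moved to the part with number 0 by the cocycle \<open>q\<close>. Apart from
  small sets, the number of the part determines \<open>f\<close>, and a point and its image under a
  power of \<open>T\<close> with exponent at most \<open>K\<close> are moved to the same
  point.\<close>
definition refinement ::
  "('a \<Rightarrow> bool) \<Rightarrow> real \<Rightarrow> ('a \<Rightarrow> 'c) \<Rightarrow> nat \<Rightarrow> real \<Rightarrow> nat \<Rightarrow> ('a \<Rightarrow> nat) \<Rightarrow> ('a \<Rightarrow> int) \<Rightarrow> (nat \<Rightarrow> 'c) \<Rightarrow> nat set \<Rightarrow>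
    ('a \<Rightarrow> bool) \<Rightarrow> bool" where
  "refinement A a f K \<epsilon> D j q g J E \<longleftrightarrow> 1 \<le> D \<and> acont j \<and> acont q \<and> (\<forall>x. j x < 2 ^ D) \<and>
     (\<forall>r<2 ^ D. mass (\<lambda>x. A x \<and> j x = r) = ennreal (a / 2 ^ D)) \<and>
     (\<forall>r<2 ^ D. \<exists>q'. orbit_iso q q' (\<lambda>x. A x \<and> j x = r) (\<lambda>x. A x \<and> j x = 0)) \<and>
     generically (\<lambda>x. A x \<and> j x \<in> J \<longrightarrow> f x = g (j x)) \<and> mass (\<lambda>x. A x \<and> j x \<notin> J) \<le> ennreal \<epsilon> \<and>
     acont E \<and> mass E \<le> ennreal \<epsilon> \<and>
     generically (\<lambda>x. A x \<and> \<not> E x \<longrightarrow> (\<forall>k. \<bar>k\<bar> \<le> int K \<longrightarrow> A (\<tau> k x) \<longrightarrow> q x = k + q (\<tau> k x)))"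

lemma gen_of_mass_0: "acont P \<Longrightarrow> mass P = 0 \<Longrightarrow> generically (\<lambda>x. \<not> P x)"
  using AE_iff_measurable[OF acont_sets, of P "\<lambda>x. \<not> P x"] by (intro acont_AE_gen acont_not) auto

text \<open>The labels of a skyscraper over a small \<open>B\<close> give parts of equal measure,
  and what they leave over of \<open>A\<close> has a measure that is a multiple of the measure of a
  part, so that it can be cut into parts as well. To move a labelled part to part 0, descend to the
  foot of the column and apply an orbit isomorphism that depends on the foot point only. Therefore
  all points of a column that share a foot point are moved to the same point.\<close>
lemma ex_refinement:
  fixes f :: "'a \<Rightarrow> 'c::countable"
  assumes A: "acont A" and mA: "mass A = ennreal a" "a > 0" and f: "acont f" "finite (range f)" and \<epsilon>: "\<epsilon> > 0"
  shows "\<exists>D j q g J E. refinement A a f K \<epsilon> D j q g J E"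
proof -
  define \<eta> where "\<eta> = \<epsilon> / (2 * (2 * real K + 1))"
  have \<eta>: "\<eta> > 0" "\<eta> \<le> \<epsilon>" using \<epsilon> by (auto simp: \<eta>_def field_simps)
  have "w * (\<epsilon> / (2 * w)) = \<epsilon> / 2" if "w \<noteq> 0" for w using that by simp
  from this[of "2 * real K + 1"] have "(2 * real K + 1) * \<eta> = \<epsilon> / 2" unfolding \<eta>_def by linarith
  then have \<eta>\<epsilon>: "(2 * real K + 1) * (\<eta> + \<eta>) = \<epsilon>" by (simp add: distrib_left)
  \<comment> \<open>A visit to \<open>B\<close> can separate \<open>x\<close> from \<open>\<tau> k x\<close> only if it happens at one of the \<open>2 * K + 1\<close> times around \<open>x\<close>.\<close>
  define \<delta> where "\<delta> = min a \<eta>"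
  have \<delta>: "\<delta> > 0" "\<delta> \<le> a" "\<delta> \<le> \<eta>" using mA \<eta> by (auto simp: \<delta>_def)
  obtain v0 :: "'a \<Rightarrow> nat" where v0: "acont v0" "mass (\<lambda>x. A x \<and> v0 x = 0) = ennreal \<delta>"
  proof (rule ex_equal_pieces[OF A \<delta>(1)])
    fix v :: "'a \<Rightarrow> nat"
    assume "acont v" "\<And>r. ennreal (real (r + 1) * \<delta>) \<le> mass A \<Longrightarrow> mass (\<lambda>x. A x \<and> v x = r) = ennreal \<delta>"
    moreover from this(2)[of 0] have "mass (\<lambda>x. A x \<and> v x = 0) = ennreal \<delta>" using mA \<delta> by (simp add: ennreal_leI)
    ultimately show thesis using that by blast
  qed
  define B where "B x \<longleftrightarrow> A x \<and> v0 x = 0" for x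
  have B: "acont B" "\<And>x. B x \<Longrightarrow> A x" "mass B > 0" "mass B = ennreal \<delta>"
    using v0 A \<delta> unfolding B_def[abs_def] by (auto intro!: acont_conj acont_eq acont_const)
  obtain D e Lab g where "tower_labels A a B f \<eta> D e Lab g"
    using ex_tower_labels[OF A mA B(1,2,3) f \<eta>(1)] by blast
  then have D: "1 \<le> D" and e: "acont e" and Lab: "finite Lab"
    and L1: "\<And>w l. (w, l) \<in> Lab \<Longrightarrow> mass (\<lambda>x. B x \<and> e x = w) = ennreal (a / 2 ^ D)"
    and L2: "\<And>w l. (w, l) \<in> Lab \<Longrightarrow>
       generically (\<lambda>x. (A x \<and> e (base_pt B x) = w \<and> age B x = l) = (B (\<tau> (- int l) x) \<and> e (\<tau> (- int l) x) = w))"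
    and L3: "\<And>w l. (w, l) \<in> Lab \<Longrightarrow> generically (\<lambda>x. A x \<and> e (base_pt B x) = w \<and> age B x = l \<longrightarrow> f x = g w l)"
    and L4: "mass (\<lambda>x. A x \<and> (e (base_pt B x), age B x) \<notin> Lab) \<le> ennreal \<eta>"
    unfolding tower_labels_def by simp_all
  let ?b = "base_pt B" and ?d = "age B"
  define lab where "lab x = (e (?b x), ?d x)" for x
  have d: "acont ?d" by (rule acont_age[OF B(1,3)])
  have eb: "acont (\<lambda>x. e (?b x))" by (rule acont_base_pt[OF B(1,3) e])
  have lab: "acont lab" unfolding lab_def[abs_def] by (intro acont_Pair eb d)
  define s where "s = a / 2 ^ D"
  have s: "s > 0" "a = 2 ^ D * s" using mA by (simp_all add: s_def)
  define P where "P w x \<longleftrightarrow> B x \<and> e x = w" for w x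
  have acP: "acont (P w)" for w unfolding P_def[abs_def] by (intro acont_conj B acont_eq e acont_const)
  have Pm: "mass (P w) = ennreal s" if "w \<in> fst ` Lab" for w
    using that L1 unfolding P_def s_def by auto
  have cls: "generically (\<lambda>x. (A x \<and> lab x = (w, l)) = P w (\<tau> (- int l) x))" if "(w, l) \<in> Lab" for w l
    using L2[OF that] by (rule gen_mono) (simp add: lab_def P_def)
  have clsm: "mass (\<lambda>x. A x \<and> lab x = p) = ennreal s" if "p \<in> Lab" for p
  proof -
    obtain w l where p: "p = (w, l)" by force
    have "mass (\<lambda>x. A x \<and> lab x = p) = mass (\<lambda>x. P w (\<tau> (- int l) x))" unfolding p
      by (rule acont_mass_cong[OF cls]) (use that p in \<open>auto intro!: acont_conj A acont_eq lab acont_const\<close>)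
    also have "\<dots> = mass (P w)" by (rule mass_shift[OF acont_sets[OF acP]])
    also have "\<dots> = ennreal s" using that p by (intro Pm) force
    finally show ?thesis .
  qed
  \<comment> \<open>The unlabelled part \<open>R\<close> has measure \<open>N' * s\<close> and is cut into \<open>N'\<close> further parts.\<close>
  define N where "N = card Lab"
  define R where "R x \<longleftrightarrow> A x \<and> lab x \<notin> Lab" for x
  have acR: "acont R" unfolding R_def[abs_def] by (intro acont_conj A acont_not acont_mem lab)
  have R\<eta>: "mass R \<le> ennreal \<eta>" using L4 unfolding R_def lab_def .
  have good: "mass (\<lambda>x. A x \<and> lab x \<in> Lab) = ennreal (real N * s)"
  proof -
    have "mass (\<lambda>x. A x \<and> lab x \<in> Lab) = (\<Sum>p\<in>Lab. mass (\<lambda>x. A x \<and> lab x = p))"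
      by (rule mass_finite_sum[OF Lab]) (intro acont_conj A acont_eq lab acont_const)
    also have "\<dots> = (\<Sum>p\<in>Lab. ennreal s)" by (intro sum.cong refl clsm)
    finally show ?thesis using s by (simp add: N_def ennreal_mult ennreal_of_nat_eq_real_of_nat)
  qed
  have N: "N \<le> 2 ^ D"
  proof -
    have "ennreal (real N * s) \<le> ennreal (2 ^ D * s)"
      unfolding good[symmetric] s(2)[symmetric] mA(1)[symmetric] by (intro AE_imp_mass_le A) auto
    then have "real N * s \<le> 2 ^ D * s" using s by (simp add: ennreal_le_iff)
    then have "real N \<le> 2 ^ D" using s by simp
    then show ?thesis by (metis of_nat_le_iff of_nat_numeral of_nat_power)
  qed
  define N' where "N' = 2 ^ D - N"
  have rN': "real N' = 2 ^ D - real N" using N by (simp add: N'_def of_nat_diff)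
  have Rm: "mass R = ennreal (real N' * s)"
  proof -
    have "mass R = mass A - mass (\<lambda>x. A x \<and> lab x \<in> Lab)" unfolding R_def
      by (rule mass_Diff[OF A acont_mem[OF lab]]) (simp add: mA)
    also have "\<dots> = ennreal (real N' * s)" unfolding good mA(1) rN' using s by (simp add: ennreal_minus algebra_simps)
    finally show ?thesis .
  qed
  obtain u :: "'a \<Rightarrow> nat" where u: "acont u"
    "\<And>r. ennreal (real (r + 1) * s) \<le> mass R \<Longrightarrow> mass (\<lambda>x. R x \<and> u x = r) = ennreal s"
    using ex_equal_pieces[OF acR s(1)] by blast
  have acRu: "acont (\<lambda>x. R x \<and> u x = r)" for r by (intro acont_conj acR acont_eq u acont_const)
  have um: "mass (\<lambda>x. R x \<and> u x = r) = ennreal s" if "r < N'" for r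
    using that s by (intro u(2)) (auto simp: Rm intro!: ennreal_leI mult_right_mono)
  have ul: "generically (\<lambda>x. R x \<longrightarrow> u x < N')"
  proof -
    have "mass (\<lambda>x. R x \<and> u x < N') = mass (\<lambda>x. R x \<and> u x \<in> {..<N'})" by simp
    also have "\<dots> = (\<Sum>r<N'. mass (\<lambda>x. R x \<and> u x = r))" by (rule mass_finite_sum[OF _ acRu]) simp
    also have "\<dots> = (\<Sum>r<N'. ennreal s)" by (intro sum.cong refl um) simp
    also have "\<dots> = mass R" using s by (simp add: Rm ennreal_mult ennreal_of_nat_eq_real_of_nat)
    finally have "mass (\<lambda>x. R x \<and> \<not> u x < N') = mass R - mass R"
      using mass_Diff[OF acR acont_less[OF u(1) acont_const], of N'] by (simp add: Rm)
    then have "mass (\<lambda>x. R x \<and> \<not> u x < N') = 0" by (simp add: Rm)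
    then have "generically (\<lambda>x. \<not> (R x \<and> \<not> u x < N'))"
      by (intro gen_of_mass_0 acont_conj acR acont_not acont_less u acont_const)
    then show ?thesis by (rule gen_mono) blast
  qed
  \<comment> \<open>Inside \<open>A\<close> the last alternative occurs on a null set only; it keeps \<open>j\<close> below \<open>2 ^ D\<close> everywhere.\<close>
  obtain idx where idx: "bij_betw idx Lab {0..<N}" using ex_bij_betw_finite_nat[OF Lab] unfolding N_def by blast
  define j where "j x = (if lab x \<in> Lab then idx (lab x) else if N + u x < 2 ^ D then N + u x else 0)" for x
  have acj: "acont j" unfolding j_def[abs_def]
    by (intro acont_if acont_mem lab acont_comp[OF lab, of idx] acont_less acont_plus acont_const u)
  have idxN: "idx p < N" if "p \<in> Lab" for p using bij_betwE[OF idx] that by force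
  have jlt: "j x < 2 ^ D" for x using idxN[of "lab x"] N by (auto simp: j_def)
  have jgood: "generically (\<lambda>x. (A x \<and> j x = idx p) = (A x \<and> lab x = p))" if p: "p \<in> Lab" for p
    using ul
  proof (rule gen_mono)
    fix x assume x: "R x \<longrightarrow> u x < N'"
    show "(A x \<and> j x = idx p) = (A x \<and> lab x = p)"
    proof (cases "lab x \<in> Lab")
      case True
      then show ?thesis using p bij_betw_imp_inj_on[OF idx] by (auto simp: j_def inj_on_def)
    next
      case False
      then have "A x \<longrightarrow> j x \<ge> N" using x N by (auto simp: R_def j_def N'_def)
      then show ?thesis using idxN[OF p] False p by auto
    qed
  qed
  have jbad: "generically (\<lambda>x. (A x \<and> j x = N + r) = (R x \<and> u x = r))" if r: "r < N'" for r
    using ul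
  proof (rule gen_mono)
    fix x assume x: "R x \<longrightarrow> u x < N'"
    show "(A x \<and> j x = N + r) = (R x \<and> u x = r)"
    proof (cases "lab x \<in> Lab")
      case True
      then show ?thesis using idxN[OF True] by (auto simp: j_def R_def)
    next
      case False
      then have "A x \<longrightarrow> j x = N + u x" using x N by (auto simp: R_def j_def N'_def)
      then show ?thesis using False by (auto simp: R_def)
    qed
  qed
  have cases_r: thesis if "r < 2 ^ D" "\<And>p. p \<in> Lab \<Longrightarrow> r = idx p \<Longrightarrow> thesis" "\<And>t. t < N' \<Longrightarrow> r = N + t \<Longrightarrow> thesis" for r thesis
  proof (cases "r < N")
    case True
    then have "r \<in> idx ` Lab" using bij_betw_imp_surj_on[OF idx] by auto
    then show ?thesis using that(2) by blast
  next
    case False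
    then show ?thesis using that(1) that(3)[of "r - N"] N by (simp add: N'_def)
  qed
  have acAj: "acont (\<lambda>x. A x \<and> j x = r)" for r by (intro acont_conj A acont_eq acj acont_const)
  have jm: "mass (\<lambda>x. A x \<and> j x = r) = ennreal s" if "r < 2 ^ D" for r
    using that
  proof (rule cases_r)
    fix p assume p: "p \<in> Lab" "r = idx p"
    show ?thesis unfolding p(2) using acont_mass_cong[OF jgood[OF p(1)] acAj] clsm[OF p(1)] by simp
  next
    fix t assume t: "t < N'" "r = N + t"
    show ?thesis unfolding t(2) using acont_mass_cong[OF jbad[OF t(1)] acAj] um[OF t(1)] by simp
  qed
  \<comment> \<open>The isomorphism \<open>h w\<close> depends on the piece \<open>w\<close> of \<open>B\<close> but not on the level, so that columns are collapsed.\<close>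
  define C0 where "C0 x \<longleftrightarrow> A x \<and> j x = 0" for x
  have C0: "acont C0" "mass C0 = ennreal s" using acAj[of 0] jm[of 0] by (auto simp: C0_def[abs_def])
  have "\<exists>p. acont (fst p) \<and> (w \<in> fst ` Lab \<longrightarrow> orbit_iso (fst p) (snd p) (P w) C0)" for w
  proof (cases "w \<in> fst ` Lab")
    case True
    then obtain c c' where "orbit_iso c c' (P w) C0"
      using ex_orbit_iso[OF acP C0(1), of w] Pm C0(2) by auto
    then show ?thesis using orbit_isoD(1) by (intro exI[of _ "(c, c')"]) auto
  qed (auto intro!: exI[of _ "(\<lambda>_. 0, \<lambda>_. 0)"] acont_const)
  from choice[OF allI, OF this] obtain h where
    "\<forall>w. acont (fst (h w)) \<and> (w \<in> fst ` Lab \<longrightarrow> orbit_iso (fst (h w)) (snd (h w)) (P w) C0)" by (rule exE)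
  then have h: "\<And>w. acont (fst (h w))" "\<And>w. w \<in> fst ` Lab \<Longrightarrow> orbit_iso (fst (h w)) (snd (h w)) (P w) C0" by simp_all
  have "\<exists>p. acont (fst p) \<and> (r < N' \<longrightarrow> orbit_iso (fst p) (snd p) (\<lambda>x. R x \<and> u x = r) C0)" for r
  proof (cases "r < N'")
    case True
    then obtain c c' where "orbit_iso c c' (\<lambda>x. R x \<and> u x = r) C0"
      using ex_orbit_iso[OF acRu C0(1), of r] um C0(2) by auto
    then show ?thesis using orbit_isoD(1) by (intro exI[of _ "(c, c')"]) auto
  qed (auto intro!: exI[of _ "(\<lambda>_. 0, \<lambda>_. 0)"] acont_const)
  from choice[OF allI, OF this] obtain k where
    "\<forall>r. acont (fst (k r)) \<and> (r < N' \<longrightarrow> orbit_iso (fst (k r)) (snd (k r)) (\<lambda>x. R x \<and> u x = r) C0)" by (rule exE)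
  then have k: "\<And>r. acont (fst (k r))" "\<And>r. r < N' \<Longrightarrow> orbit_iso (fst (k r)) (snd (k r)) (\<lambda>x. R x \<and> u x = r) C0" by simp_all
  define q where "q x = (if lab x \<in> Lab then - int (?d x) + fst (h (e (?b x))) (?b x) else fst (k (u x)) x)" for x
  have "acont q" unfolding q_def[abs_def]
  proof (intro acont_if acont_mem lab acont_plus)
    show "acont (\<lambda>x. - int (?d x))" by (rule acont_comp[OF d])
    show "acont (\<lambda>x. fst (h (e (?b x))) (?b x))"
      by (rule acont_fam[OF eb, of "\<lambda>w x. fst (h w) (?b x)"]) (rule acont_base_pt[OF B(1,3) h(1)])
    show "acont (\<lambda>x. fst (k (u x)) x)" by (rule acont_fam[OF u(1), of "\<lambda>r. fst (k r)"]) (rule k)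
  qed
  have iso: "\<exists>q'. orbit_iso q q' (\<lambda>x. A x \<and> j x = r) (\<lambda>x. A x \<and> j x = 0)" if "r < 2 ^ D" for r
    using that
  proof (rule cases_r)
    fix p assume p: "p \<in> Lab" "r = idx p"
    obtain w l where wl: "p = (w, l)" by force
    have w: "w \<in> fst ` Lab" using p wl by force
    note i = orbit_iso_trans[OF orbit_iso_sym[OF orbit_iso_shift[of "int l" "P w"]] h(2)[OF w]]
    have "orbit_iso q (\<lambda>x. snd (h w) x + int l) (\<lambda>x. A x \<and> j x = r) C0"
    proof (rule orbit_iso_cong[OF i \<open>acont q\<close>])
      show "generically (\<lambda>x. P w (\<tau> (- int l) x) = (A x \<and> j x = r))"
        using gen_conj[OF jgood[OF p(1)] cls[of w l]] p wl by (auto elim!: gen_mono)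
      show "generically (\<lambda>x. P w (\<tau> (- int l) x) \<longrightarrow> q x = - int l + fst (h w) (\<tau> (- int l) x))"
        using cls[of w l] p wl by (auto elim!: gen_mono simp: q_def lab_def base_pt_def)
    qed (simp add: gen_True)
    then show ?thesis unfolding C0_def by blast
  next
    fix t assume t: "t < N'" "r = N + t"
    have "orbit_iso q (snd (k t)) (\<lambda>x. A x \<and> j x = r) C0"
    proof (rule orbit_iso_cong[OF k(2)[OF t(1)] \<open>acont q\<close>])
      show "generically (\<lambda>x. (R x \<and> u x = t) = (A x \<and> j x = r))"
        using jbad[OF t(1)] t(2) by (auto elim!: gen_mono)
      show "generically (\<lambda>x. R x \<and> u x = t \<longrightarrow> q x = fst (k t) x)"
        by (rule gen_all) (auto simp: R_def q_def)
    qed (simp add: gen_True)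
    then show ?thesis unfolding C0_def by blast
  qed
  define G where "G r = (let (w, l) = inv_into Lab idx r in g w l)" for r
  have inv: "inv_into Lab idx (idx p) = p" if "p \<in> Lab" for p
    using bij_betw_imp_inj_on[OF idx] that by (rule inv_into_f_f)
  have appr: "generically (\<lambda>x. A x \<and> j x \<in> {..<N} \<longrightarrow> f x = G (j x))"
  proof -
    have "generically (\<lambda>x. \<forall>p. p \<in> Lab \<longrightarrow> (A x \<and> lab x = p \<longrightarrow> f x = g (fst p) (snd p)))"
    proof (rule gen_all_countable)
      fix p
      show "generically (\<lambda>x. p \<in> Lab \<longrightarrow> (A x \<and> lab x = p \<longrightarrow> f x = g (fst p) (snd p)))"
      proof (cases "p \<in> Lab")
        case True
        then have "generically (\<lambda>x. A x \<and> e (?b x) = fst p \<and> ?d x = snd p \<longrightarrow> f x = g (fst p) (snd p))"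
          by (intro L3) simp
        then show ?thesis by (rule gen_mono) (auto simp: lab_def)
      qed (simp add: gen_True)
    qed
    from gen_conj[OF this ul] show ?thesis
    proof (rule gen_mono, intro impI)
      fix x assume x: "(\<forall>p. p \<in> Lab \<longrightarrow> (A x \<and> lab x = p \<longrightarrow> f x = g (fst p) (snd p))) \<and> (R x \<longrightarrow> u x < N')"
        and a: "A x \<and> j x \<in> {..<N}"
      have l: "lab x \<in> Lab"
      proof (rule ccontr)
        assume "lab x \<notin> Lab"
        then have "j x \<ge> N" using x a N by (auto simp: R_def j_def N'_def split: if_splits)
        then show False using a by simp
      qed
      then have "f x = g (fst (lab x)) (snd (lab x))" using x a by blast
      also have "\<dots> = G (j x)" using l by (simp add: G_def j_def inv split_beta)
      finally show "f x = G (j x)" .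
    qed
  qed
  have badm: "mass (\<lambda>x. A x \<and> j x \<notin> {..<N}) \<le> ennreal \<epsilon>"
  proof -
    have "mass (\<lambda>x. A x \<and> j x \<notin> {..<N}) \<le> mass R"
      using idxN by (intro AE_imp_mass_le acR) (auto simp: R_def j_def)
    also have "\<dots> \<le> ennreal \<epsilon>" using R\<eta> \<eta>(2) by (meson ennreal_leI order_trans)
    finally show ?thesis .
  qed
  define E where "E x \<longleftrightarrow> (\<exists>k\<in>{- int K..int K}. B (\<tau> k x) \<or> R (\<tau> k x))" for x
  have acBR: "acont (\<lambda>x. B x \<or> R x)" by (intro acont_disj B acR)
  have acontE: "acont E" unfolding E_def[abs_def] by (intro acont_finite_bex acont_shift[OF acBR]) simp
  have Em: "mass E \<le> ennreal \<epsilon>"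
  proof -
    have "mass (\<lambda>x. B x \<or> R x) \<le> mass B + mass R" by (rule mass_le_add) (auto intro: B acR)
    also have "\<dots> \<le> ennreal (\<eta> + \<eta>)" using R\<eta> \<delta> \<eta> B(4)
      by (subst ennreal_plus) (auto intro!: add_mono ennreal_leI)
    finally have *: "mass (\<lambda>x. B x \<or> R x) \<le> ennreal (\<eta> + \<eta>)" .
    have "mass E \<le> of_nat (card {- int K..int K}) * ennreal (\<eta> + \<eta>)" unfolding E_def
      by (intro mass_bex_le acont_shift[OF acBR]) (use * mass_shift[OF acont_sets[OF acBR]] in auto)
    also have "\<dots> = ennreal ((2 * real K + 1) * (\<eta> + \<eta>))"
      using \<eta> by (simp add: ennreal_of_nat_eq_real_of_nat ennreal_mult'[symmetric] add.commute del: ennreal_plus)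
    finally show ?thesis unfolding \<eta>\<epsilon> .
  qed
  have fwd: "q x = int n + q (\<tau> (int n) x)"
    if rec: "\<exists>l::nat. B (\<tau> (- int l) x)" and no: "\<And>i. 0 < i \<Longrightarrow> i \<le> int n \<Longrightarrow> \<not> B (\<tau> i x)"
      and l: "lab x \<in> Lab" "lab (\<tau> (int n) x) \<in> Lab" for x n
    using l age_add[OF rec no] unfolding q_def by simp
  have pair: "generically (\<lambda>x. A x \<and> \<not> E x \<longrightarrow> (\<forall>k. \<bar>k\<bar> \<le> int K \<longrightarrow> A (\<tau> k x) \<longrightarrow> q x = k + q (\<tau> k x)))"
    using gen_shift[OF gen_recurrent[OF B(1,3)]]
  proof (rule gen_mono, intro impI allI)
    fix x k assume rec: "\<forall>k. \<exists>l::nat. B (\<tau> (- int l) (\<tau> k x))" and x: "A x \<and> \<not> E x" and k: "\<bar>k\<bar> \<le> int K" "A (\<tau> k x)"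
    have nB: "\<not> B (\<tau> i x)" "\<not> R (\<tau> i x)" if "\<bar>i\<bar> \<le> int K" for i using x that by (auto simp: E_def abs_le_iff)
    have l: "lab x \<in> Lab" "lab (\<tau> k x) \<in> Lab" using nB(2)[of 0] nB(2)[OF k(1)] x k(2) by (auto simp: R_def)
    show "q x = k + q (\<tau> k x)"
    proof (cases "k \<ge> 0")
      case True
      then show ?thesis using fwd[of x "nat k"] rec[rule_format, of 0] nB(1) l k by simp
    next
      case False
      have "q (\<tau> k x) = int (nat (- k)) + q (\<tau> (int (nat (- k))) (\<tau> k x))"
      proof (rule fwd)
        show "\<exists>l::nat. B (\<tau> (- int l) (\<tau> k x))" using rec by blast
        show "\<not> B (\<tau> i (\<tau> k x))" if "0 < i" "i \<le> int (nat (- k))" for i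
          using nB(1)[of "i + k"] that k(1) False by simp
      qed (use l False in simp_all)
      then show ?thesis using False by simp
    qed
  qed
  have "refinement A a f K \<epsilon> D j q G {..<N} E"
    unfolding refinement_def using D acj \<open>acont q\<close> jlt jm iso appr badm acontE Em pair s_def by auto
  then show ?thesis by blast
qed

section \<open>Stages of the construction\<close>

text \<open>The cells are the level sets of \<open>i\<close>. All of them are mapped onto the base
  \<open>A\<close> by the same cocycle \<open>c\<close>; their common measure is \<open>1 / 2 ^
  e\<close>.\<close>
definition tower :: "nat \<Rightarrow> ('a \<Rightarrow> int) \<Rightarrow> ('a \<Rightarrow> nat) \<Rightarrow> ('a \<Rightarrow> bool) \<Rightarrow> bool" where
  "tower e c i A \<longleftrightarrow> acont c \<and> acont i \<and> acont A \<and> (\<forall>r. \<exists>c'. orbit_iso c c' (\<lambda>x. i x = r) A) \<and>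
     mass A = ennreal (1 / 2 ^ e)"

lemma orbit_iso_restrict:
  assumes "orbit_iso c c' C D"
  shows "orbit_iso c c' (\<lambda>x. C x \<and> P (\<tau> (c x) x)) (\<lambda>x. D x \<and> P x)"
proof -
  note c = orbit_isoD[OF assms]
  have "generically (\<lambda>x. C x \<and> P (\<tau> (c x) x) \<longrightarrow>
      (D (\<tau> (c x) x) \<and> P (\<tau> (c x) x)) \<and> c' (\<tau> (c x) x) = - c x)"
    using c(3) by (rule gen_mono) blast
  moreover have "generically (\<lambda>x. D x \<and> P x \<longrightarrow>
      (C (\<tau> (c' x) x) \<and> P (\<tau> (c (\<tau> (c' x) x)) (\<tau> (c' x) x))) \<and> c (\<tau> (c' x) x) = - c' x)"
    using c(4) by (rule gen_mono) simp
  ultimately show ?thesis using c(1,2) unfolding orbit_iso_def by blast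
qed

lemma tower_cell_mass:
  assumes "tower e c i A" "acont P"
  shows "mass (\<lambda>x. i x = r \<and> P (\<tau> (c x) x)) = mass (\<lambda>x. A x \<and> P x)"
proof -
  have t: "acont i" "acont A" using assms(1) by (auto simp: tower_def)
  obtain c' where "orbit_iso c c' (\<lambda>x. i x = r) A" using assms(1) unfolding tower_def by blast
  from orbit_iso_mass[OF this acont_eq[OF t(1) acont_const] t(2) assms(2)] show ?thesis .
qed

lemma tower_mass: assumes "tower e c i A" shows "mass (\<lambda>x. i x = r) = ennreal (1 / 2 ^ e)"
  using tower_cell_mass[OF assms acont_const[of True], of r] assms by (simp add: tower_def)

lemma tower_cells_mass:
  assumes "tower e c i A" "acont P"
  shows "mass (\<lambda>x. i x < m \<and> P (\<tau> (c x) x)) = of_nat m * mass (\<lambda>x. A x \<and> P x)"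
proof -
  have t: "acont i" "acont c" using assms(1) by (auto simp: tower_def)
  have "mass (\<lambda>x. i x < m \<and> P (\<tau> (c x) x)) = mass (\<lambda>x. P (\<tau> (c x) x) \<and> i x \<in> {..<m})" by (simp add: conj_commute)
  also have "\<dots> = (\<Sum>r<m. mass (\<lambda>x. P (\<tau> (c x) x) \<and> i x = r))"
    by (intro mass_finite_sum acont_conj acont_subst[OF t(2) assms(2)] acont_eq t acont_const) simp
  also have "\<dots> = (\<Sum>r<m. mass (\<lambda>x. A x \<and> P x))"
    using tower_cell_mass[OF assms] by (simp add: conj_commute)
  finally show ?thesis by simp
qed

text \<open>This is where the infinite total measure enters: the space is divided into infinitely
  many cells of measure 1, with no remainder.\<close>
lemma tower_0: "\<exists>c i A. tower 0 c i A"
proof -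
  obtain i :: "'a \<Rightarrow> nat" where i: "acont i"
    "\<And>r. ennreal (real (r + 1) * 1) \<le> mass (\<lambda>x. True) \<Longrightarrow> mass (\<lambda>x. True \<and> i x = r) = ennreal 1"
    using ex_equal_pieces[OF acont_const[of True], of 1] by auto
  have U: "UNIV \<in> sets \<mu>" using sets.top[of \<mu>] by simp
  then have "mass (\<lambda>x. True) = \<infinity>" using infinite_mu main_part[OF U] emeasure_completion[of UNIV \<mu>] by simp
  then have m: "mass (\<lambda>x. i x = r) = 1" for r using i(2)[of r] by simp
  have aci: "acont (\<lambda>x. i x = r)" for r by (intro acont_eq i acont_const)
  have "\<exists>p. orbit_iso (fst p) (snd p) (\<lambda>x. i x = r) (\<lambda>x. i x = 0)" for r
    using ex_orbit_iso[OF aci aci, of r 0] m by auto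
  from choice[OF allI, OF this] obtain h where
    "\<forall>r. orbit_iso (fst (h r)) (snd (h r)) (\<lambda>x. i x = r) (\<lambda>x. i x = 0)" by (rule exE)
  then have h: "\<And>r. orbit_iso (fst (h r)) (snd (h r)) (\<lambda>x. i x = r) (\<lambda>x. i x = 0)" by simp
  define c where "c x = fst (h (i x)) x" for x
  have c: "acont c" unfolding c_def[abs_def] by (rule acont_fam[OF i(1), of "\<lambda>r. fst (h r)"]) (rule orbit_isoD(1)[OF h])
  have "orbit_iso c (snd (h r)) (\<lambda>x. i x = r) (\<lambda>x. i x = 0)" for r
    by (rule orbit_iso_cong[OF h[of r] c]) (auto intro!: gen_all simp: c_def)
  then have "tower 0 c i (\<lambda>x. i x = 0)" unfolding tower_def using c i aci m by auto
  then show ?thesis by blast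
qed

lemma ex_bound:
  fixes h :: "'a \<Rightarrow> int"
  assumes "acont P" "mass P < \<infinity>" "acont h" "\<eta> > (0::real)"
  shows "\<exists>K::nat. mass (\<lambda>x. P x \<and> int K < \<bar>h x\<bar>) \<le> ennreal \<eta>"
proof (rule ex_small_of_decreasing)
  show "acont (\<lambda>x. P x \<and> int K < \<bar>h x\<bar>)" for K
    by (intro acont_conj assms acont_less acont_const acont_comp[OF assms(3)])
  have "mass (\<lambda>x. P x \<and> int 0 < \<bar>h x\<bar>) \<le> mass P" by (intro AE_imp_mass_le assms) auto
  then show "mass (\<lambda>x. P x \<and> int 0 < \<bar>h x\<bar>) < \<infinity>" using assms(2) by (rule le_less_trans)
  show "\<exists>K. \<not> (P x \<and> int K < \<bar>h x\<bar>)" for x by (rule exI[of _ "nat \<bar>h x\<bar>"]) simp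
qed (use assms(4) in auto)

text \<open>A division of the base is transported to every cell; the parts of cell \<open>i\<close>
  receive the numbers from \<open>2 ^ D * i\<close> to \<open>2 ^ D * i + (2 ^ D - 1)\<close>, so
  that the number divided by the number of cells per unit of measure converges.\<close>
lemma tower_refine:
  assumes t: "tower e c i A" and r: "refinement A (1 / 2 ^ e) f K \<epsilon> D j q g J E"
  shows "tower (e + D) (\<lambda>x. c x + q (\<tau> (c x) x)) (\<lambda>x. 2 ^ D * i x + j (\<tau> (c x) x)) (\<lambda>x. A x \<and> j x = 0)"
proof -
  have t': "acont c" "acont i" "acont A" "\<And>r. \<exists>c'. orbit_iso c c' (\<lambda>x. i x = r) A" "mass A = ennreal (1 / 2 ^ e)"
    using t unfolding tower_def by auto
  have r': "acont j" "acont q" "\<And>x. j x < 2 ^ D" "\<And>u. u < 2 ^ D \<Longrightarrow> mass (\<lambda>x. A x \<and> j x = u) = ennreal ((1 / 2 ^ e) / 2 ^ D)"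
    "\<And>u. u < 2 ^ D \<Longrightarrow> \<exists>q'. orbit_iso q q' (\<lambda>x. A x \<and> j x = u) (\<lambda>x. A x \<and> j x = 0)"
    using r unfolding refinement_def by auto
  have acc: "acont (\<lambda>x. c x + q (\<tau> (c x) x))" by (intro acont_plus acont_subst[OF t'(1) r'(2)] t')
  have aci: "acont (\<lambda>x. 2 ^ D * i x + j (\<tau> (c x) x))"
    by (intro acont_plus acont_subst[OF t'(1) r'(1)] acont_comp[OF t'(2)])
  have "\<exists>c'. orbit_iso (\<lambda>x. c x + q (\<tau> (c x) x)) c' (\<lambda>x. 2 ^ D * i x + j (\<tau> (c x) x) = u) (\<lambda>x. A x \<and> j x = 0)" for u
  proof -
    define v where "v = u div 2 ^ D"
    define w where "w = u mod 2 ^ D"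
    have w: "w < 2 ^ D" by (simp add: w_def)
    have uvw: "2 ^ D * i x + j (\<tau> (c x) x) = u \<longleftrightarrow> i x = v \<and> j (\<tau> (c x) x) = w" for x
    proof
      assume h: "2 ^ D * i x + j (\<tau> (c x) x) = u"
      show "i x = v \<and> j (\<tau> (c x) x) = w" unfolding v_def w_def h[symmetric] using r'(3) by simp
    qed (simp add: v_def w_def)
    obtain c' where "orbit_iso c c' (\<lambda>x. i x = v) A" using t'(4) by blast
    from orbit_iso_restrict[OF this, of "\<lambda>x. j x = w"]
    have 1: "orbit_iso c c' (\<lambda>x. i x = v \<and> j (\<tau> (c x) x) = w) (\<lambda>x. A x \<and> j x = w)" .
    obtain q' where 2: "orbit_iso q q' (\<lambda>x. A x \<and> j x = w) (\<lambda>x. A x \<and> j x = 0)" using r'(5)[OF w] by blast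
    show ?thesis unfolding uvw using orbit_iso_trans[OF 1 2] by blast
  qed
  moreover have "mass (\<lambda>x. A x \<and> j x = 0) = ennreal (1 / 2 ^ (e + D))" using r'(4)[of 0] by (simp add: power_add)
  ultimately show ?thesis unfolding tower_def using acc aci t'(3) r'(1) by (auto intro!: acont_conj acont_eq acont_const)
qed

text \<open>The progress from stage \<open>n\<close> to stage \<open>n + 1\<close>. The condition on
  \<open>k\<close> says that two points of an orbit that are carried to the same point of the base
  remain so, and that their cell numbers are refined by the same digits. The exceptional sets are
  measured inside the union of the first \<open>n * 2 ^ e\<close> cells, which has measure
  \<open>n\<close> and is the union of the first \<open>n\<close> cells of stage 0.\<close>
definition good_step :: "(nat \<Rightarrow> 'a set) \<Rightarrow> nat \<Rightarrow> nat \<Rightarrow> ('a \<Rightarrow> int) \<Rightarrow> ('a \<Rightarrow> nat) \<Rightarrow> nat \<Rightarrow> ('a \<Rightarrow> int) \<Rightarrow> ('a \<Rightarrow> nat) \<Rightarrow>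
   nat set \<Rightarrow> (nat \<Rightarrow> nat \<Rightarrow> bool) \<Rightarrow> bool" where
  "good_step U n e c i e' c' i' S \<Gamma> \<longleftrightarrow> e < e' \<and> (\<forall>x. i' x div 2 ^ (e' - e) = i x) \<and>
     (\<forall>x k. c x = k + c (\<tau> k x) \<longrightarrow> c' x = k + c' (\<tau> k x) \<and> i' (\<tau> k x) mod 2 ^ (e' - e) = i' x mod 2 ^ (e' - e)) \<and>
     generically (\<lambda>x. i' x \<in> S \<longrightarrow> (\<forall>l<n. (x \<in> U l) = \<Gamma> l (i' x))) \<and>
     mass (\<lambda>x. i x < n * 2 ^ e \<and> i' x \<notin> S) \<le> ennreal ((1/2) ^ n) \<and>
     mass (\<lambda>x. i x < n * 2 ^ e \<and> c' x \<noteq> 1 + c' (\<tau> 1 x)) \<le> ennreal (3 * (1/2) ^ n)"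

text \<open>Apply the refinement to the function that records, for a point of the base, which of the
  first \<open>n\<close> basic sets contain its copies in the first \<open>m\<close> cells. The
  points \<open>x\<close> and \<open>T x\<close> are carried to points of the base that differ by a
  power of \<open>T\<close> whose exponent is bounded by \<open>K\<close> outside a small
  set.\<close>
lemma ex_good_step:
  assumes U: "\<And>l. acont (\<lambda>x. x \<in> U l)" and t: "tower e c i A"
  shows "\<exists>e' c' i' A' S \<Gamma>. tower e' c' i' A' \<and> good_step U n e c i e' c' i' S \<Gamma>"
proof -
  have t': "acont c" "acont i" "acont A" "\<And>r. \<exists>c'. orbit_iso c c' (\<lambda>x. i x = r) A" "mass A = ennreal (1 / 2 ^ e)"
    using t unfolding tower_def by auto
  define m where "m = n * 2 ^ e"
  define \<eta> :: real where "\<eta> = (1/2) ^ n"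
  define \<epsilon> where "\<epsilon> = \<eta> / (real m + 1)"
  have \<eta>: "\<eta> > 0" by (simp add: \<eta>_def)
  have \<epsilon>: "\<epsilon> > 0" "real m * \<epsilon> \<le> \<eta>" using \<eta> by (auto simp: \<epsilon>_def field_simps)
  have m\<epsilon>: "of_nat m * ennreal \<epsilon> \<le> ennreal \<eta>"
    using \<epsilon> by (simp add: ennreal_of_nat_eq_real_of_nat ennreal_mult'[symmetric] ennreal_leI)
  from choice[OF allI, OF t'(4)] obtain \<kappa> where "\<forall>r. orbit_iso c (\<kappa> r) (\<lambda>x. i x = r) A" by (rule exE)
  then have \<kappa>: "orbit_iso c (\<kappa> r) (\<lambda>x. i x = r) A" for r by simp
  have acm: "acont (\<lambda>x. i x < m)" by (intro acont_less t' acont_const)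
  have finm: "mass (\<lambda>x. i x < m) < \<infinity>"
    using tower_cells_mass[OF t acont_const[of True], of m] t'(5) by (simp add: ennreal_mult_less_top of_nat_less_top)
  obtain K1 :: nat where K1: "mass (\<lambda>x. i x < m \<and> int K1 < \<bar>c x\<bar>) \<le> ennreal \<eta>"
    using ex_bound[OF acm finm t'(1) \<eta>] by blast
  obtain K2 :: nat where K2: "mass (\<lambda>x. i x < m \<and> int K2 < \<bar>c (\<tau> 1 x)\<bar>) \<le> ennreal \<eta>"
    using ex_bound[OF acm finm acont_shift[OF t'(1)] \<eta>] by blast
  define K where "K = K1 + K2 + 1"
  \<comment> \<open>The copy of \<open>x\<close> in cell \<open>r\<close> is \<open>\<tau> (\<kappa> r x) x\<close>.\<close>
  define f where "f x = map (\<lambda>r. map (\<lambda>l. \<tau> (\<kappa> r x) x \<in> U l) [0..<n]) [0..<m]" for x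
  have f: "acont f" unfolding f_def[abs_def]
    by (intro acont_map acont_subst[OF orbit_isoD(2)[OF \<kappa>] U])
  have "range f \<subseteq> {xs. set xs \<subseteq> {ys. set ys \<subseteq> UNIV \<and> length ys = n} \<and> length xs = m}"
    unfolding f_def by auto
  then have finf: "finite (range f)"
    by (rule finite_subset) (intro finite_lists_length_eq finite)
  obtain D j q g J E where r: "refinement A (1 / 2 ^ e) f K \<epsilon> D j q g J E"
    using ex_refinement[OF t'(3,5) _ f finf \<epsilon>(1), of K] by auto
  have r': "1 \<le> D" "acont j" "acont q" "\<And>x. j x < 2 ^ D"
    "generically (\<lambda>x. A x \<and> j x \<in> J \<longrightarrow> f x = g (j x))" "mass (\<lambda>x. A x \<and> j x \<notin> J) \<le> ennreal \<epsilon>"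
    "acont E" "mass E \<le> ennreal \<epsilon>"
    "generically (\<lambda>x. A x \<and> \<not> E x \<longrightarrow> (\<forall>k. \<bar>k\<bar> \<le> int K \<longrightarrow> A (\<tau> k x) \<longrightarrow> q x = k + q (\<tau> k x)))"
    using r unfolding refinement_def by simp_all
  define c' where "c' x = c x + q (\<tau> (c x) x)" for x
  define i' where "i' x = 2 ^ D * i x + j (\<tau> (c x) x)" for x
  have tower': "tower (e + D) c' i' (\<lambda>x. A x \<and> j x = 0)"
    unfolding c'_def[abs_def] i'_def[abs_def] by (rule tower_refine[OF t r])
  have i'_div: "i' x div 2 ^ D = i x" and i'_mod: "i' x mod 2 ^ D = j (\<tau> (c x) x)" for x
    using r'(4) by (simp_all add: i'_def)
  have joined: "c' x = k + c' (\<tau> k x) \<and> i' (\<tau> k x) mod 2 ^ D = i' x mod 2 ^ D" if "c x = k + c (\<tau> k x)" for x k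
  proof -
    have "\<tau> (c (\<tau> k x)) (\<tau> k x) = \<tau> (c x) x" using that by (simp add: add.commute)
    then show ?thesis unfolding i'_mod c'_def using that by simp
  qed
  define S where "S = {u. u div 2 ^ D < m \<and> u mod 2 ^ D \<in> J}"
  have iS: "i' x \<in> S \<longleftrightarrow> i x < m \<and> j (\<tau> (c x) x) \<in> J" for x
    by (simp add: S_def i'_div i'_mod)
  define \<Gamma> where "\<Gamma> l u = g (u mod 2 ^ D) ! (u div 2 ^ D) ! l" for l u :: nat
  have cellD: "generically (\<lambda>x. \<forall>r. i x = r \<longrightarrow> A (\<tau> (c x) x) \<and> \<kappa> r (\<tau> (c x) x) = - c x)"
    by (rule gen_all_countable) (rule orbit_isoD(3)[OF \<kappa>])
  have 1: "generically (\<lambda>x. i' x \<in> S \<longrightarrow> (\<forall>l<n. (x \<in> U l) = \<Gamma> l (i' x)))"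
    using gen_conj[OF cellD gen_shift[OF r'(5)]]
  proof (rule gen_mono, intro impI allI)
    fix x l
    assume h: "(\<forall>r. i x = r \<longrightarrow> A (\<tau> (c x) x) \<and> \<kappa> r (\<tau> (c x) x) = - c x) \<and>
      (\<forall>k. A (\<tau> k x) \<and> j (\<tau> k x) \<in> J \<longrightarrow> f (\<tau> k x) = g (j (\<tau> k x)))"
      and x: "i' x \<in> S" and l: "l < n"
    define y where "y = \<tau> (c x) x"
    have y: "A y" "\<kappa> (i x) y = - c x" using h by (auto simp: y_def)
    have fy: "f y = g (j y)" using h x y(1) iS by (auto simp: y_def)
    have "g (j y) ! i x ! l = (\<tau> (\<kappa> (i x) y) y \<in> U l)"
      unfolding fy[symmetric] f_def using l x iS by simp
    also have "\<tau> (\<kappa> (i x) y) y = x" unfolding y(2) by (simp add: y_def)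
    finally show "(x \<in> U l) = \<Gamma> l (i' x)" by (simp add: \<Gamma>_def i'_div i'_mod y_def)
  qed
  have 2: "mass (\<lambda>x. i x < m \<and> i' x \<notin> S) \<le> ennreal \<eta>"
  proof -
    have "mass (\<lambda>x. i x < m \<and> i' x \<notin> S) = mass (\<lambda>x. i x < m \<and> j (\<tau> (c x) x) \<notin> J)"
      by (rule arg_cong[where f = "emeasure M"]) (auto simp: iS)
    also have "\<dots> = of_nat m * mass (\<lambda>x. A x \<and> j x \<notin> J)"
      by (rule tower_cells_mass[OF t, of "\<lambda>x. j x \<notin> J"]) (intro acont_not acont_mem r')
    also have "\<dots> \<le> of_nat m * ennreal \<epsilon>" by (intro mult_left_mono r') simp
    finally show ?thesis using m\<epsilon> by simp
  qed
  have 3: "mass (\<lambda>x. i x < m \<and> c' x \<noteq> 1 + c' (\<tau> 1 x)) \<le> ennreal (3 * \<eta>)"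
  proof -
    have acontE: "acont (\<lambda>x. E (\<tau> (c x) x))" by (rule acont_subst[OF t'(1) r'(7)])
    have acK1: "acont (\<lambda>x. i x < m \<and> int K1 < \<bar>c x\<bar>)"
      by (intro acont_conj acm acont_less acont_const acont_comp[OF t'(1)])
    have acK2: "acont (\<lambda>x. i x < m \<and> int K2 < \<bar>c (\<tau> 1 x)\<bar>)"
      by (intro acont_conj acm acont_less acont_const acont_comp[OF acont_shift[OF t'(1)]])
    have "mass (\<lambda>x. i x < m \<and> E (\<tau> (c x) x)) = of_nat m * mass (\<lambda>x. A x \<and> E x)"
      by (rule tower_cells_mass[OF t r'(7)])
    also have "\<dots> \<le> of_nat m * ennreal \<epsilon>"
      by (intro mult_left_mono order_trans[OF AE_imp_mass_le[OF _ r'(7)] r'(8)]) auto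
    finally have mE: "mass (\<lambda>x. i x < m \<and> E (\<tau> (c x) x)) \<le> ennreal \<eta>" using m\<epsilon> by simp
    have "generically (\<lambda>x. i x < m \<and> c' x \<noteq> 1 + c' (\<tau> 1 x) \<longrightarrow>
       (i x < m \<and> int K1 < \<bar>c x\<bar>) \<or> (i x < m \<and> int K2 < \<bar>c (\<tau> 1 x)\<bar>) \<or> (i x < m \<and> E (\<tau> (c x) x)))"
      using gen_conj[OF gen_shift[OF cellD] gen_shift[OF r'(9)]]
    proof (rule gen_mono)
      fix x assume h: "(\<forall>k r. i (\<tau> k x) = r \<longrightarrow> A (\<tau> (c (\<tau> k x)) (\<tau> k x)) \<and> \<kappa> r (\<tau> (c (\<tau> k x)) (\<tau> k x)) = - c (\<tau> k x)) \<and>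
         (\<forall>k. A (\<tau> k x) \<and> \<not> E (\<tau> k x) \<longrightarrow>
           (\<forall>ka. \<bar>ka\<bar> \<le> int K \<longrightarrow> A (\<tau> ka (\<tau> k x)) \<longrightarrow> q (\<tau> k x) = ka + q (\<tau> ka (\<tau> k x))))"
      show "i x < m \<and> c' x \<noteq> 1 + c' (\<tau> 1 x) \<longrightarrow>
       (i x < m \<and> int K1 < \<bar>c x\<bar>) \<or> (i x < m \<and> int K2 < \<bar>c (\<tau> 1 x)\<bar>) \<or> (i x < m \<and> E (\<tau> (c x) x))"
      proof (rule impI, rule ccontr)
        assume x: "i x < m \<and> c' x \<noteq> 1 + c' (\<tau> 1 x)"
          and no: "\<not> ((i x < m \<and> int K1 < \<bar>c x\<bar>) \<or> (i x < m \<and> int K2 < \<bar>c (\<tau> 1 x)\<bar>) \<or> (i x < m \<and> E (\<tau> (c x) x)))"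
        define k where "k = c (\<tau> 1 x) + 1 - c x"
        have k: "\<bar>k\<bar> \<le> int K" using no x unfolding k_def K_def by auto
        have e1: "\<tau> k (\<tau> (c x) x) = \<tau> (c (\<tau> 1 x)) (\<tau> 1 x)" by (simp add: k_def del: tau_1)
        have "A (\<tau> (c (\<tau> 1 x)) (\<tau> 1 x))" using h by blast
        moreover have "A (\<tau> (c (\<tau> 0 x)) (\<tau> 0 x))" using h by blast
        ultimately have "q (\<tau> (c x) x) = k + q (\<tau> k (\<tau> (c x) x))"
          using h no x k e1 by (metis tau_0)
        then have "q (\<tau> (c x) x) = k + q (\<tau> (c (\<tau> 1 x)) (\<tau> 1 x))" unfolding e1 .
        then have "c' x = 1 + c' (\<tau> 1 x)" unfolding c'_def k_def by linarith
        then show False using x by blast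
      qed
    qed
    from gen_AE[OF this]
    have "mass (\<lambda>x. i x < m \<and> c' x \<noteq> 1 + c' (\<tau> 1 x)) \<le> mass (\<lambda>x. i x < m \<and> int K1 < \<bar>c x\<bar>) +
        mass (\<lambda>x. (i x < m \<and> int K2 < \<bar>c (\<tau> 1 x)\<bar>) \<or> (i x < m \<and> E (\<tau> (c x) x)))"
      by (rule mass_le_add) (intro acK1 acont_disj acK2 acont_conj acm acontE)+
    also have "\<dots> \<le> ennreal \<eta> + (mass (\<lambda>x. i x < m \<and> int K2 < \<bar>c (\<tau> 1 x)\<bar>) + mass (\<lambda>x. i x < m \<and> E (\<tau> (c x) x)))"
      by (intro add_mono K1 mass_le_add acK2 acont_conj acm acontE) auto
    also have "\<dots> \<le> ennreal \<eta> + (ennreal \<eta> + ennreal \<eta>)" by (intro add_mono order_refl K2 mE)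
    also have "\<dots> = ennreal (3 * \<eta>)" using \<eta> by (simp add: ennreal_plus[symmetric] del: ennreal_plus)
    finally show ?thesis .
  qed
  have "good_step U n e c i (e + D) c' i' S \<Gamma>"
    unfolding good_step_def using r'(1) i'_div joined 1 2 3 unfolding m_def \<eta>_def by auto
  then show ?thesis using tower' by blast
qed

section \<open>The limit of the stages\<close>

lemma AE_eventually_not:
  assumes "\<And>n. acont (P n)" "\<And>n. mass (P n) \<le> ennreal (C * (1/2) ^ n)" "C \<ge> 0"
  shows "AE x in M. \<forall>\<^sub>F n in sequentially. \<not> P n x"
proof -
  have fin: "mass (P n) < \<infinity>" for n using assms(2)[of n] by (rule le_less_trans) simp
  have le: "measure M {x. P n x} \<le> C * (1/2) ^ n" for n
    unfolding measure_def using assms(2)[of n] assms(3) by (intro enn2real_leI) auto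
  have "summable (\<lambda>n. C * (1/2::real) ^ n)" by (intro summable_mult summable_geometric) simp
  then have "summable (\<lambda>n. measure M {x. P n x})"
    by (rule summable_comparison_test'[of _ 0]) (use le in auto)
  then have "AE x in M. \<forall>\<^sub>F n in sequentially. x \<in> space M - {x. P n x}"
    using fin by (intro borel_cantelli_AE1 acont_sets assms) auto
  then show ?thesis by simp
qed

end

locale tower_sequence = polish_ergodic \<mu> T
  for \<mu> :: "'a::polish_space measure" and T +
  fixes U :: "nat \<Rightarrow> 'a set" and e :: "nat \<Rightarrow> nat" and c :: "nat \<Rightarrow> 'a \<Rightarrow> int" and i :: "nat \<Rightarrow> 'a \<Rightarrow> nat"
    and A :: "nat \<Rightarrow> 'a \<Rightarrow> bool" and S :: "nat \<Rightarrow> nat set" and \<Gamma> :: "nat \<Rightarrow> nat \<Rightarrow> nat \<Rightarrow> bool"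
  assumes base: "\<And>x V. open V \<Longrightarrow> x \<in> V \<Longrightarrow> \<exists>l. x \<in> U l \<and> U l \<subseteq> V"
    and e0: "e 0 = 0"
    and tower: "\<And>n. tower (e n) (c n) (i n) (A n)"
    and step: "\<And>n. good_step U n (e n) (c n) (i n) (e (Suc n)) (c (Suc n)) (i (Suc n)) (S n) (\<Gamma> n)"
begin

lemma acont_i: "acont (i n)" and acont_c: "acont (c n)" using tower[of n] by (auto simp: tower_def)

lemma e_less: "e n < e (Suc n)" using step[of n] by (simp add: good_step_def)
lemma strict_mono_e: "strict_mono e" by (rule strict_mono_Suc_iff[THEN iffD2]) (simp add: e_less)
lemma e_mono: "n \<le> m \<Longrightarrow> e n \<le> e m" using strict_mono_e by (simp add: strict_mono_less_eq)
lemma e_ge: "n \<le> e n" using strict_mono_e by (rule strict_mono_imp_increasing)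

lemma i_Suc_div: "i (Suc n) x div 2 ^ (e (Suc n) - e n) = i n x"
  using step[of n] by (simp add: good_step_def)

lemma i_div:
  assumes "n \<le> m" shows "i m x div 2 ^ (e m - e n) = i n x"
  using assms
proof (induction m rule: dec_induct)
  case (step m)
  have "e (Suc m) - e n = (e (Suc m) - e m) + (e m - e n)" using e_less[of m] e_mono[OF step(1)] by simp
  then show ?case using step i_Suc_div[of m x] by (simp add: power_add div_mult2_eq)
qed simp

lemma i_less_iff: "i n x < n * 2 ^ e n \<longleftrightarrow> i 0 x < n"
  using i_div[of 0 n x] by (simp add: e0 div_less_iff_less_mult[symmetric])

text \<open>The points \<open>x\<close> and \<open>\<tau> k x\<close> are carried to the same point
  of the base at stage \<open>n\<close>. The equation of cocycles is used instead of the equation of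
  points because it is an almost clopen condition.\<close>
definition joined :: "nat \<Rightarrow> 'a \<Rightarrow> int \<Rightarrow> bool" where
  "joined n x k \<longleftrightarrow> c n x = k + c n (\<tau> k x)"

lemma joined_Suc:
  assumes "joined n x k"
  shows "joined (Suc n) x k"
    "int (i (Suc n) (\<tau> k x)) - int (i (Suc n) x) = 2 ^ (e (Suc n) - e n) * (int (i n (\<tau> k x)) - int (i n x))"
proof -
  have h: "c (Suc n) x = k + c (Suc n) (\<tau> k x)"
    "i (Suc n) (\<tau> k x) mod 2 ^ (e (Suc n) - e n) = i (Suc n) x mod 2 ^ (e (Suc n) - e n)"
    using step[of n] assms by (auto simp: good_step_def joined_def)
  show "joined (Suc n) x k" using h(1) by (simp add: joined_def)
  have d: "i (Suc n) y = 2 ^ (e (Suc n) - e n) * i n y + i (Suc n) y mod 2 ^ (e (Suc n) - e n)" for y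
    unfolding i_Suc_div[of n y, symmetric] by simp
  have "int (i (Suc n) y) = 2 ^ (e (Suc n) - e n) * int (i n y) + int (i (Suc n) y mod 2 ^ (e (Suc n) - e n))" for y
    by (subst d) simp
  from this[of "\<tau> k x"] this[of x] h(2)
  show "int (i (Suc n) (\<tau> k x)) - int (i (Suc n) x) = 2 ^ (e (Suc n) - e n) * (int (i n (\<tau> k x)) - int (i n x))"
    by (simp add: right_diff_distrib)
qed

text \<open>The measured distance of the cells of two joined points does not change in later
  stages.\<close>
lemma joined_mono:
  assumes "joined n x k" "n \<le> m"
  shows "joined m x k \<and> int (i m (\<tau> k x)) - int (i m x) = 2 ^ (e m - e n) * (int (i n (\<tau> k x)) - int (i n x))"
  using assms(2)
proof (induction m rule: dec_induct)
  case (step m)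
  have "e (Suc m) - e n = (e (Suc m) - e m) + (e m - e n)" using e_less[of m] e_mono[OF step(1)] by simp
  then show ?case using step joined_Suc[of m x k] by (simp add: power_add)
qed (simp add: assms)

text \<open>The cell of a point at stage \<open>n\<close> corresponds to the dyadic interval from
  \<open>lower n x\<close> of length \<open>width n\<close>; \<open>\<Phi> x\<close> is the common
  point of these nested intervals.\<close>
definition lower :: "nat \<Rightarrow> 'a \<Rightarrow> real" where "lower n x = real (i n x) / 2 ^ e n"
definition width :: "nat \<Rightarrow> real" where "width n = 1 / 2 ^ e n"
definition \<Phi> :: "'a \<Rightarrow> real" where "\<Phi> x = lim (\<lambda>n. lower n x)"

lemma width_pos: "width n > 0" by (simp add: width_def)

lemma width_0: "width \<longlonglongrightarrow> 0"
proof -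
  have "(\<lambda>n. (1/2::real) ^ n) \<longlonglongrightarrow> 0" by (rule LIMSEQ_realpow_zero) auto
  from LIMSEQ_subseq_LIMSEQ[OF this strict_mono_e] show ?thesis
    by (simp add: comp_def width_def[abs_def] power_one_over)
qed

lemma lower_le: "n \<le> m \<Longrightarrow> lower n x \<le> lower m x"
  and upper_le: "n \<le> m \<Longrightarrow> lower m x + width m \<le> lower n x + width n"
proof -
  assume nm: "n \<le> m"
  define D where "D = e m - e n"
  have e: "e m = e n + D" using e_mono[OF nm] by (simp add: D_def)
  have d: "i m x = 2 ^ D * i n x + i m x mod 2 ^ D" using i_div[OF nm, of x] unfolding D_def
    by (metis mult_div_mod_eq)
  have r: "i m x mod 2 ^ D + 1 \<le> 2 ^ D" by (simp add: Suc_leI)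
  have 1: "real (i m x) \<ge> 2 ^ D * real (i n x)"
    by (subst d) simp
  have "i m x + 1 \<le> 2 ^ D * (i n x + 1)" using d r by (simp add: algebra_simps)
  then have "real (i m x + 1) \<le> real (2 ^ D * (i n x + 1))" by (rule of_nat_mono)
  then have 2: "real (i m x) + 1 \<le> 2 ^ D * (real (i n x) + 1)" by (simp add: distrib_left)
  show "lower n x \<le> lower m x" using 1 unfolding lower_def e by (simp add: power_add field_simps)
  have "(real (i m x) + 1) / 2 ^ e m \<le> (real (i n x) + 1) / 2 ^ e n"
  proof -
    have "(real (i m x) + 1) / 2 ^ e m \<le> 2 ^ D * (real (i n x) + 1) / 2 ^ e m"
      by (rule divide_right_mono[OF 2]) simp
    also have "\<dots> = (real (i n x) + 1) / 2 ^ e n" unfolding e by (simp add: power_add)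
    finally show ?thesis .
  qed
  then show "lower m x + width m \<le> lower n x + width n" by (simp add: lower_def width_def add_divide_distrib)
qed

lemma lower_LIMSEQ: "(\<lambda>n. lower n x) \<longlonglongrightarrow> \<Phi> x"
proof -
  have "lower n x \<le> lower 0 x + width 0" for n using upper_le[of 0 n x] width_pos[of n] by simp
  then have "Bseq (\<lambda>n. lower n x)"
    by (intro BseqI'[of _ "lower 0 x + width 0"]) (auto simp: lower_def)
  moreover have "monoseq (\<lambda>n. lower n x)" using lower_le by (auto simp: monoseq_def)
  ultimately have "convergent (\<lambda>n. lower n x)" by (rule Bseq_monoseq_convergent)
  then show ?thesis unfolding \<Phi>_def by (simp add: convergent_LIMSEQ_iff)
qed

lemma lower_le_\<Phi>: "lower n x \<le> \<Phi> x"
  by (rule LIMSEQ_le_const[OF lower_LIMSEQ]) (use lower_le in blast)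

lemma \<Phi>_le_upper: "\<Phi> x \<le> lower n x + width n"
proof (rule LIMSEQ_le_const2[OF lower_LIMSEQ])
  have "lower m x \<le> lower n x + width n" if "n \<le> m" for m
    using upper_le[OF that, of x] width_pos[of m] by simp
  then show "\<exists>N. \<forall>m\<ge>N. lower m x \<le> lower n x + width n" by blast
qed

lemma joined_\<Phi>:
  assumes "joined n x k"
  shows "\<Phi> (\<tau> k x) = \<Phi> x + (real (i n (\<tau> k x)) - real (i n x)) / 2 ^ e n"
proof -
  let ?d = "(real (i n (\<tau> k x)) - real (i n x)) / 2 ^ e n"
  have eq: "lower m (\<tau> k x) = lower m x + ?d" if "n \<le> m" for m
  proof -
    have "int (i m (\<tau> k x)) - int (i m x) = 2 ^ (e m - e n) * (int (i n (\<tau> k x)) - int (i n x))"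
      using joined_mono[OF assms that] by simp
    then have "real_of_int (int (i m (\<tau> k x)) - int (i m x)) = real_of_int (2 ^ (e m - e n) * (int (i n (\<tau> k x)) - int (i n x)))" by simp
    then have "real (i m (\<tau> k x)) - real (i m x) = 2 ^ (e m - e n) * (real (i n (\<tau> k x)) - real (i n x))" by simp
    moreover have "(2::real) ^ e m = 2 ^ (e m - e n) * 2 ^ e n" using e_mono[OF that] by (simp add: power_add[symmetric])
    ultimately have "?d = (real (i m (\<tau> k x)) - real (i m x)) / 2 ^ e m" by simp
    then show ?thesis unfolding lower_def by (simp add: diff_divide_distrib)
  qed
  have "(\<lambda>m. lower m x + ?d) \<longlonglongrightarrow> \<Phi> x + ?d" by (intro tendsto_intros lower_LIMSEQ)
  moreover have "\<forall>\<^sub>F m in sequentially. lower m x + ?d = lower m (\<tau> k x)"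
    using eq by (auto simp: eventually_sequentially intro!: exI[of _ n])
  ultimately have "(\<lambda>m. lower m (\<tau> k x)) \<longlonglongrightarrow> \<Phi> x + ?d" by (rule Lim_transform_eventually)
  then show ?thesis using LIMSEQ_unique[OF lower_LIMSEQ] by blast
qed

text \<open>At every stage the value \<open>t\<close> is compatible with at most two cells.\<close>
lemma AE_\<Phi>_neq: "AE x in M. \<Phi> x \<noteq> t"
proof -
  define I where "I n = {nat \<lfloor>t * 2 ^ e n\<rfloor>, nat \<lfloor>t * 2 ^ e n\<rfloor> - 1}" for n
  have sub: "i n x \<in> I n" if "\<Phi> x = t" for x n
  proof -
    have "lower n x \<le> t" "t \<le> lower n x + width n" using that lower_le_\<Phi>[of n x] \<Phi>_le_upper[of x n] by auto
    then have "real (i n x) \<le> t * 2 ^ e n" "t * 2 ^ e n \<le> real (i n x) + 1"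
      by (simp_all add: lower_def width_def field_simps)
    then have "int (i n x) \<le> \<lfloor>t * 2 ^ e n\<rfloor>" "\<lfloor>t * 2 ^ e n\<rfloor> \<le> int (i n x) + 1"
      by (simp_all add: le_floor_iff floor_le_iff)
    then show ?thesis unfolding I_def by auto
  qed
  have acI: "acont (\<lambda>x. i n x \<in> I n)" for n by (intro acont_mem acont_i)
  have m: "mass (\<lambda>x. i n x \<in> I n) \<le> ennreal (2 * width n)" for n
  proof -
    have "mass (\<lambda>x. \<exists>r\<in>I n. i n x = r) \<le> of_nat (card (I n)) * ennreal (width n)"
      using tower_mass[OF tower[of n]]
      by (intro mass_bex_le acont_eq acont_i acont_const) (auto simp: I_def width_def)
    also have "\<dots> \<le> of_nat 2 * ennreal (width n)"
      by (intro mult_right_mono of_nat_mono) (simp_all add: I_def card_insert_le_m1)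
    finally show ?thesis by (simp add: ennreal_mult' )
  qed
  have sets: "(\<Inter>n. {x. i n x \<in> I n}) \<in> sets M" using acont_sets[OF acI] by auto
  have "emeasure M (\<Inter>n. {x. i n x \<in> I n}) \<le> 0"
  proof (rule LIMSEQ_le_const)
    show "(\<lambda>n. ennreal (2 * width n)) \<longlonglongrightarrow> 0"
      using tendsto_ennrealI[OF tendsto_mult[OF tendsto_const[of 2] width_0]] by simp
    have "emeasure M (\<Inter>n. {x. i n x \<in> I n}) \<le> ennreal (2 * width n)" for n
      by (rule order_trans[OF emeasure_mono m]) (use acont_sets[OF acI] in auto)
    then show "\<exists>N. \<forall>n\<ge>N. emeasure M (\<Inter>n. {x. i n x \<in> I n}) \<le> ennreal (2 * width n)" by blast
  qed
  then have "(\<Inter>n. {x. i n x \<in> I n}) \<in> null_sets M" using sets by (auto simp: null_sets_def)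
  then show ?thesis by (rule AE_I') (use sub in auto)
qed

lemma gen_\<Phi>_neq: "generically (\<lambda>x. \<Phi> x \<noteq> t)"
proof (rule gen_limit_neq[where g = lower and \<delta> = width])
  show "acont (lower n)" for n unfolding lower_def[abs_def] by (rule acont_comp[OF acont_i])
qed (auto intro!: gen_all lower_le_\<Phi> \<Phi>_le_upper width_0 AE_\<Phi>_neq)

lemma gen_not_dyadic: "generically (\<lambda>x. \<forall>(k::int) (m::nat). \<Phi> x \<noteq> of_int k / 2 ^ m)"
  by (intro gen_all_countable gen_\<Phi>_neq)

text \<open>Borel-Cantelli; every point lies in the union of the first \<open>n\<close> cells of
  stage 0 for large \<open>n\<close>.\<close>
lemma gen_separated: "generically (\<lambda>x. \<forall>l. \<exists>n. l < n \<and> i (Suc n) x \<in> S n)"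
proof (rule gen_countable, rule acont_ex_gen)
  show "acont (\<lambda>x. l < n \<and> i (Suc n) x \<in> S n)" for l n by (intro acont_conj acont_const acont_mem acont_i)
  fix l
  have "AE x in M. \<forall>\<^sub>F n in sequentially. \<not> (i n x < n * 2 ^ e n \<and> i (Suc n) x \<notin> S n)"
  proof (rule AE_eventually_not)
    show "acont (\<lambda>x. i n x < n * 2 ^ e n \<and> i (Suc n) x \<notin> S n)" for n
      by (intro acont_conj acont_less acont_i acont_const acont_not acont_mem)
    show "mass (\<lambda>x. i n x < n * 2 ^ e n \<and> i (Suc n) x \<notin> S n) \<le> ennreal (1 * (1/2) ^ n)" for n
      using step[of n] unfolding good_step_def by simp
  qed simp
  then show "AE x in M. \<exists>n. l < n \<and> i (Suc n) x \<in> S n"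
  proof eventually_elim
    case (elim x)
    then obtain N where N: "\<And>n. n \<ge> N \<Longrightarrow> \<not> (i n x < n * 2 ^ e n \<and> i (Suc n) x \<notin> S n)"
      by (auto simp: eventually_sequentially)
    define n where "n = Suc (max N (max l (i 0 x)))"
    have n: "N \<le> n" "l < n" "i 0 x < n" by (auto simp: n_def)
    then have "i n x < n * 2 ^ e n" unfolding i_less_iff by simp
    then show ?case using N[OF n(1)] n(2) by blast
  qed
qed

lemma gen_joined_1: "generically (\<lambda>x. \<exists>n. joined n x 1)"
proof (rule acont_ex_gen)
  have acont_j: "acont (\<lambda>x. joined n x 1)" for n unfolding joined_def
    by (intro acont_eq acont_plus acont_const acont_c acont_shift[OF acont_c])
  show "acont (\<lambda>x. joined n x 1)" for n by (rule acont_j)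
  have "AE x in M. \<forall>\<^sub>F n in sequentially. \<not> (i n x < n * 2 ^ e n \<and> \<not> joined (Suc n) x 1)"
  proof (rule AE_eventually_not)
    show "acont (\<lambda>x. i n x < n * 2 ^ e n \<and> \<not> joined (Suc n) x 1)" for n
      by (intro acont_conj acont_less acont_i acont_const acont_not acont_j)
    show "mass (\<lambda>x. i n x < n * 2 ^ e n \<and> \<not> joined (Suc n) x 1) \<le> ennreal (3 * (1/2) ^ n)" for n
      using step[of n] unfolding good_step_def joined_def by simp
  qed simp
  then show "AE x in M. \<exists>n. joined n x 1"
  proof eventually_elim
    case (elim x)
    then obtain N where N: "\<And>n. n \<ge> N \<Longrightarrow> \<not> (i n x < n * 2 ^ e n \<and> \<not> joined (Suc n) x 1)"
      by (auto simp: eventually_sequentially)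
    define n where "n = Suc (max N (i 0 x))"
    have n: "N \<le> n" "i 0 x < n" by (auto simp: n_def)
    then have "i n x < n * 2 ^ e n" unfolding i_less_iff by simp
    then show ?case using N[OF n(1)] by blast
  qed
qed

text \<open>Being joined is transitive along an orbit once all the links hold at a common
  stage.\<close>
lemma gen_joined: "generically (\<lambda>x. \<forall>k. \<exists>n. joined n x k)"
  using gen_shift[OF gen_joined_1]
proof (rule gen_mono, intro allI)
  fix x k assume h: "\<forall>k. \<exists>n. joined n (\<tau> k x) 1"
  show "\<exists>n. joined n x k"
  proof (induction k rule: int_induct[where k = 0])
    case base
    show ?case by (simp add: joined_def)
  next
    case (step1 j)
    then obtain n where n: "joined n x j" by blast
    obtain m where m: "joined m (\<tau> j x) 1" using h by blast
    have "joined (max n m) x j" "joined (max n m) (\<tau> j x) 1"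
      using joined_mono[OF n, of "max n m"] joined_mono[OF m, of "max n m"] by auto
    then have "joined (max n m) x (j + 1)" by (simp add: joined_def add.commute del: tau_1)
    then show ?case by blast
  next
    case (step2 j)
    then obtain n where n: "joined n x j" by blast
    obtain m where m: "joined m (\<tau> (j - 1) x) 1" using h by blast
    have "joined (max n m) x j" "joined (max n m) (\<tau> (j - 1) x) 1"
      using joined_mono[OF n, of "max n m"] joined_mono[OF m, of "max n m"] by auto
    then have "joined (max n m) x (j - 1)" by (simp add: joined_def del: tau_1)
    then show ?case by blast
  qed
qed

lemma gen_cells_filled: "generically (\<lambda>x. \<forall>n r. \<exists>k. i n (\<tau> k x) = r \<and> joined n x k)"
proof (intro gen_countable)
  fix n r
  obtain d where d: "orbit_iso (c n) d (\<lambda>x. i n x = r) (A n)" using tower[of n] unfolding tower_def by blast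
  have "generically (\<lambda>x. \<forall>s. i n x = s \<longrightarrow> A n (\<tau> (c n x) x))"
  proof (rule gen_countable)
    fix s
    obtain d where d: "orbit_iso (c n) d (\<lambda>x. i n x = s) (A n)" using tower[of n] unfolding tower_def by blast
    show "generically (\<lambda>x. i n x = s \<longrightarrow> A n (\<tau> (c n x) x))" using orbit_isoD(3)[OF d] by (rule gen_mono) blast
  qed
  from gen_conj[OF this gen_shift[OF orbit_isoD(4)[OF d]]]
  show "generically (\<lambda>x. \<exists>k. i n (\<tau> k x) = r \<and> joined n x k)"
  proof (rule gen_mono)
    fix x assume h: "(\<forall>s. i n x = s \<longrightarrow> A n (\<tau> (c n x) x)) \<and>
      (\<forall>k. A n (\<tau> k x) \<longrightarrow> i n (\<tau> (d (\<tau> k x)) (\<tau> k x)) = r \<and> c n (\<tau> (d (\<tau> k x)) (\<tau> k x)) = - d (\<tau> k x))"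
    define y where "y = \<tau> (c n x) x"
    have "A n y" using h by (simp add: y_def)
    then have y: "i n (\<tau> (d y) y) = r" "c n (\<tau> (d y) y) = - d y" using h unfolding y_def by blast+
    have e: "\<tau> (d y) y = \<tau> (c n x + d y) x" by (simp add: y_def add.commute)
    show "\<exists>k. i n (\<tau> k x) = r \<and> joined n x k"
      by (rule exI[of _ "c n x + d y"]) (use y[unfolded e] in \<open>simp add: joined_def\<close>)
  qed
qed

lemma gen_labels: "generically (\<lambda>x. \<forall>n. i (Suc n) x \<in> S n \<longrightarrow> (\<forall>l<n. (x \<in> U l) = \<Gamma> n l (i (Suc n) x)))"
  by (rule gen_countable) (use step in \<open>simp add: good_step_def\<close>)

lemma mass_dyadic:
  assumes "m \<le> e n"
  shows "mass (\<lambda>x. i n x div 2 ^ (e n - m) = k) = ennreal (1 / 2 ^ m)"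
proof -
  define w where "w = (2::nat) ^ (e n - m)"
  have w: "w > 0" by (simp add: w_def)
  have div: "a div w = k \<longleftrightarrow> a \<in> {k * w..<Suc k * w}" for a
  proof
    assume "a div w = k"
    then show "a \<in> {k * w..<Suc k * w}"
      using div_times_less_eq_dividend[of a w] dividend_less_div_times[OF w, of a] by simp
  next
    assume "a \<in> {k * w..<Suc k * w}"
    then show "a div w = k" by (intro div_nat_eqI) (simp_all add: mult.commute)
  qed
  have "mass (\<lambda>x. i n x div w = k) = mass (\<lambda>x. True \<and> i n x \<in> {k * w..<Suc k * w})" unfolding div by simp
  also have "\<dots> = (\<Sum>r\<in>{k * w..<Suc k * w}. mass (\<lambda>x. True \<and> i n x = r))"
    by (intro mass_finite_sum acont_conj acont_const acont_eq acont_i) simp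
  also have "\<dots> = of_nat w * ennreal (1 / 2 ^ e n)"
    using tower_mass[OF tower[of n]] by simp
  also have "\<dots> = ennreal (real w / 2 ^ e n)"
    by (simp add: ennreal_of_nat_eq_real_of_nat ennreal_mult'[symmetric])
  also have "real w / 2 ^ e n = 1 / 2 ^ m"
  proof -
    have "(2::real) ^ e n = 2 ^ (e n - m) * 2 ^ m" using assms by (simp add: power_add[symmetric])
    then show ?thesis by (simp add: w_def)
  qed
  finally show ?thesis by (simp add: w_def)
qed

end

section \<open>Coding by dyadic classes\<close>

text \<open>That \<open>\<Phi>\<close> carries \<open>\<mu>\<close> to Lebesgue measure is required
  on dyadic intervals only. They may be taken open because dyadic values do not occur.\<close>
definition dyadic_coding :: "'a::topological_space measure \<Rightarrow> ('a \<Rightarrow> 'a) \<Rightarrow> 'a set \<Rightarrow> ('a \<Rightarrow> real) \<Rightarrow> bool" where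
  "dyadic_coding \<mu> T X \<Phi> \<longleftrightarrow> gdelta X \<and> T ` X = X \<and> full_measure \<mu> X \<and>
     (\<exists>\<Theta>. homeomorphism X (\<Phi> ` X) \<Phi> \<Theta>) \<and>
     (\<forall>x\<in>X. 0 < \<Phi> x) \<and> (\<forall>x\<in>X. \<forall>(k::int) m::nat. \<Phi> x \<noteq> of_int k / 2 ^ m) \<and>
     (\<forall>k m::nat. emeasure \<mu> {x\<in>X. real k / 2 ^ m < \<Phi> x \<and> \<Phi> x < (real k + 1) / 2 ^ m} = ennreal (1 / 2 ^ m)) \<and>
     (\<forall>x\<in>X. \<Phi> ` int_orbit T x = {y. 0 < y \<and> (\<exists>(k::int) m::nat. y = \<Phi> x + of_int k / 2 ^ m)})"

context tower_sequence
begin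

text \<open>On a common generic set \<open>X\<close> cells are preimages of open dyadic intervals.
  They shrink to points inside basic open sets, which gives injectivity and the continuity of the
  inverse. The image of an orbit is contained in a dyadic class because orbits get joined, and fills
  it because every cell contains a point joined to a given one.\<close>
lemma ex_dyadic_coding: "\<exists>X. dyadic_coding \<mu> T X \<Phi>"
proof -
  obtain G0 where G0: "generic G0" "\<And>n. loc_const G0 (i n)" using acont_common[of i] acont_i by blast
  have "generically (\<lambda>x. (\<forall>(k::int) (m::nat). \<Phi> x \<noteq> of_int k / 2 ^ m) \<and> (\<forall>l. \<exists>n. l < n \<and> i (Suc n) x \<in> S n) \<and>
     (\<forall>k. \<exists>n. joined n x k) \<and> (\<forall>n r. \<exists>k. i n (\<tau> k x) = r \<and> joined n x k) \<and>
     (\<forall>n. i (Suc n) x \<in> S n \<longrightarrow> (\<forall>l<n. (x \<in> U l) = \<Gamma> n l (i (Suc n) x))))"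
    by (intro gen_conj gen_not_dyadic gen_separated gen_joined gen_cells_filled gen_labels)
  then obtain G1 where G1: "generic G1" "\<And>x. x \<in> G1 \<Longrightarrow>
     (\<forall>(k::int) (m::nat). \<Phi> x \<noteq> of_int k / 2 ^ m) \<and> (\<forall>l. \<exists>n. l < n \<and> i (Suc n) x \<in> S n) \<and>
     (\<forall>k. \<exists>n. joined n x k) \<and> (\<forall>n r. \<exists>k. i n (\<tau> k x) = r \<and> joined n x k) \<and>
     (\<forall>n. i (Suc n) x \<in> S n \<longrightarrow> (\<forall>l<n. (x \<in> U l) = \<Gamma> n l (i (Suc n) x)))" by (rule genE) (rule that)
  define X where "X = G0 \<inter> G1"
  have X: "generic X" unfolding X_def by (rule generic_Int[OF G0(1) G1(1)])
  have XG: "gdelta X" "- X \<in> null_sets \<mu>" using X by (auto simp: generic_def)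
  have lc: "loc_const X (i n)" for n unfolding X_def using loc_const_mono[OF G0(2)] by blast
  have irr: "\<Phi> x \<noteq> of_int k / 2 ^ m" if "x \<in> X" for x and k :: int and m using that G1(2) by (simp add: X_def)
  have sep: "\<exists>n. l < n \<and> i (Suc n) x \<in> S n" if "x \<in> X" for x l using that G1(2) by (simp add: X_def)
  have joi: "\<exists>n. joined n x k" if "x \<in> X" for x k using that G1(2) by (simp add: X_def)
  have fil: "\<exists>k. i n (\<tau> k x) = r \<and> joined n x k" if "x \<in> X" for x n r using that G1(2) by (simp add: X_def)
  have lab: "(x \<in> U l) = \<Gamma> n l (i (Suc n) x)" if "x \<in> X" "i (Suc n) x \<in> S n" "l < n" for x n l
    using that G1(2) by (simp add: X_def)
  have pos: "0 < \<Phi> x" if "x \<in> X" for x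
  proof -
    have "0 \<le> lower 0 x" by (simp add: lower_def)
    then have "0 \<le> \<Phi> x" using lower_le_\<Phi>[of 0 x] by linarith
    moreover have "\<Phi> x \<noteq> 0" using irr[OF that, of 0 0] by simp
    ultimately show ?thesis by simp
  qed
  have strict: "lower n x < \<Phi> x" "\<Phi> x < lower n x + width n" if "x \<in> X" for x n
  proof -
    have "lower n x = of_int (int (i n x)) / 2 ^ e n" "lower n x + width n = of_int (int (i n x) + 1) / 2 ^ e n"
      by (simp_all add: lower_def width_def add_divide_distrib)
    then show "lower n x < \<Phi> x" "\<Phi> x < lower n x + width n"
      using irr[OF that] lower_le_\<Phi>[of n x] \<Phi>_le_upper[of x n] by (metis order_le_less)+
  qed
  have cell: "i n x = r \<longleftrightarrow> real r / 2 ^ e n < \<Phi> x \<and> \<Phi> x < (real r + 1) / 2 ^ e n" if x: "x \<in> X" for x n r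
  proof
    assume "i n x = r"
    then show "real r / 2 ^ e n < \<Phi> x \<and> \<Phi> x < (real r + 1) / 2 ^ e n"
      using strict[OF x, of n] by (auto simp: lower_def width_def add_divide_distrib)
  next
    assume h: "real r / 2 ^ e n < \<Phi> x \<and> \<Phi> x < (real r + 1) / 2 ^ e n"
    then have "real r / 2 ^ e n < (real (i n x) + 1) / 2 ^ e n" "real (i n x) / 2 ^ e n < (real r + 1) / 2 ^ e n"
      using strict[OF x, of n] by (auto simp: lower_def width_def add_divide_distrib)
    then have "real r < real (i n x) + 1" "real (i n x) < real r + 1" by (simp_all add: divide_less_cancel)
    then show "i n x = r" by linarith
  qed
  have nbhd: "\<exists>W. open W \<and> \<Phi> x \<in> W \<and> (\<forall>y\<in>X. \<Phi> y \<in> W \<longrightarrow> y \<in> V)" if x: "x \<in> X" and V: "open V" "x \<in> V" for x V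
  proof -
    obtain l where l: "x \<in> U l" "U l \<subseteq> V" using base[OF V] by blast
    obtain n where n: "l < n" "i (Suc n) x \<in> S n" using sep[OF x] by blast
    define r where "r = i (Suc n) x"
    let ?W = "{real r / 2 ^ e (Suc n)<..<(real r + 1) / 2 ^ e (Suc n)}"
    have "y \<in> V" if y: "y \<in> X" "\<Phi> y \<in> ?W" for y
    proof -
      have "i (Suc n) y = i (Suc n) x" using cell[OF y(1), of "Suc n" r] y(2) by (simp add: r_def)
      then have "y \<in> U l" using lab[OF x n(2,1)] lab[OF y(1) _ n(1)] n(2) l(1) by simp
      then show ?thesis using l(2) by blast
    qed
    moreover have "\<Phi> x \<in> ?W" using cell[OF x, of "Suc n" r] by (simp add: r_def)
    ultimately show ?thesis by (intro exI[of _ ?W]) auto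
  qed
  have inj: "inj_on \<Phi> X"
  proof (rule inj_onI, rule ccontr)
    fix x y assume xy: "x \<in> X" "y \<in> X" "\<Phi> x = \<Phi> y" "x \<noteq> y"
    obtain V where "open V" "x \<in> V" "y \<notin> V" using t1_space[OF xy(4)] by blast
    then show False using nbhd[OF xy(1)] xy by metis
  qed
  have contX: "continuous_on X \<Phi>"
    unfolding continuous_on_topological
  proof (intro ballI allI impI)
    fix x B assume x: "x \<in> X" and B: "open B" "\<Phi> x \<in> B"
    obtain \<epsilon> where \<epsilon>: "\<epsilon> > 0" "ball (\<Phi> x) \<epsilon> \<subseteq> B" using B open_contains_ball by metis
    obtain n where n: "width n < \<epsilon>"
      using order_tendstoD(2)[OF width_0 \<epsilon>(1)] by (auto dest: eventually_happens)
    obtain V where V: "open V" "x \<in> V" "\<forall>y\<in>V \<inter> X. i n y = i n x" using lc[of n] x unfolding loc_const_def by blast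
    have "\<Phi> y \<in> B" if "y \<in> X" "y \<in> V" for y
    proof -
      have "lower n y = lower n x" using V(3) that by (simp add: lower_def)
      then have "dist (\<Phi> x) (\<Phi> y) < \<epsilon>"
        using lower_le_\<Phi>[of n x] \<Phi>_le_upper[of x n] lower_le_\<Phi>[of n y] \<Phi>_le_upper[of y n] n
        by (simp add: dist_real_def)
      then show ?thesis using \<epsilon>(2) by auto
    qed
    then show "\<exists>A. open A \<and> x \<in> A \<and> (\<forall>y\<in>X. y \<in> A \<longrightarrow> \<Phi> y \<in> B)" using V by blast
  qed
  have contI: "continuous_on (\<Phi> ` X) (inv_into X \<Phi>)"
    unfolding continuous_on_topological
  proof (intro ballI allI impI)
    fix z B assume z: "z \<in> \<Phi> ` X" and B: "open B" "inv_into X \<Phi> z \<in> B"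
    then obtain x where x: "x \<in> X" "z = \<Phi> x" by blast
    then have ix: "inv_into X \<Phi> z = x" using inj by simp
    obtain W where W: "open W" "\<Phi> x \<in> W" "\<forall>y\<in>X. \<Phi> y \<in> W \<longrightarrow> y \<in> B" using nbhd[OF x(1) B(1)] B(2) ix by auto
    then show "\<exists>A. open A \<and> z \<in> A \<and> (\<forall>y\<in>\<Phi> ` X. y \<in> A \<longrightarrow> inv_into X \<Phi> y \<in> B)"
      using inj x(2) by (intro exI[of _ W]) auto
  qed
  have hom: "homeomorphism X (\<Phi> ` X) \<Phi> (inv_into X \<Phi>)"
    using inj contX contI by (intro homeomorphismI) (auto simp: inv_into_into f_inv_into_f)
  have Xsets: "X \<in> sets \<mu>"
  proof -
    have "- (- X) \<in> sets \<mu>" using XG(2) sets.compl_sets[of "- X" \<mu>] by (auto simp: Compl_eq_Diff_UNIV)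
    then show ?thesis by simp
  qed
  have meas: "emeasure \<mu> {x\<in>X. real k / 2 ^ m < \<Phi> x \<and> \<Phi> x < (real k + 1) / 2 ^ m} = ennreal (1 / 2 ^ m)" for k m :: nat
  proof -
    define E where "E = {x\<in>X. real k / 2 ^ m < \<Phi> x \<and> \<Phi> x < (real k + 1) / 2 ^ m}"
    define w where "w = (2::nat) ^ (e m - m)"
    have w: "(2::real) ^ e m = real w * 2 ^ m" "w > 0" using e_ge[of m] by (simp_all add: w_def power_add[symmetric])
    obtain O' where O': "open O'" "O' \<inter> X = \<Phi> -` {real k / 2 ^ m<..<(real k + 1) / 2 ^ m} \<inter> X"
      using contX[unfolded continuous_on_open_invariant, rule_format, OF open_greaterThanLessThan] by blast
    have "E = O' \<inter> X" unfolding O'(2) by (auto simp: E_def)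
    then have Es: "E \<in> sets \<mu>" using Xsets O'(1) sets_mu by auto
    have "emeasure \<mu> E = emeasure M E" using Es by simp
    also have "\<dots> = mass (\<lambda>x. i m x div w = k)"
    proof (rule emeasure_eq_AE)
      have "AE x in M. x \<in> X" by (rule gen_AE) (use X in \<open>auto simp: generically_def\<close>)
      then show "AE x in M. x \<in> E \<longleftrightarrow> x \<in> {x. i m x div w = k}"
      proof eventually_elim
        case (elim x)
        have "i m x div w = k \<longleftrightarrow> real k / 2 ^ m < \<Phi> x \<and> \<Phi> x < (real k + 1) / 2 ^ m"
        proof
          assume h: "i m x div w = k"
          have "k * w \<le> i m x" "i m x + 1 \<le> (k + 1) * w"
            using div_times_less_eq_dividend[of "i m x" w] dividend_less_div_times[OF w(2), of "i m x"] h by simp_all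
          then have "real (k * w) \<le> real (i m x)" "real (i m x + 1) \<le> real ((k + 1) * w)" by (metis of_nat_mono)+
          then have "real k * real w \<le> real (i m x)" "real (i m x) + 1 \<le> (real k + 1) * real w" by (simp_all add: algebra_simps)
          then have "real k * real w / 2 ^ e m \<le> lower m x" "lower m x + width m \<le> (real k + 1) * real w / 2 ^ e m"
            unfolding lower_def width_def add_divide_distrib[symmetric] by (auto intro: divide_right_mono)
          then have "real k / 2 ^ m \<le> lower m x" "lower m x + width m \<le> (real k + 1) / 2 ^ m"
            using w by simp_all
          then show "real k / 2 ^ m < \<Phi> x \<and> \<Phi> x < (real k + 1) / 2 ^ m" using strict[OF elim, of m] by linarith
        next
          assume h: "real k / 2 ^ m < \<Phi> x \<and> \<Phi> x < (real k + 1) / 2 ^ m"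
          then have "real k / 2 ^ m < lower m x + width m" "lower m x < (real k + 1) / 2 ^ m"
            using strict[OF elim, of m] by linarith+
          moreover have "real k / 2 ^ m = real k * real w / 2 ^ e m" "(real k + 1) / 2 ^ m = (real k + 1) * real w / 2 ^ e m"
            using w by simp_all
          ultimately have "real k * real w < real (i m x) + 1" "real (i m x) < (real k + 1) * real w"
            unfolding lower_def width_def add_divide_distrib[symmetric] by (simp_all add: divide_less_cancel)
          then have "real (k * w) < real (i m x + 1)" "real (i m x) < real ((k + 1) * w)" by (simp_all add: algebra_simps)
          then have "k * w < i m x + 1" "i m x < (k + 1) * w" by (metis of_nat_less_iff)+
          then show "i m x div w = k" by (intro div_nat_eqI) (simp_all add: algebra_simps)
        qed
        then show ?case using elim by (simp add: E_def)
      qed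
      show "E \<in> sets M" using Es by auto
      show "{x. i m x div w = k} \<in> sets M" by (intro acont_sets acont_eq acont_const acont_comp[OF acont_i])
    qed
    also have "\<dots> = ennreal (1 / 2 ^ m)" unfolding w_def by (rule mass_dyadic[OF e_ge])
    finally show ?thesis unfolding E_def .
  qed
  have orb: "\<Phi> ` int_orbit T x = {y. 0 < y \<and> (\<exists>(k::int) m::nat. y = \<Phi> x + of_int k / 2 ^ m)}" if x: "x \<in> X" for x
  proof (intro equalityI subsetI)
    fix y assume "y \<in> \<Phi> ` int_orbit T x"
    then obtain k where k: "y = \<Phi> (\<tau> k x)" unfolding int_orbit_def by blast
    obtain n where n: "joined n x k" using joi[OF x] by blast
    have "y = \<Phi> x + of_int (int (i n (\<tau> k x)) - int (i n x)) / 2 ^ e n" unfolding k joined_\<Phi>[OF n] by simp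
    moreover have "0 < y" unfolding k by (rule pos) (simp add: generic_tau[OF X] x)
    ultimately show "y \<in> {y. 0 < y \<and> (\<exists>(k::int) m::nat. y = \<Phi> x + of_int k / 2 ^ m)}" by blast
  next
    fix y assume "y \<in> {y. 0 < y \<and> (\<exists>(k::int) m::nat. y = \<Phi> x + of_int k / 2 ^ m)}"
    then obtain k :: int and m :: nat where y: "0 < y" "y = \<Phi> x + of_int k / 2 ^ m" by blast
    define J where "J = int (i m x) + k * 2 ^ (e m - m)"
    have E: "(2::real) ^ e m = 2 ^ (e m - m) * 2 ^ m" using e_ge[of m] by (simp add: power_add[symmetric])
    have kE: "of_int k / 2 ^ m = of_int (k * 2 ^ (e m - m)) / (2::real) ^ e m" unfolding E by simp
    have "y < lower m x + width m + of_int k / 2 ^ m" using strict[OF x, of m] y(2) by simp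
    also have "\<dots> = (of_int J + 1) / 2 ^ e m" unfolding kE J_def lower_def width_def by (simp add: add_divide_distrib)
    finally have "0 < (of_int J + 1) / (2::real) ^ e m" using y(1) by linarith
    then have "0 < (of_int (J + 1) :: real)" by (simp add: zero_less_divide_iff)
    then have J: "0 \<le> J" by linarith
    obtain l where l: "i m (\<tau> l x) = nat J" "joined m x l" using fil[OF x] by blast
    have "\<Phi> (\<tau> l x) = \<Phi> x + (of_int J - real (i m x)) / 2 ^ e m" unfolding joined_\<Phi>[OF l(2)] l(1) using J by simp
    also have "(of_int J - real (i m x)) / 2 ^ e m = of_int k / 2 ^ m" unfolding kE J_def by simp
    finally have "y = \<Phi> (\<tau> l x)" using y(2) by simp
    then show "y \<in> \<Phi> ` int_orbit T x" unfolding int_orbit_def by blast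
  qed
  have inv: "T ` X = X"
  proof
    show "T ` X \<subseteq> X" using generic_tau[OF X, of 1] by auto
    show "X \<subseteq> T ` X"
    proof
      fix x assume "x \<in> X"
      then have "\<tau> (- 1) x \<in> X" using generic_tau[OF X] by blast
      moreover have "T (\<tau> (- 1) x) = x" using int_iterate_1_add[OF bij_T, of "- 1" x] by simp
      ultimately show "x \<in> T ` X" by (metis imageI)
    qed
  qed
  have full: "full_measure \<mu> X" using XG(2) by (simp add: full_measure_def Compl_eq_Diff_UNIV)
  have "dyadic_coding \<mu> T X \<Phi>"
    unfolding dyadic_coding_def
  proof (intro conjI ballI allI)
    show "gdelta X" "T ` X = X" "full_measure \<mu> X" by (fact XG(1) inv full)+
    show "\<exists>\<Theta>. homeomorphism X (\<Phi> ` X) \<Phi> \<Theta>" using hom by blast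
    show "0 < \<Phi> x" if "x \<in> X" for x using that by (rule pos)
    show "\<Phi> x \<noteq> of_int k / 2 ^ m" if "x \<in> X" for x and k :: int and m :: nat using that by (rule irr)
    show "emeasure \<mu> {x\<in>X. real k / 2 ^ m < \<Phi> x \<and> \<Phi> x < (real k + 1) / 2 ^ m} = ennreal (1 / 2 ^ m)" for k m :: nat
      by (rule meas)
    show "\<Phi> ` int_orbit T x = {y. 0 < y \<and> (\<exists>(k::int) m::nat. y = \<Phi> x + of_int k / 2 ^ m)}" if "x \<in> X" for x
      using that by (rule orb)
  qed
  then show ?thesis by blast
qed

end

theorem (in polish_ergodic) ex_coding: "\<exists>X \<Phi>. dyadic_coding \<mu> T X \<Phi>"
proof -
  obtain U :: "nat \<Rightarrow> 'a set" where U: "\<And>l. open (U l)" "\<And>l. acont (\<lambda>x. x \<in> U l)"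
    "\<And>x V. open V \<Longrightarrow> x \<in> V \<Longrightarrow> \<exists>l. x \<in> U l \<and> U l \<subseteq> V"
    using ex_acont_base by blast
  define P where "P n s \<longleftrightarrow> (case s of (e, c, i, A) \<Rightarrow> tower e c i A \<and> (n = 0 \<longrightarrow> e = 0))"
    for n :: nat and s :: "nat \<times> ('a \<Rightarrow> int) \<times> ('a \<Rightarrow> nat) \<times> ('a \<Rightarrow> bool)"
  define Q where "Q n s s' \<longleftrightarrow> (case s of (e, c, i, A) \<Rightarrow> case s' of (e', c', i', A') \<Rightarrow>
      \<exists>S \<Gamma>. good_step U n e c i e' c' i' S \<Gamma>)"
    for n :: nat and s s' :: "nat \<times> ('a \<Rightarrow> int) \<times> ('a \<Rightarrow> nat) \<times> ('a \<Rightarrow> bool)"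
  have "\<exists>f. \<forall>n. P n (f n) \<and> Q n (f n) (f (Suc n))"
  proof (rule dependent_nat_choice)
    obtain c i A where "tower 0 c i A" using tower_0 by blast
    then have "P 0 (0, c, i, A)" by (simp add: P_def)
    then show "\<exists>s. P 0 s" by blast
    fix s n assume "P n s"
    moreover obtain e c i A where s: "s = (e, c, i, A)" by (cases s) auto
    ultimately have "tower e c i A" by (simp add: P_def)
    from ex_good_step[where U = U and n = n, OF U(2) this] obtain e' c' i' A' S \<Gamma> where
      "tower e' c' i' A'" "good_step U n e c i e' c' i' S \<Gamma>" by blast
    then have "P (Suc n) (e', c', i', A')" "Q n s (e', c', i', A')" unfolding P_def Q_def s by auto
    then show "\<exists>s'. P (Suc n) s' \<and> Q n s s'" by blast
  qed
  then obtain f where f: "\<And>n. P n (f n)" "\<And>n. Q n (f n) (f (Suc n))" by blast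
  define e where "e n = fst (f n)" for n
  define c where "c n = fst (snd (f n))" for n
  define i where "i n = fst (snd (snd (f n)))" for n
  define A where "A n = snd (snd (snd (f n)))" for n
  have tw: "tower (e n) (c n) (i n) (A n)" "e 0 = 0" for n
    using f(1)[of n] f(1)[of 0] by (auto simp: P_def e_def c_def i_def A_def split: prod.splits)
  have "\<exists>p. good_step U n (e n) (c n) (i n) (e (Suc n)) (c (Suc n)) (i (Suc n)) (fst p) (snd p)" for n
    using f(2)[of n] by (auto simp: Q_def e_def c_def i_def split: prod.splits)
  from choice[OF allI, OF this] obtain p where
    "\<forall>n. good_step U n (e n) (c n) (i n) (e (Suc n)) (c (Suc n)) (i (Suc n)) (fst (p n)) (snd (p n))" by (rule exE)
  then interpret tower_sequence \<mu> T U e c i A "\<lambda>n. fst (p n)" "\<lambda>n. snd (p n)"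
    by unfold_locales (use U(3) tw in simp_all)
  show ?thesis using ex_dyadic_coding by blast
qed

section \<open>Comparing two codings\<close>

lemma gdelta_in_euclidean: "gdelta_in euclidean S \<longleftrightarrow> gdelta S"
proof
  assume "gdelta_in euclidean S"
  then obtain C :: "nat \<Rightarrow> 'a set" where "\<And>n. open (C n)" "\<Inter>(range C) = S"
    unfolding gdelta_in_descending by auto
  then show "gdelta S" using gdelta.intros by blast
next
  assume "gdelta S"
  then obtain F :: "nat \<Rightarrow> 'a set" where F: "\<And>n. open (F n)" "S = \<Inter>(range F)" by (auto simp: gdelta.simps)
  show "gdelta_in euclidean S" unfolding gdelta_in_descending
  proof (intro exI conjI allI)
    show "openin euclidean (\<Inter>k\<le>n. F k)" for n using F(1) by (auto intro!: open_INT)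
    show "(\<Inter>k\<le>Suc n. F k) \<subseteq> (\<Inter>k\<le>n. F k)" for n by auto
    show "\<Inter>(range (\<lambda>n. \<Inter>k\<le>n. F k)) = S" unfolding F(2) by auto
  qed
qed

text \<open>A subset of a Polish space is \<open>G\<^sub>\<delta>\<close> exactly if it is
  completely metrizable, which does not depend on the surrounding space.\<close>
lemma gdelta_homeomorphic_image:
  fixes X :: "'a::polish_space set" and Y :: "'b::polish_space set"
  assumes "homeomorphism X Y f g" "gdelta X" shows "gdelta Y"
proof -
  have "completely_metrizable_space (top_of_set X)"
    using assms(2) completely_metrizable_space_eq_gdelta_in[OF completely_metrizable_space_euclidean, of X]
    by (simp add: gdelta_in_euclidean)
  moreover have "homeomorphic_maps (top_of_set X) (top_of_set Y) f g"
    using assms(1) by (auto simp: homeomorphic_maps_def homeomorphism_def)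
  then have "top_of_set X homeomorphic_space top_of_set Y"
    unfolding homeomorphic_space_def by (intro exI)
  ultimately have "completely_metrizable_space (top_of_set Y)"
    using homeomorphic_completely_metrizable_space by blast
  then show ?thesis
    using completely_metrizable_space_eq_gdelta_in[OF completely_metrizable_space_euclidean, of Y]
    by (simp add: gdelta_in_euclidean)
qed

lemma gdelta_vimage:
  assumes "gdelta X" "continuous_on X f" "gdelta Z" shows "gdelta {x\<in>X. f x \<in> Z}"
proof -
  obtain F :: "nat \<Rightarrow> 'a set" where F: "\<And>n. open (F n)" "X = \<Inter>(range F)" using assms(1) by (auto simp: gdelta.simps)
  obtain W :: "nat \<Rightarrow> 'b set" where W: "\<And>n. open (W n)" "Z = \<Inter>(range W)" using assms(3) by (auto simp: gdelta.simps)
  have "\<forall>n. \<exists>A. open A \<and> A \<inter> X = f -` W n \<inter> X"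
    using assms(2) W(1) unfolding continuous_on_open_invariant by blast
  from choice[OF this] obtain A where "\<forall>n. open (A n) \<and> A n \<inter> X = f -` W n \<inter> X" by (rule exE)
  then have A: "\<And>n. open (A n)" "\<And>n. A n \<inter> X = f -` W n \<inter> X" by simp_all
  have AW: "x \<in> A n \<longleftrightarrow> f x \<in> W n" if "x \<in> X" for x n using A(2)[of n] that by blast
  have "{x\<in>X. f x \<in> Z} = \<Inter>(range (\<lambda>n. F n \<inter> A n))"
  proof (intro equalityI subsetI)
    fix x assume "x \<in> {x\<in>X. f x \<in> Z}"
    then show "x \<in> \<Inter>(range (\<lambda>n. F n \<inter> A n))" using AW[of x] F(2) W(2) by simp
  next
    fix x assume x: "x \<in> \<Inter>(range (\<lambda>n. F n \<inter> A n))"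
    then have "x \<in> X" by (simp add: F(2))
    then show "x \<in> {x\<in>X. f x \<in> Z}" using AW[of x] x W(2) by simp
  qed
  moreover have "gdelta \<dots>" by (rule gdelta.intros) (use F A in auto)
  ultimately show ?thesis by simp
qed

lemma gdelta_borel: "gdelta S \<Longrightarrow> S \<in> sets borel"
  by (auto simp: gdelta.simps intro!: sets.countable_INT)

lemma coding_measurable:
  assumes "dyadic_coding \<mu> T X \<Phi>" "sets \<mu> = sets borel"
  shows "X \<in> sets \<mu>" "\<Phi> \<in> borel_measurable (restrict_space \<mu> X)" "B \<in> sets borel \<Longrightarrow> {x\<in>X. \<Phi> x \<in> B} \<in> sets \<mu>"
proof -
  show X: "X \<in> sets \<mu>" using assms gdelta_borel by (auto simp: dyadic_coding_def)
  have "continuous_on X \<Phi>" using assms(1) by (auto simp: dyadic_coding_def homeomorphism_def)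
  then have "\<Phi> \<in> borel_measurable (restrict_space borel X)" by (rule borel_measurable_continuous_on_restrict)
  then show m: "\<Phi> \<in> borel_measurable (restrict_space \<mu> X)"
    using measurable_cong_sets[OF sets_restrict_space_cong[OF assms(2)] refl] by blast
  assume "B \<in> sets borel"
  then have "\<Phi> -` B \<inter> space (restrict_space \<mu> X) \<in> sets (restrict_space \<mu> X)" by (rule measurable_sets[OF m])
  then show "{x\<in>X. \<Phi> x \<in> B} \<in> sets \<mu>"
    using X sets_eq_imp_space_eq[OF assms(2)]
    by (auto simp: sets_restrict_space_iff space_restrict_space Int_def vimage_def conj_commute)
qed

text \<open>For dyadic \<open>t\<close> by adding up dyadic intervals; in general by squeezing
  \<open>t\<close> between dyadic numbers.\<close>
lemma coding_below:
  assumes c: "dyadic_coding \<mu> T X \<Phi>" and s: "sets \<mu> = sets borel"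
  shows "emeasure \<mu> {x\<in>X. \<Phi> x < t} = ennreal t"
proof -
  note meas = coding_measurable[OF c s]
  have pos: "\<And>x. x \<in> X \<Longrightarrow> 0 < \<Phi> x" and irr: "\<And>x k m. x \<in> X \<Longrightarrow> \<Phi> x \<noteq> of_int k / 2 ^ (m::nat)"
    and unit: "\<And>k m. emeasure \<mu> {x\<in>X. real k / 2 ^ m < \<Phi> x \<and> \<Phi> x < (real k + 1) / 2 ^ (m::nat)} = ennreal (1 / 2 ^ m)"
    using c unfolding dyadic_coding_def by auto
  have dy: "emeasure \<mu> {x\<in>X. \<Phi> x < real k / 2 ^ m} = ennreal (real k / 2 ^ m)" for k m :: nat
  proof (induction k)
    case 0
    have e: "{x\<in>X. \<Phi> x < 0} = {}" using pos by (auto simp: not_less less_imp_le)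
    have z: "real 0 / 2 ^ m = 0" by simp
    show ?case unfolding z e by simp
  next
    case (Suc k)
    let ?A = "{x\<in>X. \<Phi> x < real k / 2 ^ m}" and ?B = "{x\<in>X. real k / 2 ^ m < \<Phi> x \<and> \<Phi> x < (real k + 1) / 2 ^ m}"
    have le: "real k / 2 ^ m \<le> (real k + 1) / 2 ^ m" by (simp add: divide_right_mono)
    have "{x\<in>X. \<Phi> x < real (Suc k) / 2 ^ m} = ?A \<union> ?B"
      using irr[of _ "int k" m] le by (auto simp: add.commute neq_iff)
    moreover have "emeasure \<mu> (?A \<union> ?B) = emeasure \<mu> ?A + emeasure \<mu> ?B"
    proof (rule plus_emeasure[symmetric])
      show "?A \<in> sets \<mu>" using meas(3)[of "{..<real k / 2 ^ m}"] by simp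
      show "?B \<in> sets \<mu>" using meas(3)[of "{real k / 2 ^ m<..<(real k + 1) / 2 ^ m}"] by simp
    qed auto
    ultimately show ?case using Suc unit[of k m]
      by (simp add: ennreal_plus[symmetric] add_divide_distrib[symmetric] add.commute del: ennreal_plus)
  qed
  show ?thesis
  proof (cases "t > 0")
    case False
    then have e: "{x\<in>X. \<Phi> x < t} = {}" using pos by force
    show ?thesis unfolding e using False by (simp add: ennreal_neg)
  next
    case True
    define F where "F = emeasure \<mu> {x\<in>X. \<Phi> x < t}"
    have m1: "{x\<in>X. \<Phi> x < u} \<in> sets \<mu>" for u using meas(3)[of "{..<u}"] by simp
    have bd: "ennreal (t - 1 / 2 ^ m) \<le> F \<and> F \<le> ennreal (t + 1 / 2 ^ m)" for m :: nat
    proof -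
      define k where "k = nat \<lfloor>t * 2 ^ m\<rfloor>"
      have "real k = of_int \<lfloor>t * 2 ^ m\<rfloor>" using True by (simp add: k_def)
      then have "real k \<le> t * 2 ^ m" "t * 2 ^ m < real k + 1" by linarith+
      then have k: "real k / 2 ^ m \<le> t" "t \<le> real (Suc k) / 2 ^ m" by (simp_all add: field_simps)
      have k2: "real (Suc k) / 2 ^ m = real k / 2 ^ m + 1 / 2 ^ m" by (simp add: add_divide_distrib)
      have "ennreal (t - 1 / 2 ^ m) \<le> ennreal (real k / 2 ^ m)" using k k2 by (intro ennreal_leI) simp
      also have "\<dots> \<le> F" unfolding F_def dy[symmetric] by (rule emeasure_mono[OF _ m1]) (use k in auto)
      finally have "ennreal (t - 1 / 2 ^ m) \<le> F" .
      moreover have "F \<le> ennreal (real (Suc k) / 2 ^ m)"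
        unfolding F_def dy[symmetric] by (rule emeasure_mono[OF _ m1]) (use k in auto)
      moreover have "\<dots> \<le> ennreal (t + 1 / 2 ^ m)" using k k2 by (intro ennreal_leI) simp
      ultimately show ?thesis by (meson order_trans)
    qed
    have lim: "(\<lambda>m. 1 / (2::real) ^ m) \<longlonglongrightarrow> 0" using LIMSEQ_realpow_zero[of "1/2::real"] by (simp add: power_one_over)
    have "F \<le> ennreal t"
    proof (rule LIMSEQ_le_const)
      show "(\<lambda>m. ennreal (t + 1 / 2 ^ m)) \<longlonglongrightarrow> ennreal t"
        using tendsto_ennrealI[OF tendsto_add[OF tendsto_const[of t] lim]] by simp
    qed (use bd in blast)
    moreover have "ennreal t \<le> F"
    proof (rule LIMSEQ_le_const2)
      show "(\<lambda>m. ennreal (t - 1 / 2 ^ m)) \<longlonglongrightarrow> ennreal t"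
        using tendsto_ennrealI[OF tendsto_diff[OF tendsto_const[of t] lim]] by simp
    qed (use bd in blast)
    ultimately show ?thesis by (simp add: F_def)
  qed
qed

text \<open>The reflection turns the sets \<open>{..<t}\<close>, which have finite measure, into the
  upper intervals that determine a measure on the line.\<close>
lemma coding_same_law:
  assumes c: "dyadic_coding \<mu> T X \<Phi>" and s: "sets \<mu> = sets borel"
    and d: "dyadic_coding \<nu> S Y \<Psi>" and r: "sets \<nu> = sets borel" and B: "B \<in> sets borel"
  shows "emeasure \<mu> {x\<in>X. \<Phi> x \<in> B} = emeasure \<nu> {y\<in>Y. \<Psi> y \<in> B}"
proof -
  note cm = coding_measurable[OF c s] and dm = coding_measurable[OF d r]
  define N1 where "N1 = distr (restrict_space \<mu> X) borel (\<lambda>x. - \<Phi> x)"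
  define N2 where "N2 = distr (restrict_space \<nu> Y) borel (\<lambda>y. - \<Psi> y)"
  have N1: "emeasure N1 C = emeasure \<mu> {x\<in>X. - \<Phi> x \<in> C}" if "C \<in> sets borel" for C
    unfolding N1_def using that cm(1,2) sets_eq_imp_space_eq[OF s]
    by (subst emeasure_distr) (auto simp: emeasure_restrict_space space_restrict_space vimage_def Int_def conj_commute)
  have N2: "emeasure N2 C = emeasure \<nu> {x\<in>Y. - \<Psi> x \<in> C}" if "C \<in> sets borel" for C
    unfolding N2_def using that dm(1,2) sets_eq_imp_space_eq[OF r]
    by (subst emeasure_distr) (auto simp: emeasure_restrict_space space_restrict_space vimage_def Int_def conj_commute)
  have t1: "emeasure N1 {t<..} = ennreal (- t)" for t
  proof -
    have "{x\<in>X. - \<Phi> x \<in> {t<..}} = {x\<in>X. \<Phi> x < - t}" by auto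
    then show ?thesis using N1[of "{t<..}"] coding_below[OF c s, of "- t"] by simp
  qed
  have t2: "emeasure N2 {t<..} = ennreal (- t)" for t
  proof -
    have "{x\<in>Y. - \<Psi> x \<in> {t<..}} = {x\<in>Y. \<Psi> x < - t}" by auto
    then show ?thesis using N2[of "{t<..}"] coding_below[OF d r, of "- t"] by simp
  qed
  have eq: "N1 = N2"
    by (rule measure_eqI_lessThan) (auto simp: N1_def[THEN arg_cong[where f = sets]] N2_def[THEN arg_cong[where f = sets]] t1 t2)
  have "(\<lambda>z::real. - z) \<in> borel_measurable borel" by measurable
  then have C: "uminus -` B \<in> sets borel" using measurable_sets[OF _ B, of "\<lambda>z. - z" borel] by simp
  show ?thesis using N1[OF C] N2[OF C] eq by simp
qed

lemma int_orbit_subset: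
  assumes "bij T" "T ` X = X" "x \<in> X" shows "int_orbit T x \<subseteq> X"
proof -
  have T: "T y \<in> X \<longleftrightarrow> y \<in> X" for y
    using assms(1,2) by (metis bij_is_inj image_iff inj_eq)
  have "int_iterate T k x \<in> X" for k
  proof (induction k rule: int_induct[where k = 0])
    case base show ?case using assms(3) by (simp add: int_iterate_def)
  next
    case (step1 i)
    then show ?case using int_iterate_1_add[OF assms(1), of i x] T by (simp add: add.commute)
  next
    case (step2 i)
    then show ?case using int_iterate_1_add[OF assms(1), of "i - 1" x] T by simp
  qed
  then show ?thesis unfolding int_orbit_def by blast
qed

lemma invariant_if_orbit_closed:
  assumes "bij T" "\<And>x. x \<in> X \<Longrightarrow> int_orbit T x \<subseteq> X" shows "T ` X = X"
proof
  have mem: "int_iterate T k x \<in> X" if "x \<in> X" for x k using assms(2)[OF that] by (auto simp: int_orbit_def)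
  have one: "int_iterate T 1 x = T x" for x by (simp add: int_iterate_def)
  show "T ` X \<subseteq> X" using mem[of _ 1] by (auto simp: one)
  show "X \<subseteq> T ` X"
  proof
    fix x assume x: "x \<in> X"
    have "T (int_iterate T (- 1) x) = x"
      using int_iterate_1_add[OF assms(1), of "- 1" x] by (simp add: int_iterate_def)
    then show "x \<in> T ` X" using mem[OF x, of "- 1"] by (metis imageI)
  qed
qed

text \<open>The set of points whose code occurs in \<open>Y\<close> is invariant since dyadic
  classes match, and conull since the set of missing codes is null for the common law.\<close>
lemma coding_domain:
  fixes \<mu> :: "'a::polish_space measure" and \<nu> :: "'b::polish_space measure"
  assumes c: "dyadic_coding \<mu> T X \<Phi>" and s: "sets \<mu> = sets borel" and T: "bij T"
    and d: "dyadic_coding \<nu> S Y \<Psi>" and r: "sets \<nu> = sets borel" and S: "bij S"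
  defines "X' \<equiv> {x\<in>X. \<Phi> x \<in> \<Psi> ` Y}"
  shows "gdelta X'" "T ` X' = X'" "full_measure \<mu> X'"
proof -
  obtain \<Theta> where \<Theta>: "homeomorphism Y (\<Psi> ` Y) \<Psi> \<Theta>" using d by (auto simp: dyadic_coding_def)
  have gY: "gdelta (\<Psi> ` Y)" using gdelta_homeomorphic_image[OF \<Theta>] d by (simp add: dyadic_coding_def)
  have cX: "continuous_on X \<Phi>" using c by (auto simp: dyadic_coding_def homeomorphism_def)
  show "gdelta X'" unfolding X'_def using c by (intro gdelta_vimage cX gY) (simp add: dyadic_coding_def)
  show "T ` X' = X'"
  proof (rule invariant_if_orbit_closed[OF T])
    fix x assume "x \<in> X'"
    then obtain y where x: "x \<in> X" and y: "y \<in> Y" "\<Phi> x = \<Psi> y" by (auto simp: X'_def)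
    have "\<Phi> ` int_orbit T x = \<Psi> ` int_orbit S y" using c d x y by (simp add: dyadic_coding_def)
    moreover have "int_orbit T x \<subseteq> X"
      using c by (intro int_orbit_subset[OF T _ x]) (simp add: dyadic_coding_def)
    moreover have "int_orbit S y \<subseteq> Y"
      using d by (intro int_orbit_subset[OF S _ y(1)]) (simp add: dyadic_coding_def)
    ultimately show "int_orbit T x \<subseteq> X'" unfolding X'_def by blast
  qed
  have B: "- \<Psi> ` Y \<in> sets borel" using gdelta_borel[OF gY] by auto
  have "emeasure \<mu> {x\<in>X. \<Phi> x \<in> - \<Psi> ` Y} = emeasure \<nu> {y\<in>Y. \<Psi> y \<in> - \<Psi> ` Y}"
    by (rule coding_same_law[OF c s d r B])
  also have "{y\<in>Y. \<Psi> y \<in> - \<Psi> ` Y} = {}" by auto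
  finally have "{x\<in>X. \<Phi> x \<in> - \<Psi> ` Y} \<in> null_sets \<mu>"
    using coding_measurable(3)[OF c s B] by (simp add: null_sets_def)
  moreover have "space \<mu> - X \<in> null_sets \<mu>" using c by (simp add: dyadic_coding_def full_measure_def)
  ultimately have "(space \<mu> - X) \<union> {x\<in>X. \<Phi> x \<in> - \<Psi> ` Y} \<in> null_sets \<mu>" by blast
  moreover have "X \<subseteq> space \<mu>" using c by (simp add: dyadic_coding_def full_measure_def)
  then have "(space \<mu> - X) \<union> {x\<in>X. \<Phi> x \<in> - \<Psi> ` Y} = space \<mu> - X'" by (auto simp: X'_def)
  ultimately show "full_measure \<mu> X'" using \<open>X \<subseteq> space \<mu>\<close> by (auto simp: full_measure_def X'_def)
qed

text \<open>The map sends a point of \<open>X\<close> to the point of \<open>Y\<close> with the same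
  code. Orbits correspond because both orbits have the same dyadic class as their image.\<close>
lemma coding_orbit_equivalence:
  fixes \<mu> :: "'a::polish_space measure" and \<nu> :: "'b::polish_space measure"
  assumes c: "dyadic_coding \<mu> T X \<Phi>" and s: "sets \<mu> = sets borel" and T: "bij T"
    and d: "dyadic_coding \<nu> S Y \<Psi>" and r: "sets \<nu> = sets borel" and S: "bij S"
  shows "\<exists>X' Y' \<phi> \<psi>.
      gdelta X' \<and> gdelta Y' \<and> T ` X' = X' \<and> S ` Y' = Y' \<and>
      full_measure \<mu> X' \<and> full_measure \<nu> Y' \<and> homeomorphism X' Y' \<phi> \<psi> \<and>
      measure_preserving_map (restrict_space \<mu> X') (restrict_space \<nu> Y') \<phi> \<and>
      (\<forall>x\<in>X'. \<phi> ` int_orbit T x = int_orbit S (\<phi> x))"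
proof -
  obtain \<Theta> where \<Theta>: "homeomorphism X (\<Phi> ` X) \<Phi> \<Theta>" using c by (auto simp: dyadic_coding_def)
  obtain \<Xi> where \<Xi>: "homeomorphism Y (\<Psi> ` Y) \<Psi> \<Xi>" using d by (auto simp: dyadic_coding_def)
  define X' where "X' = {x\<in>X. \<Phi> x \<in> \<Psi> ` Y}"
  define Y' where "Y' = {y\<in>Y. \<Psi> y \<in> \<Phi> ` X}"
  define Z where "Z = \<Phi> ` X \<inter> \<Psi> ` Y"
  define \<phi> where "\<phi> = \<Xi> \<circ> \<Phi>"
  define \<psi> where "\<psi> = \<Theta> \<circ> \<Psi>"
  note X' = coding_domain[OF c s T d r S, folded X'_def] and Y' = coding_domain[OF d r S c s T, folded Y'_def]
  have "homeomorphism X' Z \<Phi> \<Theta>"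
  proof (rule homeomorphism_of_subsets[OF \<Theta>])
    show "\<Phi> ` X' = Z" unfolding X'_def Z_def by blast
  qed (auto simp: X'_def Z_def)
  moreover have "homeomorphism Y' Z \<Psi> \<Xi>"
  proof (rule homeomorphism_of_subsets[OF \<Xi>])
    show "\<Psi> ` Y' = Z"
    proof
      show "Z \<subseteq> \<Psi> ` Y'"
      proof
        fix z assume "z \<in> Z"
        then obtain y where "y \<in> Y" "z = \<Psi> y" "z \<in> \<Phi> ` X" unfolding Z_def by blast
        then show "z \<in> \<Psi> ` Y'" unfolding Y'_def by blast
      qed
    qed (auto simp: Y'_def Z_def)
  qed (auto simp: Y'_def Z_def)
  ultimately have hom: "homeomorphism X' Y' \<phi> \<psi>" unfolding \<phi>_def \<psi>_def
    by (meson homeomorphism_compose homeomorphism_symD)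
  have \<phi>: "\<phi> x \<in> Y'" "\<Psi> (\<phi> x) = \<Phi> x" if "x \<in> X'" for x
  proof -
    show "\<phi> x \<in> Y'" using hom that by (auto simp: homeomorphism_def)
    show "\<Psi> (\<phi> x) = \<Phi> x" using that \<Xi> by (auto simp: X'_def \<phi>_def homeomorphism_def)
  qed
  have \<Xi>\<Psi>: "\<Xi> (\<Psi> y) = y" if "y \<in> Y" for y using \<Xi> that by (simp add: homeomorphism_def)
  have orb: "\<phi> ` int_orbit T x = int_orbit S (\<phi> x)" if x: "x \<in> X'" for x
  proof -
    have xX: "x \<in> X" and yY: "\<phi> x \<in> Y" using x \<phi>(1)[OF x] by (auto simp: X'_def Y'_def)
    have "\<Phi> ` int_orbit T x = \<Psi> ` int_orbit S (\<phi> x)"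
      using c d xX yY \<phi>(2)[OF x] by (simp add: dyadic_coding_def)
    then have "\<Xi> ` \<Phi> ` int_orbit T x = \<Xi> ` \<Psi> ` int_orbit S (\<phi> x)" by simp
    moreover have "int_orbit S (\<phi> x) \<subseteq> Y" using d S yY by (intro int_orbit_subset) (auto simp: dyadic_coding_def)
    then have "\<Xi> ` \<Psi> ` int_orbit S (\<phi> x) = int_orbit S (\<phi> x)" using \<Xi>\<Psi> by (force simp: image_image)
    ultimately show ?thesis by (simp add: \<phi>_def image_comp)
  qed
  have sX: "X' \<in> sets \<mu>" and sY: "Y' \<in> sets \<nu>" using gdelta_borel[OF X'(1)] gdelta_borel[OF Y'(1)] s r by auto
  have spm: "space \<mu> = UNIV" and spn: "space \<nu> = UNIV"
    using sets_eq_imp_space_eq[OF s] sets_eq_imp_space_eq[OF r] by auto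
  have meas: "\<phi> \<in> measurable (restrict_space \<mu> X') (restrict_space \<nu> Y')"
  proof (rule measurable_restrict_space2)
    show "\<phi> \<in> space (restrict_space \<mu> X') \<rightarrow> Y'" using \<phi>(1) by (auto simp: space_restrict_space)
    have "continuous_on X' \<phi>" using hom by (simp add: homeomorphism_def)
    then have "\<phi> \<in> borel_measurable (restrict_space borel X')" by (rule borel_measurable_continuous_on_restrict)
    then show "\<phi> \<in> measurable (restrict_space \<mu> X') \<nu>"
      using measurable_cong_sets[OF sets_restrict_space_cong[OF s] r] by blast
  qed
  have "distr (restrict_space \<mu> X') (restrict_space \<nu> Y') \<phi> = restrict_space \<nu> Y'"
  proof (rule measure_eqI)
    fix B assume "B \<in> sets (distr (restrict_space \<mu> X') (restrict_space \<nu> Y') \<phi>)"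
    then have B: "B \<in> sets (restrict_space \<nu> Y')" by simp
    then have BY: "B \<subseteq> Y'" "B \<in> sets \<nu>" using sY spn by (auto simp: sets_restrict_space_iff)
    have YsubY: "Y' \<subseteq> Y" by (auto simp: Y'_def)
    \<comment> \<open>Both measures of \<open>B\<close> are read off from its set \<open>C\<close> of codes, which is Borel as a preimage under the continuous decoding.\<close>
    define C where "C = \<Psi> ` B"
    have C: "C \<in> sets borel"
    proof -
      have "continuous_on (\<Psi> ` Y) \<Xi>" using \<Xi> by (simp add: homeomorphism_def)
      then have m: "\<Xi> \<in> borel_measurable (restrict_space borel (\<Psi> ` Y))" by (rule borel_measurable_continuous_on_restrict)
      have g: "\<Psi> ` Y \<in> sets borel"
        using gdelta_borel[OF gdelta_homeomorphic_image[OF \<Xi>]] d by (simp add: dyadic_coding_def)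
      have "\<Xi> -` B \<inter> space (restrict_space borel (\<Psi> ` Y)) \<in> sets (restrict_space borel (\<Psi> ` Y))"
        by (rule measurable_sets[OF m]) (use BY(2) r in simp)
      then have "\<Xi> -` B \<inter> \<Psi> ` Y \<in> sets borel" using g by (simp add: sets_restrict_space_iff space_restrict_space)
      moreover have "\<Xi> -` B \<inter> \<Psi> ` Y = C" using BY(1) YsubY \<Xi>\<Psi> unfolding C_def by force
      ultimately show ?thesis by simp
    qed
    have inY: "y \<in> B" if "y \<in> Y" "\<Psi> y \<in> C" for y
      using that BY(1) YsubY \<Xi>\<Psi> unfolding C_def by (metis imageE subsetD)
    have 1: "\<phi> -` B \<inter> space (restrict_space \<mu> X') = {x\<in>X. \<Phi> x \<in> C}"
    proof (intro equalityI subsetI)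
      fix x assume "x \<in> \<phi> -` B \<inter> space (restrict_space \<mu> X')"
      then have "x \<in> X'" "\<phi> x \<in> B" by (auto simp: space_restrict_space)
      then show "x \<in> {x\<in>X. \<Phi> x \<in> C}" using \<phi>(2)[of x] by (auto simp: C_def X'_def intro: rev_image_eqI)
    next
      fix x assume x: "x \<in> {x\<in>X. \<Phi> x \<in> C}"
      then have x': "x \<in> X'" using BY(1) YsubY by (auto simp: X'_def C_def)
      then have "\<phi> x \<in> B" using x \<phi>[OF x'] YsubY by (intro inY) auto
      then show "x \<in> \<phi> -` B \<inter> space (restrict_space \<mu> X')" using x' by (simp add: space_restrict_space spm)
    qed
    have 2: "{y\<in>Y. \<Psi> y \<in> C} = B" using inY BY(1) YsubY by (auto simp: C_def)
    have "emeasure (distr (restrict_space \<mu> X') (restrict_space \<nu> Y') \<phi>) B = emeasure (restrict_space \<mu> X') {x\<in>X. \<Phi> x \<in> C}"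
      using emeasure_distr[OF meas B] unfolding 1 .
    also have "\<dots> = emeasure \<mu> {x\<in>X. \<Phi> x \<in> C}"
      using sX unfolding 1[symmetric] by (intro emeasure_restrict_space) (auto simp: space_restrict_space spm)
    also have "\<dots> = emeasure \<nu> B" using coding_same_law[OF c s d r C] unfolding 2 .
    also have "\<dots> = emeasure (restrict_space \<nu> Y') B"
      using sY BY(1) by (intro emeasure_restrict_space[symmetric]) (auto simp: spn)
    finally show "emeasure (distr (restrict_space \<mu> X') (restrict_space \<nu> Y') \<phi>) B = emeasure (restrict_space \<nu> Y') B" .
  qed simp
  then have "measure_preserving_map (restrict_space \<mu> X') (restrict_space \<nu> Y') \<phi>"
    using meas by (simp add: measure_preserving_map_def)
  then show ?thesis using X' Y' hom orb by blast
qed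

theorem theorem3:
  fixes \<mu> :: "'a::polish_space measure" and \<nu> :: "'b::polish_space measure"
    and T :: "'a \<Rightarrow> 'a" and S :: "'b \<Rightarrow> 'b"
  assumes "sets \<mu> = sets borel" and "sets \<nu> = sets borel"
    and "sigma_finite_measure \<mu>" and "sigma_finite_measure \<nu>"
    and "nonatomic \<mu>" and "nonatomic \<nu>"
    and "emeasure \<mu> (space \<mu>) = \<infinity>" and "emeasure \<nu> (space \<nu>) = \<infinity>"
    and "\<exists>U. open U \<and> 0 < emeasure \<mu> U \<and> emeasure \<mu> U < \<infinity>"
    and "\<exists>V. open V \<and> 0 < emeasure \<nu> V \<and> emeasure \<nu> V < \<infinity>"
    and "self_homeomorphism T" and "self_homeomorphism S"
    and "measure_preserving_map \<mu> \<mu> T" and "measure_preserving_map \<nu> \<nu> S"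
    and "ergodic \<mu> T" and "ergodic \<nu> S"
  shows "\<exists>X' Y' \<phi> \<psi>.
      gdelta X' \<and> gdelta Y' \<and>
      T ` X' = X' \<and> S ` Y' = Y' \<and>
      full_measure \<mu> X' \<and> full_measure \<nu> Y' \<and>
      homeomorphism X' Y' \<phi> \<psi> \<and>
      measure_preserving_map (restrict_space \<mu> X') (restrict_space \<nu> Y') \<phi> \<and>
      (\<forall>x\<in>X'. \<phi> ` int_orbit T x = int_orbit S (\<phi> x))"
proof -
  interpret X: polish_ergodic \<mu> T by (rule polish_ergodic.intro) fact+
  interpret Y: polish_ergodic \<nu> S by (rule polish_ergodic.intro) fact+
  obtain X \<Phi> Y \<Psi> where "dyadic_coding \<mu> T X \<Phi>" "dyadic_coding \<nu> S Y \<Psi>"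
    using X.ex_coding Y.ex_coding by blast
  then show ?thesis
    using coding_orbit_equivalence[OF _ assms(1) X.bij_T _ assms(2) Y.bij_T] by blast
qed

end
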